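(* The 2-category $\mathcal{C}$ of small categories admits weighted pseudo limits: for every small 2-category $\mathcal{D}$ and all pseudo functors $J:\mathcal{D}\to Cat$ and $F:\mathcal{D}\to\mathcal{C}$, there exists a $J$-weighted pseudo limit $\{J,F\}_p$ of $F$ in $\mathcal{C}$.
   Context: $\mathcal{C}=Cat$ has small categories as objects, functors as morphisms and natural transformations as 2-cells. Pseudo functors and pseudo natural transformations have invertible coherence 2-cells. $Hom[\mathcal{D},Cat]$ is the 2-category of pseudo functors $\mathcal{D}\to Cat$, pseudo natural transformations and modifications. An object $\{J,F\}_p$ of $\mathcal{C}$ is a $J$-weighted pseudo limit of $F$ if the strict 2-functors $\mathcal{C}^{op}\to Cat$, $C\mapsto\mathcal{C}(C,\{J,F\}_p)$ and $C\mapsto Hom[\mathcal{D},Cat](J,\mathcal{C}(C,F-))$, are 2-naturally isomorphic. *)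

theory Defs
  imports Main "HOL-Library.FuncSet"
begin

section \<open>Universe of sets\<close>

text \<open>
  Smallness is relative to a universe: a type whose elements are sets, membership being given by
  \<open>elts\<close>, and satisfying extensionality, separation, union, power set and replacement. A collection
  of elements is small if it is the extension of an element. Foundation and infinity are not
  needed and hence not assumed: every model of ZFC is an instance, and so are
  the hereditarily finite sets.
\<close>

definition small :: "('u \<Rightarrow> 'u set) \<Rightarrow> 'u set \<Rightarrow> bool" where
  "small elts X \<longleftrightarrow> X \<in> range elts"

locale set_universe =
  fixes elts :: "'u \<Rightarrow> 'u set"
  assumes extensionality: "elts x = elts y \<Longrightarrow> x = y"
    and separation: "small elts X \<Longrightarrow> Y \<subseteq> X \<Longrightarrow> small elts Y"
    and union: "small elts X \<Longrightarrow> small elts (\<Union>x\<in>X. elts x)"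
    and power_set: "small elts {y. elts y \<subseteq> elts x}"
    and replacement: "small elts X \<Longrightarrow> small elts (f ` X)"

lemma set_universe_hereditarily_finite: "set_universe (\<lambda>n::nat. {i. bit n i})"
proof -
  let ?e = "\<lambda>n::nat. {i. bit n i}"
  have fin: "finite (?e n)" for n
  proof (rule finite_subset)
    show "?e n \<subseteq> {..n}"
    proof
      fix i assume "i \<in> ?e n"
      then have "2 ^ i \<le> n"
        by (metis bit_iff_odd div_less even_zero mem_Collect_eq not_le)
      then show "i \<in> {..n}" by (meson atMost_iff less_exp less_imp_le_nat order_trans)
    qed
  qed simp
  have ex: "\<exists>n. ?e n = X" if "finite X" for X
    using that
  proof (induction X)
    case empty
    have "?e 0 = {}" by simp
    then show ?case by blast
  next
    case (insert x X)
    then obtain n where "?e n = X" by blast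
    then have "?e (set_bit x n) = insert x X" by (auto simp: bit_set_bit_iff)
    then show ?case by blast
  qed
  have small: "small ?e X \<longleftrightarrow> finite X" for X
    using fin ex unfolding small_def by (metis rangeE rangeI)
  have ext: "x = y" if "?e x = ?e y" for x y
    using that by (intro bit_eqI) blast
  have "finite {y. ?e y \<subseteq> ?e x}" for x
    by (rule inj_on_finite[where f = ?e and B = "Pow (?e x)"]) (auto simp: fin inj_on_def intro: ext)
  then show ?thesis
    by unfold_locales (auto simp: small fin intro: ext finite_subset)
qed


section \<open>Categories, functors and natural transformations\<close>

record ('o, 'a) cat =
  Obj :: "'o set"
  Arr :: "'a set"
  Dom :: "'a \<Rightarrow> 'o"
  Cod :: "'a \<Rightarrow> 'o"
  Ident :: "'o \<Rightarrow> 'a"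
  Comp :: "'a \<Rightarrow> 'a \<Rightarrow> 'a"  \<comment> \<open>\<open>Comp A g f\<close> is \<open>g\<close> after \<open>f\<close>\<close>

definition arrows :: "('o, 'a) cat \<Rightarrow> 'o \<Rightarrow> 'o \<Rightarrow> 'a set" where
  "arrows A x y = {f \<in> Arr A. Dom A f = x \<and> Cod A f = y}"

locale category =
  fixes A :: "('o, 'a) cat"
  assumes dom_obj: "f \<in> Arr A \<Longrightarrow> Dom A f \<in> Obj A"
    and cod_obj: "f \<in> Arr A \<Longrightarrow> Cod A f \<in> Obj A"
    and ident: "x \<in> Obj A \<Longrightarrow> Ident A x \<in> arrows A x x"
    and comp: "f \<in> arrows A x y \<Longrightarrow> g \<in> arrows A y z \<Longrightarrow> Comp A g f \<in> arrows A x z"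
    and comp_ident_right: "f \<in> arrows A x y \<Longrightarrow> Comp A f (Ident A x) = f"
    and comp_ident_left: "f \<in> arrows A x y \<Longrightarrow> Comp A (Ident A y) f = f"
    and comp_assoc: "f \<in> arrows A w x \<Longrightarrow> g \<in> arrows A x y \<Longrightarrow> h \<in> arrows A y z \<Longrightarrow>
      Comp A h (Comp A g f) = Comp A (Comp A h g) f"

definition small_category :: "('u \<Rightarrow> 'u set) \<Rightarrow> ('u, 'u) cat \<Rightarrow> bool" where
  "small_category elts A \<longleftrightarrow> category A \<and> small elts (Obj A) \<and> small elts (Arr A)"

definition iso_arrow :: "('o, 'a) cat \<Rightarrow> 'o \<Rightarrow> 'o \<Rightarrow> 'a \<Rightarrow> bool" where
  "iso_arrow A x y f \<longleftrightarrow> f \<in> arrows A x y \<and>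
    (\<exists>g \<in> arrows A y x. Comp A g f = Ident A x \<and> Comp A f g = Ident A y)"

text \<open>
  Functors, natural transformations, and below pseudo natural transformations and modifications,
  are themselves elements of objects and arrows of categories. Their component maps are therefore
  required to be extensional (with value \<open>undefined\<close> outside the intended domain), so that
  HOL equality is the intended equality.
\<close>

record ('o, 'a, 'p, 'b) functr =
  FO :: "'o \<Rightarrow> 'p"
  FA :: "'a \<Rightarrow> 'b"

definition mk_functor :: "('o, 'a) cat \<Rightarrow> ('o \<Rightarrow> 'p) \<Rightarrow> ('a \<Rightarrow> 'b) \<Rightarrow> ('o, 'a, 'p, 'b) functr" where
  "mk_functor A fo fa = \<lparr>FO = restrict fo (Obj A), FA = restrict fa (Arr A)\<rparr>"

definition is_functor ::
    "('o, 'a) cat \<Rightarrow> ('p, 'b) cat \<Rightarrow> ('o, 'a, 'p, 'b) functr \<Rightarrow> bool" where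
  "is_functor A B F \<longleftrightarrow>
    FO F \<in> extensional (Obj A) \<and> FA F \<in> extensional (Arr A) \<and>
    (\<forall>x \<in> Obj A. FO F x \<in> Obj B) \<and>
    (\<forall>x y. \<forall>f \<in> arrows A x y. FA F f \<in> arrows B (FO F x) (FO F y)) \<and>
    (\<forall>x \<in> Obj A. FA F (Ident A x) = Ident B (FO F x)) \<and>
    (\<forall>x y z. \<forall>f \<in> arrows A x y. \<forall>g \<in> arrows A y z.
      FA F (Comp A g f) = Comp B (FA F g) (FA F f))"

definition id_functor :: "('o, 'a) cat \<Rightarrow> ('o, 'a, 'o, 'a) functr" where
  "id_functor A = mk_functor A (\<lambda>x. x) (\<lambda>f. f)"

text \<open>\<open>fcomp A G F\<close> is \<open>G\<close> after \<open>F\<close>, where \<open>F\<close> has domain \<open>A\<close>.\<close>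

definition fcomp :: "('o, 'a) cat \<Rightarrow> ('p, 'b, 'q, 'c) functr \<Rightarrow> ('o, 'a, 'p, 'b) functr \<Rightarrow>
    ('o, 'a, 'q, 'c) functr" where
  "fcomp A G F = mk_functor A (\<lambda>x. FO G (FO F x)) (\<lambda>f. FA G (FA F f))"

definition iso_functor ::
    "('o, 'a) cat \<Rightarrow> ('p, 'b) cat \<Rightarrow> ('o, 'a, 'p, 'b) functr \<Rightarrow> bool" where
  "iso_functor A B F \<longleftrightarrow> is_functor A B F \<and>
    (\<exists>G. is_functor B A G \<and> fcomp A G F = id_functor A \<and> fcomp B F G = id_functor B)"

record ('o, 'a, 'p, 'b) nt =
  NDom :: "('o, 'a, 'p, 'b) functr"
  NCod :: "('o, 'a, 'p, 'b) functr"
  NAt :: "'o \<Rightarrow> 'b"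

definition mk_nt :: "('o, 'a) cat \<Rightarrow> ('o, 'a, 'p, 'b) functr \<Rightarrow> ('o, 'a, 'p, 'b) functr \<Rightarrow>
    ('o \<Rightarrow> 'b) \<Rightarrow> ('o, 'a, 'p, 'b) nt" where
  "mk_nt A F G t = \<lparr>NDom = F, NCod = G, NAt = restrict t (Obj A)\<rparr>"

definition is_nt :: "('o, 'a) cat \<Rightarrow> ('p, 'b) cat \<Rightarrow> ('o, 'a, 'p, 'b) nt \<Rightarrow> bool" where
  "is_nt A B t \<longleftrightarrow>
    is_functor A B (NDom t) \<and> is_functor A B (NCod t) \<and> NAt t \<in> extensional (Obj A) \<and>
    (\<forall>x \<in> Obj A. NAt t x \<in> arrows B (FO (NDom t) x) (FO (NCod t) x)) \<and>
    (\<forall>x y. \<forall>f \<in> arrows A x y.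
      Comp B (NAt t y) (FA (NDom t) f) = Comp B (FA (NCod t) f) (NAt t x))"

definition functor_cat :: "('o, 'a) cat \<Rightarrow> ('p, 'b) cat \<Rightarrow>
    (('o, 'a, 'p, 'b) functr, ('o, 'a, 'p, 'b) nt) cat" where
  "functor_cat A B =
    \<lparr>Obj = {F. is_functor A B F},
     Arr = {t. is_nt A B t},
     Dom = NDom,
     Cod = NCod,
     Ident = (\<lambda>F. mk_nt A F F (\<lambda>x. Ident B (FO F x))),
     Comp = (\<lambda>s t. mk_nt A (NDom t) (NCod s) (\<lambda>x. Comp B (NAt s x) (NAt t x)))\<rparr>"

text \<open>
  In the following operations, \<open>A\<close> is the domain of the composite functors; \<open>hcomp A C s t\<close> is the
  horizontal composite of \<open>t\<close>, between functors from \<open>A\<close>, with \<open>s\<close>, between functors to \<open>C\<close>.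
\<close>

definition hcomp :: "('o, 'a) cat \<Rightarrow> ('q, 'c) cat \<Rightarrow> ('p, 'b, 'q, 'c) nt \<Rightarrow> ('o, 'a, 'p, 'b) nt \<Rightarrow>
    ('o, 'a, 'q, 'c) nt" where
  "hcomp A C s t = mk_nt A (fcomp A (NDom s) (NDom t)) (fcomp A (NCod s) (NCod t))
    (\<lambda>x. Comp C (NAt s (FO (NCod t) x)) (FA (NDom s) (NAt t x)))"

definition whisker_left :: "('o, 'a) cat \<Rightarrow> ('p, 'b, 'q, 'c) functr \<Rightarrow> ('o, 'a, 'p, 'b) nt \<Rightarrow>
    ('o, 'a, 'q, 'c) nt" where
  "whisker_left A H t = mk_nt A (fcomp A H (NDom t)) (fcomp A H (NCod t)) (\<lambda>x. FA H (NAt t x))"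

definition whisker_right :: "('o, 'a) cat \<Rightarrow> ('p, 'b, 'q, 'c) nt \<Rightarrow> ('o, 'a, 'p, 'b) functr \<Rightarrow>
    ('o, 'a, 'q, 'c) nt" where
  "whisker_right A s H = mk_nt A (fcomp A (NDom s) H) (fcomp A (NCod s) H) (\<lambda>x. NAt s (FO H x))"


section \<open>2-categories\<close>

text \<open>
  Hom-categories for different pairs of objects need not be disjoint, so the compositions
  carry the objects: \<open>Comp1 K a b c g f\<close> composes \<open>f\<close> from \<open>a\<close> to \<open>b\<close> with \<open>g\<close> from \<open>b\<close> to \<open>c\<close>, and
  \<open>Comp2\<close> is the horizontal composition of 2-cells. Vertical composition is the
  composition of the hom-categories.
\<close>

record ('o, 'm, 'c) two_cat =
  Ob :: "'o set"
  Hom :: "'o \<Rightarrow> 'o \<Rightarrow> ('m, 'c) cat"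
  One :: "'o \<Rightarrow> 'm"
  Comp1 :: "'o \<Rightarrow> 'o \<Rightarrow> 'o \<Rightarrow> 'm \<Rightarrow> 'm \<Rightarrow> 'm"
  Comp2 :: "'o \<Rightarrow> 'o \<Rightarrow> 'o \<Rightarrow> 'c \<Rightarrow> 'c \<Rightarrow> 'c"

abbreviation Id2 :: "('o, 'm, 'c) two_cat \<Rightarrow> 'o \<Rightarrow> 'o \<Rightarrow> 'm \<Rightarrow> 'c" where
  "Id2 K a b f \<equiv> Ident (Hom K a b) f"

locale two_category =
  fixes K :: "('o, 'm, 'c) two_cat"
  assumes hom_category: "a \<in> Ob K \<Longrightarrow> b \<in> Ob K \<Longrightarrow> category (Hom K a b)"
    and one: "a \<in> Ob K \<Longrightarrow> One K a \<in> Obj (Hom K a a)"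
    and comp1: "a \<in> Ob K \<Longrightarrow> b \<in> Ob K \<Longrightarrow> c \<in> Ob K \<Longrightarrow>
      f \<in> Obj (Hom K a b) \<Longrightarrow> g \<in> Obj (Hom K b c) \<Longrightarrow> Comp1 K a b c g f \<in> Obj (Hom K a c)"
    and comp2: "a \<in> Ob K \<Longrightarrow> b \<in> Ob K \<Longrightarrow> c \<in> Ob K \<Longrightarrow>
      s \<in> arrows (Hom K a b) f f' \<Longrightarrow> t \<in> arrows (Hom K b c) g g' \<Longrightarrow>
      Comp2 K a b c t s \<in> arrows (Hom K a c) (Comp1 K a b c g f) (Comp1 K a b c g' f')"
    and comp2_ident: "a \<in> Ob K \<Longrightarrow> b \<in> Ob K \<Longrightarrow> c \<in> Ob K \<Longrightarrow>
      f \<in> Obj (Hom K a b) \<Longrightarrow> g \<in> Obj (Hom K b c) \<Longrightarrow>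
      Comp2 K a b c (Id2 K b c g) (Id2 K a b f) = Id2 K a c (Comp1 K a b c g f)"
    and interchange: "a \<in> Ob K \<Longrightarrow> b \<in> Ob K \<Longrightarrow> c \<in> Ob K \<Longrightarrow>
      s \<in> arrows (Hom K a b) f f' \<Longrightarrow> s' \<in> arrows (Hom K a b) f' f'' \<Longrightarrow>
      t \<in> arrows (Hom K b c) g g' \<Longrightarrow> t' \<in> arrows (Hom K b c) g' g'' \<Longrightarrow>
      Comp2 K a b c (Comp (Hom K b c) t' t) (Comp (Hom K a b) s' s) =
      Comp (Hom K a c) (Comp2 K a b c t' s') (Comp2 K a b c t s)"
    and comp1_one_right: "a \<in> Ob K \<Longrightarrow> b \<in> Ob K \<Longrightarrow> f \<in> Obj (Hom K a b) \<Longrightarrow>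
      Comp1 K a a b f (One K a) = f"
    and comp1_one_left: "a \<in> Ob K \<Longrightarrow> b \<in> Ob K \<Longrightarrow> f \<in> Obj (Hom K a b) \<Longrightarrow>
      Comp1 K a b b (One K b) f = f"
    and comp1_assoc: "a \<in> Ob K \<Longrightarrow> b \<in> Ob K \<Longrightarrow> c \<in> Ob K \<Longrightarrow> d \<in> Ob K \<Longrightarrow>
      f \<in> Obj (Hom K a b) \<Longrightarrow> g \<in> Obj (Hom K b c) \<Longrightarrow> h \<in> Obj (Hom K c d) \<Longrightarrow>
      Comp1 K a c d h (Comp1 K a b c g f) = Comp1 K a b d (Comp1 K b c d h g) f"
    and comp2_one_right: "a \<in> Ob K \<Longrightarrow> b \<in> Ob K \<Longrightarrow> s \<in> Arr (Hom K a b) \<Longrightarrow>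
      Comp2 K a a b s (Id2 K a a (One K a)) = s"
    and comp2_one_left: "a \<in> Ob K \<Longrightarrow> b \<in> Ob K \<Longrightarrow> s \<in> Arr (Hom K a b) \<Longrightarrow>
      Comp2 K a b b (Id2 K b b (One K b)) s = s"
    and comp2_assoc: "a \<in> Ob K \<Longrightarrow> b \<in> Ob K \<Longrightarrow> c \<in> Ob K \<Longrightarrow> d \<in> Ob K \<Longrightarrow>
      r \<in> Arr (Hom K a b) \<Longrightarrow> s \<in> Arr (Hom K b c) \<Longrightarrow> t \<in> Arr (Hom K c d) \<Longrightarrow>
      Comp2 K a c d t (Comp2 K a b c s r) = Comp2 K a b d (Comp2 K b c d t s) r"

definition small_two_category :: "('u \<Rightarrow> 'u set) \<Rightarrow> ('u, 'u, 'u) two_cat \<Rightarrow> bool" where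
  "small_two_category elts D \<longleftrightarrow> two_category D \<and> small elts (Ob D) \<and>
    (\<forall>a \<in> Ob D. \<forall>b \<in> Ob D. small_category elts (Hom D a b))"

definition op2 :: "('o, 'm, 'c) two_cat \<Rightarrow> ('o, 'm, 'c) two_cat" where
  "op2 K =
    \<lparr>Ob = Ob K,
     Hom = (\<lambda>a b. Hom K b a),
     One = One K,
     Comp1 = (\<lambda>a b c g f. Comp1 K c b a f g),
     Comp2 = (\<lambda>a b c t s. Comp2 K c b a s t)\<rparr>"

text \<open>
  The 2-category of all categories over given types of objects and arrows which satisfy \<open>P\<close>.
\<close>

definition Cat_of :: "(('o, 'a) cat \<Rightarrow> bool) \<Rightarrow>
    (('o, 'a) cat, ('o, 'a, 'o, 'a) functr, ('o, 'a, 'o, 'a) nt) two_cat" where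
  "Cat_of P =
    \<lparr>Ob = {A. P A},
     Hom = functor_cat,
     One = id_functor,
     Comp1 = (\<lambda>A B C G F. fcomp A G F),
     Comp2 = (\<lambda>A B C s t. hcomp A C s t)\<rparr>"

definition Cat :: "('u \<Rightarrow> 'u set) \<Rightarrow>
    (('u, 'u) cat, ('u, 'u, 'u, 'u) functr, ('u, 'u, 'u, 'u) nt) two_cat" where
  "Cat elts = Cat_of (small_category elts)"

text \<open>
  The hom-categories of a 2-category and the categories of pseudo natural transformations
  are categories over other types than \<open>'u\<close>; 2-functors formed from them take values in \<open>CAT\<close>.
\<close>

definition CAT :: "(('o, 'a) cat, ('o, 'a, 'o, 'a) functr, ('o, 'a, 'o, 'a) nt) two_cat" where
  "CAT = Cat_of category"


section \<open>2-functors and pseudo functors\<close>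

text \<open>\<open>P1 F a b\<close> is the functor from \<open>Hom K a b\<close> to \<open>Hom L (P0 F a) (P0 F b)\<close>.\<close>

record ('o, 'm, 'c, 'p, 'n, 'd) two_functr =
  P0 :: "'o \<Rightarrow> 'p"
  P1 :: "'o \<Rightarrow> 'o \<Rightarrow> ('m, 'c, 'n, 'd) functr"

definition two_functor :: "('o, 'm, 'c) two_cat \<Rightarrow> ('p, 'n, 'd) two_cat \<Rightarrow>
    ('o, 'm, 'c, 'p, 'n, 'd) two_functr \<Rightarrow> bool" where
  "two_functor K L F \<longleftrightarrow>
    (\<forall>a \<in> Ob K. P0 F a \<in> Ob L) \<and>
    (\<forall>a \<in> Ob K. \<forall>b \<in> Ob K. is_functor (Hom K a b) (Hom L (P0 F a) (P0 F b)) (P1 F a b)) \<and>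
    (\<forall>a \<in> Ob K. FO (P1 F a a) (One K a) = One L (P0 F a)) \<and>
    (\<forall>a \<in> Ob K. \<forall>b \<in> Ob K. \<forall>c \<in> Ob K. \<forall>f \<in> Obj (Hom K a b). \<forall>g \<in> Obj (Hom K b c).
      FO (P1 F a c) (Comp1 K a b c g f) =
      Comp1 L (P0 F a) (P0 F b) (P0 F c) (FO (P1 F b c) g) (FO (P1 F a b) f)) \<and>
    (\<forall>a \<in> Ob K. \<forall>b \<in> Ob K. \<forall>c \<in> Ob K. \<forall>s \<in> Arr (Hom K a b). \<forall>t \<in> Arr (Hom K b c).
      FA (P1 F a c) (Comp2 K a b c t s) =
      Comp2 L (P0 F a) (P0 F b) (P0 F c) (FA (P1 F b c) t) (FA (P1 F a b) s))"

text \<open>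
  The coherence cells are \<open>PUnit F a\<close>, from the identity of \<open>F a\<close> to the image of the
  identity of \<open>a\<close>, and \<open>PComp F a b c g f\<close>, from \<open>F g \<circ> F f\<close> to \<open>F (g \<circ> f)\<close>.
\<close>

record ('o, 'm, 'c, 'p, 'n, 'd) pseudo_functr = "('o, 'm, 'c, 'p, 'n, 'd) two_functr" +
  PUnit :: "'o \<Rightarrow> 'd"
  PComp :: "'o \<Rightarrow> 'o \<Rightarrow> 'o \<Rightarrow> 'm \<Rightarrow> 'm \<Rightarrow> 'd"

locale pseudo_functor =
  fixes K :: "('o, 'm, 'c) two_cat" and L :: "('p, 'n, 'd) two_cat"
    and F :: "('o, 'm, 'c, 'p, 'n, 'd) pseudo_functr"
  assumes ob: "a \<in> Ob K \<Longrightarrow> P0 F a \<in> Ob L"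
    and local_functor: "a \<in> Ob K \<Longrightarrow> b \<in> Ob K \<Longrightarrow>
      is_functor (Hom K a b) (Hom L (P0 F a) (P0 F b)) (P1 F a b)"
    and unit_iso: "a \<in> Ob K \<Longrightarrow>
      iso_arrow (Hom L (P0 F a) (P0 F a)) (One L (P0 F a)) (FO (P1 F a a) (One K a)) (PUnit F a)"
    and comp_iso: "a \<in> Ob K \<Longrightarrow> b \<in> Ob K \<Longrightarrow> c \<in> Ob K \<Longrightarrow>
      f \<in> Obj (Hom K a b) \<Longrightarrow> g \<in> Obj (Hom K b c) \<Longrightarrow>
      iso_arrow (Hom L (P0 F a) (P0 F c))
        (Comp1 L (P0 F a) (P0 F b) (P0 F c) (FO (P1 F b c) g) (FO (P1 F a b) f))
        (FO (P1 F a c) (Comp1 K a b c g f)) (PComp F a b c g f)"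
    and comp_natural: "a \<in> Ob K \<Longrightarrow> b \<in> Ob K \<Longrightarrow> c \<in> Ob K \<Longrightarrow>
      s \<in> arrows (Hom K a b) f f' \<Longrightarrow> t \<in> arrows (Hom K b c) g g' \<Longrightarrow>
      Comp (Hom L (P0 F a) (P0 F c)) (PComp F a b c g' f')
        (Comp2 L (P0 F a) (P0 F b) (P0 F c) (FA (P1 F b c) t) (FA (P1 F a b) s)) =
      Comp (Hom L (P0 F a) (P0 F c)) (FA (P1 F a c) (Comp2 K a b c t s)) (PComp F a b c g f)"
    and assoc_coherence: "a \<in> Ob K \<Longrightarrow> b \<in> Ob K \<Longrightarrow> c \<in> Ob K \<Longrightarrow> d \<in> Ob K \<Longrightarrow>
      f \<in> Obj (Hom K a b) \<Longrightarrow> g \<in> Obj (Hom K b c) \<Longrightarrow> h \<in> Obj (Hom K c d) \<Longrightarrow>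
      Comp (Hom L (P0 F a) (P0 F d)) (PComp F a b d (Comp1 K b c d h g) f)
        (Comp2 L (P0 F a) (P0 F b) (P0 F d) (PComp F b c d h g)
          (Id2 L (P0 F a) (P0 F b) (FO (P1 F a b) f))) =
      Comp (Hom L (P0 F a) (P0 F d)) (PComp F a c d h (Comp1 K a b c g f))
        (Comp2 L (P0 F a) (P0 F c) (P0 F d) (Id2 L (P0 F c) (P0 F d) (FO (P1 F c d) h))
          (PComp F a b c g f))"
    and unit_coherence_right: "a \<in> Ob K \<Longrightarrow> b \<in> Ob K \<Longrightarrow> f \<in> Obj (Hom K a b) \<Longrightarrow>
      Comp (Hom L (P0 F a) (P0 F b)) (PComp F a a b f (One K a))
        (Comp2 L (P0 F a) (P0 F a) (P0 F b) (Id2 L (P0 F a) (P0 F b) (FO (P1 F a b) f))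
          (PUnit F a)) =
      Id2 L (P0 F a) (P0 F b) (FO (P1 F a b) f)"
    and unit_coherence_left: "a \<in> Ob K \<Longrightarrow> b \<in> Ob K \<Longrightarrow> f \<in> Obj (Hom K a b) \<Longrightarrow>
      Comp (Hom L (P0 F a) (P0 F b)) (PComp F a b b (One K b) f)
        (Comp2 L (P0 F a) (P0 F b) (P0 F b) (PUnit F b)
          (Id2 L (P0 F a) (P0 F b) (FO (P1 F a b) f))) =
      Id2 L (P0 F a) (P0 F b) (FO (P1 F a b) f)"

type_synonym ('x, 'm, 'c, 'o, 'a) cat_pseudo_functr =
  "('x, 'm, 'c, ('o, 'a) cat, ('o, 'a, 'o, 'a) functr, ('o, 'a, 'o, 'a) nt) pseudo_functr"

type_synonym ('x, 'm, 'c, 'o, 'a) cat_two_functr =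
  "('x, 'm, 'c, ('o, 'a) cat, ('o, 'a, 'o, 'a) functr, ('o, 'a, 'o, 'a) nt) two_functr"


section \<open>Pseudo natural transformations and modifications\<close>

text \<open>
  The domain \<open>J\<close> and the codomain \<open>G\<close> may take values in categories over different types, so
  these notions are stated for category-valued pseudo functors in terms of the operations
  on functors and natural transformations. The cell \<open>T1 s a b f\<close> goes from \<open>G f \<circ> s a\<close> to
  \<open>s b \<circ> J f\<close>.
\<close>

record ('x, 'm, 'o, 'a, 'p, 'b) pseudo_nt =
  T0 :: "'x \<Rightarrow> ('o, 'a, 'p, 'b) functr"
  T1 :: "'x \<Rightarrow> 'x \<Rightarrow> 'm \<Rightarrow> ('o, 'a, 'p, 'b) nt"

definition is_pseudo_nt :: "('x, 'm, 'c) two_cat \<Rightarrow>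
    ('x, 'm, 'c, 'o, 'a) cat_pseudo_functr \<Rightarrow> ('x, 'm, 'c, 'p, 'b) cat_pseudo_functr \<Rightarrow>
    ('x, 'm, 'o, 'a, 'p, 'b) pseudo_nt \<Rightarrow> bool" where
  "is_pseudo_nt D J G s \<longleftrightarrow>
    T0 s \<in> extensional (Ob D) \<and>
    (\<forall>a b f. \<not> (a \<in> Ob D \<and> b \<in> Ob D \<and> f \<in> Obj (Hom D a b)) \<longrightarrow> T1 s a b f = undefined) \<and>
    (\<forall>a \<in> Ob D. is_functor (P0 J a) (P0 G a) (T0 s a)) \<and>
    (\<forall>a \<in> Ob D. \<forall>b \<in> Ob D. \<forall>f \<in> Obj (Hom D a b).
      iso_arrow (functor_cat (P0 J a) (P0 G b))
        (fcomp (P0 J a) (FO (P1 G a b) f) (T0 s a))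
        (fcomp (P0 J a) (T0 s b) (FO (P1 J a b) f))
        (T1 s a b f)) \<and>
    (\<forall>a \<in> Ob D. \<forall>b \<in> Ob D. \<forall>f g. \<forall>t \<in> arrows (Hom D a b) f g.
      Comp (functor_cat (P0 J a) (P0 G b))
        (whisker_left (P0 J a) (T0 s b) (FA (P1 J a b) t)) (T1 s a b f) =
      Comp (functor_cat (P0 J a) (P0 G b))
        (T1 s a b g) (whisker_right (P0 J a) (FA (P1 G a b) t) (T0 s a))) \<and>
    (\<forall>a \<in> Ob D.
      Comp (functor_cat (P0 J a) (P0 G a))
        (T1 s a a (One D a)) (whisker_right (P0 J a) (PUnit G a) (T0 s a)) =
      whisker_left (P0 J a) (T0 s a) (PUnit J a)) \<and>
    (\<forall>a \<in> Ob D. \<forall>b \<in> Ob D. \<forall>c \<in> Ob D. \<forall>f \<in> Obj (Hom D a b). \<forall>g \<in> Obj (Hom D b c).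
      Comp (functor_cat (P0 J a) (P0 G c))
        (T1 s a c (Comp1 D a b c g f)) (whisker_right (P0 J a) (PComp G a b c g f) (T0 s a)) =
      Comp (functor_cat (P0 J a) (P0 G c))
        (whisker_left (P0 J a) (T0 s c) (PComp J a b c g f))
        (Comp (functor_cat (P0 J a) (P0 G c))
          (whisker_right (P0 J a) (T1 s b c g) (FO (P1 J a b) f))
          (whisker_left (P0 J a) (FO (P1 G b c) g) (T1 s a b f))))"

record ('x, 'm, 'o, 'a, 'p, 'b) modif =
  MDom :: "('x, 'm, 'o, 'a, 'p, 'b) pseudo_nt"
  MCod :: "('x, 'm, 'o, 'a, 'p, 'b) pseudo_nt"
  MAt :: "'x \<Rightarrow> ('o, 'a, 'p, 'b) nt"

definition is_modification :: "('x, 'm, 'c) two_cat \<Rightarrow>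
    ('x, 'm, 'c, 'o, 'a) cat_pseudo_functr \<Rightarrow> ('x, 'm, 'c, 'p, 'b) cat_pseudo_functr \<Rightarrow>
    ('x, 'm, 'o, 'a, 'p, 'b) modif \<Rightarrow> bool" where
  "is_modification D J G m \<longleftrightarrow>
    is_pseudo_nt D J G (MDom m) \<and> is_pseudo_nt D J G (MCod m) \<and>
    MAt m \<in> extensional (Ob D) \<and>
    (\<forall>a \<in> Ob D.
      MAt m a \<in> arrows (functor_cat (P0 J a) (P0 G a)) (T0 (MDom m) a) (T0 (MCod m) a)) \<and>
    (\<forall>a \<in> Ob D. \<forall>b \<in> Ob D. \<forall>f \<in> Obj (Hom D a b).
      Comp (functor_cat (P0 J a) (P0 G b))
        (whisker_right (P0 J a) (MAt m b) (FO (P1 J a b) f)) (T1 (MDom m) a b f) =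
      Comp (functor_cat (P0 J a) (P0 G b))
        (T1 (MCod m) a b f) (whisker_left (P0 J a) (FO (P1 G a b) f) (MAt m a)))"

text \<open>The category \<open>Hom[D, Cat](J, G)\<close>.\<close>

definition pseudo_hom :: "('x, 'm, 'c) two_cat \<Rightarrow>
    ('x, 'm, 'c, 'o, 'a) cat_pseudo_functr \<Rightarrow> ('x, 'm, 'c, 'p, 'b) cat_pseudo_functr \<Rightarrow>
    (('x, 'm, 'o, 'a, 'p, 'b) pseudo_nt, ('x, 'm, 'o, 'a, 'p, 'b) modif) cat" where
  "pseudo_hom D J G =
    \<lparr>Obj = {s. is_pseudo_nt D J G s},
     Arr = {m. is_modification D J G m},
     Dom = MDom,
     Cod = MCod,
     Ident = (\<lambda>s. \<lparr>MDom = s, MCod = s,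
       MAt = (\<lambda>a \<in> Ob D. Ident (functor_cat (P0 J a) (P0 G a)) (T0 s a))\<rparr>),
     Comp = (\<lambda>n m. \<lparr>MDom = MDom m, MCod = MCod n,
       MAt = (\<lambda>a \<in> Ob D. Comp (functor_cat (P0 J a) (P0 G a)) (MAt n a) (MAt m a))\<rparr>)\<rparr>"


section \<open>Weighted pseudo limits\<close>

text \<open>
  \<open>post_comp K C X Y f\<close> is \<open>K(C, f)\<close> for \<open>f\<close> from \<open>X\<close> to \<open>Y\<close>, and \<open>post_cell\<close> is \<open>K(C, -)\<close> on
  2-cells. Dually, \<open>pre_comp K B C X u\<close> is \<open>K(u, X)\<close> for \<open>u\<close> from \<open>B\<close> to \<open>C\<close>.
\<close>

definition post_comp :: "('o, 'm, 'c) two_cat \<Rightarrow> 'o \<Rightarrow> 'o \<Rightarrow> 'o \<Rightarrow> 'm \<Rightarrow> ('m, 'c, 'm, 'c) functr" where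
  "post_comp K C X Y f = mk_functor (Hom K C X)
    (\<lambda>h. Comp1 K C X Y f h) (\<lambda>t. Comp2 K C X Y (Id2 K X Y f) t)"

definition post_cell :: "('o, 'm, 'c) two_cat \<Rightarrow> 'o \<Rightarrow> 'o \<Rightarrow> 'o \<Rightarrow> 'c \<Rightarrow> ('m, 'c, 'm, 'c) nt" where
  "post_cell K C X Y t = mk_nt (Hom K C X)
    (post_comp K C X Y (Dom (Hom K X Y) t)) (post_comp K C X Y (Cod (Hom K X Y) t))
    (\<lambda>h. Comp2 K C X Y t (Id2 K C X h))"

definition pre_comp :: "('o, 'm, 'c) two_cat \<Rightarrow> 'o \<Rightarrow> 'o \<Rightarrow> 'o \<Rightarrow> 'm \<Rightarrow> ('m, 'c, 'm, 'c) functr" where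
  "pre_comp K B C X u = mk_functor (Hom K C X)
    (\<lambda>h. Comp1 K B C X h u) (\<lambda>t. Comp2 K B C X t (Id2 K B C u))"

definition pre_cell :: "('o, 'm, 'c) two_cat \<Rightarrow> 'o \<Rightarrow> 'o \<Rightarrow> 'o \<Rightarrow> 'c \<Rightarrow> ('m, 'c, 'm, 'c) nt" where
  "pre_cell K B C X w = mk_nt (Hom K C X)
    (pre_comp K B C X (Dom (Hom K B C) w)) (pre_comp K B C X (Cod (Hom K B C) w))
    (\<lambda>h. Comp2 K B C X (Id2 K C X h) w)"

text \<open>The pseudo functor \<open>K(C, F -)\<close> from \<open>D\<close> to \<open>CAT\<close>.\<close>

definition hom_after :: "('o, 'm, 'c) two_cat \<Rightarrow> ('x, 'n, 'd) two_cat \<Rightarrow>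
    ('x, 'n, 'd, 'o, 'm, 'c) pseudo_functr \<Rightarrow> 'o \<Rightarrow> ('x, 'n, 'd, 'm, 'c) cat_pseudo_functr" where
  "hom_after K D F C =
    \<lparr>P0 = (\<lambda>a. Hom K C (P0 F a)),
     P1 = (\<lambda>a b. mk_functor (Hom D a b)
       (\<lambda>f. post_comp K C (P0 F a) (P0 F b) (FO (P1 F a b) f))
       (\<lambda>t. post_cell K C (P0 F a) (P0 F b) (FA (P1 F a b) t))),
     PUnit = (\<lambda>a. post_cell K C (P0 F a) (P0 F a) (PUnit F a)),
     PComp = (\<lambda>a b c g f. post_cell K C (P0 F a) (P0 F c) (PComp F a b c g f))\<rparr>"

text \<open>
  The 2-functor \<open>K(-, X)\<close> from \<open>op2 K\<close> to \<open>CAT\<close>. A 1-cell from \<open>C\<close> to \<open>B\<close> in \<open>op2 K\<close> is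
  a 1-cell from \<open>B\<close> to \<open>C\<close> in \<open>K\<close>.
\<close>

definition representable :: "('o, 'm, 'c) two_cat \<Rightarrow> 'o \<Rightarrow> ('o, 'm, 'c, 'm, 'c) cat_two_functr" where
  "representable K X =
    \<lparr>P0 = (\<lambda>C. Hom K C X),
     P1 = (\<lambda>C B. mk_functor (Hom K B C) (pre_comp K B C X) (pre_cell K B C X))\<rparr>"

text \<open>
  The 2-functor \<open>Hom[D, Cat](J, K(-, F -))\<close> from \<open>op2 K\<close> to \<open>CAT\<close>. A 1-cell \<open>u\<close> of \<open>K\<close> acts
  by composing with the 2-natural transformation \<open>K(u, F -)\<close>, and a 2-cell \<open>w\<close>
  by composing with the modification \<open>K(w, F -)\<close>.
\<close>

definition cone_pull :: "('o, 'm, 'c) two_cat \<Rightarrow> ('x, 'n, 'd) two_cat \<Rightarrow>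
    ('x, 'n, 'd, 'j, 'k) cat_pseudo_functr \<Rightarrow> ('x, 'n, 'd, 'o, 'm, 'c) pseudo_functr \<Rightarrow>
    'o \<Rightarrow> 'o \<Rightarrow> 'm \<Rightarrow> ('x, 'n, 'j, 'k, 'm, 'c) pseudo_nt \<Rightarrow> ('x, 'n, 'j, 'k, 'm, 'c) pseudo_nt" where
  "cone_pull K D J F B C u s =
    \<lparr>T0 = (\<lambda>a \<in> Ob D. fcomp (P0 J a) (pre_comp K B C (P0 F a) u) (T0 s a)),
     T1 = (\<lambda>a b f. if a \<in> Ob D \<and> b \<in> Ob D \<and> f \<in> Obj (Hom D a b)
       then whisker_left (P0 J a) (pre_comp K B C (P0 F b) u) (T1 s a b f) else undefined)\<rparr>"

definition cone_pull_functor :: "('o, 'm, 'c) two_cat \<Rightarrow> ('x, 'n, 'd) two_cat \<Rightarrow>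
    ('x, 'n, 'd, 'j, 'k) cat_pseudo_functr \<Rightarrow> ('x, 'n, 'd, 'o, 'm, 'c) pseudo_functr \<Rightarrow>
    'o \<Rightarrow> 'o \<Rightarrow> 'm \<Rightarrow>
    (('x, 'n, 'j, 'k, 'm, 'c) pseudo_nt, ('x, 'n, 'j, 'k, 'm, 'c) modif,
     ('x, 'n, 'j, 'k, 'm, 'c) pseudo_nt, ('x, 'n, 'j, 'k, 'm, 'c) modif) functr" where
  "cone_pull_functor K D J F B C u = mk_functor (pseudo_hom D J (hom_after K D F C))
    (cone_pull K D J F B C u)
    (\<lambda>m. \<lparr>MDom = cone_pull K D J F B C u (MDom m), MCod = cone_pull K D J F B C u (MCod m),
      MAt = (\<lambda>a \<in> Ob D. whisker_left (P0 J a) (pre_comp K B C (P0 F a) u) (MAt m a))\<rparr>)"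

definition cone_pull_cell :: "('o, 'm, 'c) two_cat \<Rightarrow> ('x, 'n, 'd) two_cat \<Rightarrow>
    ('x, 'n, 'd, 'j, 'k) cat_pseudo_functr \<Rightarrow> ('x, 'n, 'd, 'o, 'm, 'c) pseudo_functr \<Rightarrow>
    'o \<Rightarrow> 'o \<Rightarrow> 'c \<Rightarrow>
    (('x, 'n, 'j, 'k, 'm, 'c) pseudo_nt, ('x, 'n, 'j, 'k, 'm, 'c) modif,
     ('x, 'n, 'j, 'k, 'm, 'c) pseudo_nt, ('x, 'n, 'j, 'k, 'm, 'c) modif) nt" where
  "cone_pull_cell K D J F B C w = mk_nt (pseudo_hom D J (hom_after K D F C))
    (cone_pull_functor K D J F B C (Dom (Hom K B C) w))
    (cone_pull_functor K D J F B C (Cod (Hom K B C) w))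
    (\<lambda>s. \<lparr>MDom = cone_pull K D J F B C (Dom (Hom K B C) w) s,
      MCod = cone_pull K D J F B C (Cod (Hom K B C) w) s,
      MAt = (\<lambda>a \<in> Ob D. whisker_right (P0 J a) (pre_cell K B C (P0 F a) w) (T0 s a))\<rparr>)"

definition weighted_cones :: "('o, 'm, 'c) two_cat \<Rightarrow> ('x, 'n, 'd) two_cat \<Rightarrow>
    ('x, 'n, 'd, 'j, 'k) cat_pseudo_functr \<Rightarrow> ('x, 'n, 'd, 'o, 'm, 'c) pseudo_functr \<Rightarrow>
    ('o, 'm, 'c, ('x, 'n, 'j, 'k, 'm, 'c) pseudo_nt, ('x, 'n, 'j, 'k, 'm, 'c) modif)
      cat_two_functr" where
  "weighted_cones K D J F =
    \<lparr>P0 = (\<lambda>C. pseudo_hom D J (hom_after K D F C)),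
     P1 = (\<lambda>C B. mk_functor (Hom K B C)
       (cone_pull_functor K D J F B C) (cone_pull_cell K D J F B C))\<rparr>"

text \<open>
  2-natural isomorphism of category-valued 2-functors, possibly over different types:
  a family of isomorphisms of categories, strictly natural in 1-cells and in 2-cells.
\<close>

definition two_naturally_isomorphic :: "('o, 'm, 'c) two_cat \<Rightarrow>
    ('o, 'm, 'c, 'p, 'a) cat_two_functr \<Rightarrow> ('o, 'm, 'c, 'q, 'b) cat_two_functr \<Rightarrow> bool" where
  "two_naturally_isomorphic K X Y \<longleftrightarrow>
    two_functor K CAT X \<and> two_functor K CAT Y \<and>
    (\<exists>\<Phi>. (\<forall>a \<in> Ob K. iso_functor (P0 X a) (P0 Y a) (\<Phi> a)) \<and>
      (\<forall>a \<in> Ob K. \<forall>b \<in> Ob K. \<forall>f \<in> Obj (Hom K a b).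
        fcomp (P0 X a) (FO (P1 Y a b) f) (\<Phi> a) = fcomp (P0 X a) (\<Phi> b) (FO (P1 X a b) f)) \<and>
      (\<forall>a \<in> Ob K. \<forall>b \<in> Ob K. \<forall>t \<in> Arr (Hom K a b).
        whisker_right (P0 X a) (FA (P1 Y a b) t) (\<Phi> a) =
        whisker_left (P0 X a) (\<Phi> b) (FA (P1 X a b) t)))"

definition weighted_pseudo_limit :: "('o, 'm, 'c) two_cat \<Rightarrow> ('x, 'n, 'd) two_cat \<Rightarrow>
    ('x, 'n, 'd, 'j, 'k) cat_pseudo_functr \<Rightarrow> ('x, 'n, 'd, 'o, 'm, 'c) pseudo_functr \<Rightarrow>
    'o \<Rightarrow> bool" where
  "weighted_pseudo_limit K D J F X \<longleftrightarrow> X \<in> Ob K \<and>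
    two_naturally_isomorphic (op2 K) (representable K X) (weighted_cones K D J F)"

end

(* Cones over F weighted by J with vertex the terminal category form the category
   L = Hom[D, Cat](J, F). Its objects and arrows are families indexed by small sets, so L is isomorphic
   to a small category X. Exchanging the two arguments of functors C -> [J a, F a] gives isomorphisms
   Cat(C, X) = [C, L] = Hom[D, Cat](J, Cat(C, F -)) which are natural in C: the
   conditions on pseudo natural transformations and modifications into Cat(C, F -) correspond under this
   exchange because each of them is an equation that may be checked componentwise. That the cones form
   a 2-functor in C follows by transport along these isomorphisms. *)

theory Submission
  imports Defs
begin

section \<open>Categories, functors and natural transformations\<close>

text \<open>The point of the exchange is where each law goes. A functor from \<open>C\<close> to the
  cones and a cone over \<open>Cat(C, F -)\<close> consist of the same objects and arrows of the
  categories \<open>P0 F b\<close>. The modification law of the image of an arrow \<open>u\<close>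
  of \<open>C\<close> reappears as naturality along \<open>u\<close> of a structure cell at
  \<open>j\<close>; naturality in \<open>j\<close> of the cell of the cone at \<open>c\<close>
  reappears as naturality of a cell with values in \<open>[C, F b]\<close>; the laws of a cone are
  repeated at every \<open>c\<close>.

  The isomorphism has to be strict, so both round trips are HOL equalities. Hence functors and
  transformations are built by \<open>mk_functor\<close> and \<open>mk_nt\<close>, which fix the
  values off the domain, and eta rules absorb these restrictions.

  Size is kept apart from the universal property. Cones have types of their own and so do not form
  an object of \<open>Cat\<close>; a class \<open>P\<close> of categories stands for smallness until
  a copy of the cones over \<open>'u\<close> is available. For that copy an upper bound on the size
  suffices.\<close>

lemma arrows_iff: "f \<in> arrows A x y \<longleftrightarrow> f \<in> Arr A \<and> Dom A f = x \<and> Cod A f = y"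
  by (simp add: arrows_def)

context category begin

lemma Ident_Arr: "x \<in> Obj A \<Longrightarrow> Ident A x \<in> Arr A"
  and Dom_Ident: "x \<in> Obj A \<Longrightarrow> Dom A (Ident A x) = x"
  and Cod_Ident: "x \<in> Obj A \<Longrightarrow> Cod A (Ident A x) = x"
  using ident by (auto simp: arrows_iff)

lemma Comp_Arr: "g \<in> Arr A \<Longrightarrow> f \<in> Arr A \<Longrightarrow> Dom A g = Cod A f \<Longrightarrow> Comp A g f \<in> Arr A"
  and Dom_Comp: "g \<in> Arr A \<Longrightarrow> f \<in> Arr A \<Longrightarrow> Dom A g = Cod A f \<Longrightarrow> Dom A (Comp A g f) = Dom A f"
  and Cod_Comp: "g \<in> Arr A \<Longrightarrow> f \<in> Arr A \<Longrightarrow> Dom A g = Cod A f \<Longrightarrow> Cod A (Comp A g f) = Cod A g"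
  using comp[of f "Dom A f" "Cod A f" g "Cod A g"] by (auto simp: arrows_iff)

lemma Comp_Ident_right: "f \<in> Arr A \<Longrightarrow> Dom A f = x \<Longrightarrow> Comp A f (Ident A x) = f"
  and Comp_Ident_left: "f \<in> Arr A \<Longrightarrow> Cod A f = x \<Longrightarrow> Comp A (Ident A x) f = f"
  using comp_ident_right comp_ident_left by (auto simp: arrows_iff)

lemma Comp_assoc: "h \<in> Arr A \<Longrightarrow> g \<in> Arr A \<Longrightarrow> f \<in> Arr A \<Longrightarrow>
    Dom A h = Cod A g \<Longrightarrow> Dom A g = Cod A f \<Longrightarrow>
    Comp A (Comp A h g) f = Comp A h (Comp A g f)"
  using comp_assoc by (auto simp: arrows_iff)

end

lemmas category_simps = category.dom_obj category.cod_obj category.Ident_Arr category.Dom_Ident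
  category.Cod_Ident category.Comp_Arr category.Dom_Comp category.Cod_Comp
  category.Comp_Ident_right category.Comp_Ident_left
declare category_simps [simp]

lemma categoryI:
  assumes "\<And>f. f \<in> Arr A \<Longrightarrow> Dom A f \<in> Obj A \<and> Cod A f \<in> Obj A"
    and "\<And>x. x \<in> Obj A \<Longrightarrow> Ident A x \<in> Arr A \<and> Dom A (Ident A x) = x \<and> Cod A (Ident A x) = x"
    and "\<And>g f. g \<in> Arr A \<Longrightarrow> f \<in> Arr A \<Longrightarrow> Dom A g = Cod A f \<Longrightarrow>
      Comp A g f \<in> Arr A \<and> Dom A (Comp A g f) = Dom A f \<and> Cod A (Comp A g f) = Cod A g"
    and "\<And>f. f \<in> Arr A \<Longrightarrow> Comp A f (Ident A (Dom A f)) = f \<and> Comp A (Ident A (Cod A f)) f = f"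
    and "\<And>h g f. h \<in> Arr A \<Longrightarrow> g \<in> Arr A \<Longrightarrow> f \<in> Arr A \<Longrightarrow>
      Dom A h = Cod A g \<Longrightarrow> Dom A g = Cod A f \<Longrightarrow>
      Comp A h (Comp A g f) = Comp A (Comp A h g) f"
  shows "category A"
  by unfold_locales (use assms in \<open>auto simp: arrows_iff\<close>)

text \<open>\<open>Dom\<close> and \<open>Cod\<close> equations on a single arrow replace membership
  in \<open>arrows\<close>, whose endpoints are extra variables; later computations rewrite with
  this form.\<close>

lemma is_functor_iff: "is_functor A B F \<longleftrightarrow>
    FO F \<in> extensional (Obj A) \<and> FA F \<in> extensional (Arr A) \<and>
    (\<forall>x \<in> Obj A. FO F x \<in> Obj B) \<and>
    (\<forall>f \<in> Arr A. FA F f \<in> Arr B \<and> Dom B (FA F f) = FO F (Dom A f) \<and> Cod B (FA F f) = FO F (Cod A f)) \<and>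
    (\<forall>x \<in> Obj A. FA F (Ident A x) = Ident B (FO F x)) \<and>
    (\<forall>f \<in> Arr A. \<forall>g \<in> Arr A. Dom A g = Cod A f \<longrightarrow> FA F (Comp A g f) = Comp B (FA F g) (FA F f))"
  unfolding is_functor_def by (auto simp: arrows_iff)

lemma functor_simps:
  assumes "is_functor A B F"
  shows "x \<in> Obj A \<Longrightarrow> FO F x \<in> Obj B"
    and "f \<in> Arr A \<Longrightarrow> FA F f \<in> Arr B"
    and "f \<in> Arr A \<Longrightarrow> Dom B (FA F f) = FO F (Dom A f)"
    and "f \<in> Arr A \<Longrightarrow> Cod B (FA F f) = FO F (Cod A f)"
    and "x \<in> Obj A \<Longrightarrow> FA F (Ident A x) = Ident B (FO F x)"
    and "g \<in> Arr A \<Longrightarrow> f \<in> Arr A \<Longrightarrow> Dom A g = Cod A f \<Longrightarrow>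
      FA F (Comp A g f) = Comp B (FA F g) (FA F f)"
  using assms unfolding is_functor_iff by auto

declare functor_simps [simp]

lemma functor_extensional:
  assumes "is_functor A B F"
  shows "FO F \<in> extensional (Obj A)" and "FA F \<in> extensional (Arr A)"
  using assms unfolding is_functor_iff by auto

lemma mk_functor_simps [simp]:
  "x \<in> Obj A \<Longrightarrow> FO (mk_functor A fo fa) x = fo x"
  "f \<in> Arr A \<Longrightarrow> FA (mk_functor A fo fa) f = fa f"
  by (simp_all add: mk_functor_def)

lemma is_functor_mk_functor:
  assumes "category A"
    and "\<And>x. x \<in> Obj A \<Longrightarrow> fo x \<in> Obj B"
    and "\<And>f. f \<in> Arr A \<Longrightarrow> fa f \<in> Arr B \<and> Dom B (fa f) = fo (Dom A f) \<and> Cod B (fa f) = fo (Cod A f)"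
    and "\<And>x. x \<in> Obj A \<Longrightarrow> fa (Ident A x) = Ident B (fo x)"
    and "\<And>g f. g \<in> Arr A \<Longrightarrow> f \<in> Arr A \<Longrightarrow> Dom A g = Cod A f \<Longrightarrow> fa (Comp A g f) = Comp B (fa g) (fa f)"
  shows "is_functor A B (mk_functor A fo fa)"
  unfolding is_functor_iff using assms by (auto simp: mk_functor_def)

lemma functor_eqI:
  assumes "is_functor A B F" and "is_functor A B' G"
    and "\<And>x. x \<in> Obj A \<Longrightarrow> FO F x = FO G x"
    and "\<And>f. f \<in> Arr A \<Longrightarrow> FA F f = FA G f"
  shows "F = G"
proof -
  have "FO F = FO G"
    using functor_extensional(1)[OF assms(1)] functor_extensional(1)[OF assms(2)] assms(3)
    by (rule extensionalityI)
  moreover have "FA F = FA G"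
    using functor_extensional(2)[OF assms(1)] functor_extensional(2)[OF assms(2)] assms(4)
    by (rule extensionalityI)
  ultimately show ?thesis by simp
qed

text \<open>Restricted maps are determined by their values on \<open>A\<close>, so composites built
  with \<open>mk_functor\<close> can be compared pointwise before they are known to be
  functors.\<close>

lemma mk_functor_cong:
  assumes "\<And>x. x \<in> Obj A \<Longrightarrow> fo x = fo' x" and "\<And>f. f \<in> Arr A \<Longrightarrow> fa f = fa' f"
  shows "mk_functor A fo fa = mk_functor A fo' fa'"
  unfolding mk_functor_def using assms by (auto cong: restrict_cong)

lemma mk_functor_eta: "is_functor A B F \<Longrightarrow> mk_functor A (FO F) (FA F) = F"
  unfolding mk_functor_def by (simp add: functor_extensional extensional_restrict)

lemma is_functor_id_functor [simp]: "category A \<Longrightarrow> is_functor A A (id_functor A)"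
  unfolding id_functor_def by (rule is_functor_mk_functor) auto

lemma id_functor_simps [simp]:
  "x \<in> Obj A \<Longrightarrow> FO (id_functor A) x = x"
  "f \<in> Arr A \<Longrightarrow> FA (id_functor A) f = f"
  by (simp_all add: id_functor_def)

lemma is_functor_fcomp [simp]:
  "category A \<Longrightarrow> is_functor A B F \<Longrightarrow> is_functor B C G \<Longrightarrow> is_functor A C (fcomp A G F)"
  unfolding fcomp_def by (rule is_functor_mk_functor) auto

lemma fcomp_simps [simp]:
  "x \<in> Obj A \<Longrightarrow> FO (fcomp A G F) x = FO G (FO F x)"
  "f \<in> Arr A \<Longrightarrow> FA (fcomp A G F) f = FA G (FA F f)"
  by (simp_all add: fcomp_def)

lemma fcomp_id_left: "is_functor A B F \<Longrightarrow> fcomp A (id_functor B) F = F"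
  unfolding fcomp_def by (subst mk_functor_eta[symmetric]) (auto intro: mk_functor_cong)

lemma fcomp_id_right: "is_functor A B F \<Longrightarrow> fcomp A F (id_functor A) = F"
  unfolding fcomp_def by (subst (3) mk_functor_eta[symmetric]) (auto intro: mk_functor_cong)

text \<open>The restriction to \<open>B\<close> inside \<open>fcomp B H G\<close> is invisible
  because \<open>F\<close> takes its values in \<open>B\<close>.\<close>

lemma fcomp_assoc: "is_functor A B F \<Longrightarrow> fcomp A (fcomp B H G) F = fcomp A H (fcomp A G F)"
  by (simp add: fcomp_def[of A] cong: mk_functor_cong)

lemma is_nt_iff: "is_nt A B t \<longleftrightarrow>
    is_functor A B (NDom t) \<and> is_functor A B (NCod t) \<and> NAt t \<in> extensional (Obj A) \<and>
    (\<forall>x \<in> Obj A. NAt t x \<in> Arr B \<and> Dom B (NAt t x) = FO (NDom t) x \<and> Cod B (NAt t x) = FO (NCod t) x) \<and>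
    (\<forall>f \<in> Arr A. Comp B (NAt t (Cod A f)) (FA (NDom t) f) = Comp B (FA (NCod t) f) (NAt t (Dom A f)))"
  unfolding is_nt_def by (auto simp: arrows_iff)

lemma nt_simps:
  assumes "is_nt A B t"
  shows "is_functor A B (NDom t)"
    and "is_functor A B (NCod t)"
    and "x \<in> Obj A \<Longrightarrow> NAt t x \<in> Arr B"
    and "x \<in> Obj A \<Longrightarrow> Dom B (NAt t x) = FO (NDom t) x"
    and "x \<in> Obj A \<Longrightarrow> Cod B (NAt t x) = FO (NCod t) x"
  using assms unfolding is_nt_iff by auto

declare nt_simps [simp]

lemmas is_functor_fcomp_nt [simp] =
  is_functor_fcomp[OF _ nt_simps(1)] is_functor_fcomp[OF _ nt_simps(2)]
  is_functor_fcomp[OF _ _ nt_simps(1)] is_functor_fcomp[OF _ _ nt_simps(2)]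
  is_functor_fcomp[OF _ nt_simps(1) nt_simps(1)] is_functor_fcomp[OF _ nt_simps(2) nt_simps(2)]
lemmas nt_dom_simps [simp] = functor_simps[OF nt_simps(1)]
lemmas nt_cod_simps [simp] = functor_simps[OF nt_simps(2)]

lemma nt_natural: "is_nt A B t \<Longrightarrow> f \<in> Arr A \<Longrightarrow>
    Comp B (NAt t (Cod A f)) (FA (NDom t) f) = Comp B (FA (NCod t) f) (NAt t (Dom A f))"
  unfolding is_nt_iff by auto

lemma nt_extensional: "is_nt A B t \<Longrightarrow> NAt t \<in> extensional (Obj A)"
  unfolding is_nt_iff by blast

lemma mk_nt_simps [simp]:
  "NDom (mk_nt A F G t) = F"
  "NCod (mk_nt A F G t) = G"
  "x \<in> Obj A \<Longrightarrow> NAt (mk_nt A F G t) x = t x"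
  by (simp_all add: mk_nt_def)

lemma is_nt_mk_nt:
  assumes "category A" and "is_functor A B F" and "is_functor A B G"
    and "\<And>x. x \<in> Obj A \<Longrightarrow> t x \<in> Arr B \<and> Dom B (t x) = FO F x \<and> Cod B (t x) = FO G x"
    and "\<And>f. f \<in> Arr A \<Longrightarrow> Comp B (t (Cod A f)) (FA F f) = Comp B (FA G f) (t (Dom A f))"
  shows "is_nt A B (mk_nt A F G t)"
  unfolding is_nt_iff using assms by (auto simp: mk_nt_def)

lemma mk_nt_cong:
  assumes "F = F'" and "G = G'" and "\<And>x. x \<in> Obj A \<Longrightarrow> t x = t' x"
  shows "mk_nt A F G t = mk_nt A F' G' t'"
  unfolding mk_nt_def using assms by (auto cong: restrict_cong)

lemma mk_nt_eta: "is_nt A B t \<Longrightarrow> mk_nt A (NDom t) (NCod t) (NAt t) = t"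
  unfolding mk_nt_def by (simp add: nt_extensional extensional_restrict)

lemma nt_eqI:
  assumes "is_nt A B s" and "is_nt A B' t" and "NDom s = NDom t" and "NCod s = NCod t"
    and "\<And>x. x \<in> Obj A \<Longrightarrow> NAt s x = NAt t x"
  shows "s = t"
proof -
  have "NAt s = NAt t"
    using nt_extensional[OF assms(1)] nt_extensional[OF assms(2)] assms(5) by (rule extensionalityI)
  then show ?thesis using assms by simp
qed

text \<open>Serves to recognise \<open>t\<close> after its components have been taken apart and
  reassembled: \<open>t\<close> is extensional, so restricting the components to \<open>A\<close>
  changes nothing.\<close>

lemma mk_nt_eqI:
  assumes "is_nt A B t" and "F = NDom t" and "G = NCod t" and "\<And>x. x \<in> Obj A \<Longrightarrow> u x = NAt t x"
  shows "mk_nt A F G u = t"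
  using mk_nt_cong[of F "NDom t" G "NCod t" A u "NAt t"] mk_nt_eta[of A B t] assms by auto

lemma functor_cat_simps [simp]:
  "Obj (functor_cat A B) = {F. is_functor A B F}"
  "Arr (functor_cat A B) = {t. is_nt A B t}"
  "Dom (functor_cat A B) = NDom"
  "Cod (functor_cat A B) = NCod"
  "Ident (functor_cat A B) F = mk_nt A F F (\<lambda>x. Ident B (FO F x))"
  "Comp (functor_cat A B) s t = mk_nt A (NDom t) (NCod s) (\<lambda>x. Comp B (NAt s x) (NAt t x))"
  by (simp_all add: functor_cat_def)

lemma is_nt_Ident [simp]:
  "category A \<Longrightarrow> category B \<Longrightarrow> is_functor A B F \<Longrightarrow> is_nt A B (mk_nt A F F (\<lambda>x. Ident B (FO F x)))"
  by (rule is_nt_mk_nt) auto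

lemma is_nt_Comp [simp]:
  assumes "category A" "category B" "is_nt A B s" "is_nt A B t" "NDom s = NCod t"
  shows "is_nt A B (mk_nt A (NDom t) (NCod s) (\<lambda>x. Comp B (NAt s x) (NAt t x)))"
proof (rule is_nt_mk_nt)
  fix f assume f: "f \<in> Arr A"
  have "Comp B (Comp B (NAt s (Cod A f)) (NAt t (Cod A f))) (FA (NDom t) f) =
      Comp B (NAt s (Cod A f)) (Comp B (FA (NDom s) f) (NAt t (Dom A f)))"
    using assms f nt_natural[OF assms(4) f] by (simp add: category.Comp_assoc)
  also have "\<dots> = Comp B (Comp B (FA (NCod s) f) (NAt s (Dom A f))) (NAt t (Dom A f))"
    using assms f nt_natural[OF assms(3) f, symmetric] by (simp add: category.Comp_assoc)
  also have "\<dots> = Comp B (FA (NCod s) f) (Comp B (NAt s (Dom A f)) (NAt t (Dom A f)))"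
    using assms f by (simp add: category.Comp_assoc)
  finally show "Comp B (Comp B (NAt s (Cod A f)) (NAt t (Cod A f))) (FA (NDom t) f) =
      Comp B (FA (NCod s) f) (Comp B (NAt s (Dom A f)) (NAt t (Dom A f)))" .
qed (use assms in auto)

lemma category_functor_cat [simp]:
  assumes A: "category A" and B: "category B"
  shows "category (functor_cat A B)"
proof (rule categoryI)
  fix f assume "f \<in> Arr (functor_cat A B)"
  then have f: "is_nt A B f" by simp
  show "Comp (functor_cat A B) f (Ident (functor_cat A B) (Dom (functor_cat A B) f)) = f \<and>
      Comp (functor_cat A B) (Ident (functor_cat A B) (Cod (functor_cat A B) f)) f = f"
    using A B f by (auto intro!: mk_nt_eqI[OF f])
next
  fix h g f
  assume "h \<in> Arr (functor_cat A B)" "g \<in> Arr (functor_cat A B)" "f \<in> Arr (functor_cat A B)"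
    "Dom (functor_cat A B) h = Cod (functor_cat A B) g" "Dom (functor_cat A B) g = Cod (functor_cat A B) f"
  then show "Comp (functor_cat A B) h (Comp (functor_cat A B) g f) =
      Comp (functor_cat A B) (Comp (functor_cat A B) h g) f"
    using A B by (auto simp: category.Comp_assoc intro!: mk_nt_cong)
qed (use A B in auto)

lemma is_nt_whisker_left [simp]:
  assumes "category A" "category B" "is_functor B C H" "is_nt A B t"
  shows "is_nt A C (whisker_left A H t)"
  unfolding whisker_left_def
proof (rule is_nt_mk_nt)
  fix f assume f: "f \<in> Arr A"
  show "Comp C (FA H (NAt t (Cod A f))) (FA (fcomp A H (NDom t)) f) =
      Comp C (FA (fcomp A H (NCod t)) f) (FA H (NAt t (Dom A f)))"
    using assms f arg_cong[OF nt_natural[OF assms(4) f], of "FA H"] by simp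
qed (use assms in auto)

lemma whisker_left_simps [simp]:
  "NDom (whisker_left A H t) = fcomp A H (NDom t)"
  "NCod (whisker_left A H t) = fcomp A H (NCod t)"
  "x \<in> Obj A \<Longrightarrow> NAt (whisker_left A H t) x = FA H (NAt t x)"
  by (simp_all add: whisker_left_def)

lemma is_nt_whisker_right [simp]:
  assumes "category A" "is_functor A B H" "is_nt B C s"
  shows "is_nt A C (whisker_right A s H)"
  unfolding whisker_right_def
proof (rule is_nt_mk_nt)
  fix f assume f: "f \<in> Arr A"
  show "Comp C (NAt s (FO H (Cod A f))) (FA (fcomp A (NDom s) H) f) =
      Comp C (FA (fcomp A (NCod s) H) f) (NAt s (FO H (Dom A f)))"
    using assms f nt_natural[OF assms(3), of "FA H f"] by simp
qed (use assms in auto)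

lemma whisker_right_simps [simp]:
  "NDom (whisker_right A s H) = fcomp A (NDom s) H"
  "NCod (whisker_right A s H) = fcomp A (NCod s) H"
  "x \<in> Obj A \<Longrightarrow> NAt (whisker_right A s H) x = NAt s (FO H x)"
  by (simp_all add: whisker_right_def)

lemma is_nt_hcomp [simp]:
  assumes "category A" "category B" "category C" "is_nt B C s" "is_nt A B t"
  shows "is_nt A C (hcomp A C s t)"
proof -
  \<comment> \<open>The defining formula is the vertical composite of two whiskerings, from which
    naturality is inherited.\<close>
  have "hcomp A C s t = Comp (functor_cat A C) (whisker_right A s (NCod t)) (whisker_left A (NDom s) t)"
    unfolding hcomp_def by (auto intro!: mk_nt_cong)
  then show ?thesis
    using is_nt_Comp[OF assms(1,3) is_nt_whisker_right is_nt_whisker_left, of B "NCod t" s B "NDom s" t]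
      assms by simp
qed

lemma hcomp_simps [simp]:
  "NDom (hcomp A C s t) = fcomp A (NDom s) (NDom t)"
  "NCod (hcomp A C s t) = fcomp A (NCod s) (NCod t)"
  "x \<in> Obj A \<Longrightarrow> NAt (hcomp A C s t) x = Comp C (NAt s (FO (NCod t) x)) (FA (NDom s) (NAt t x))"
  by (simp_all add: hcomp_def)

text \<open>Inverses chosen at each object are automatically natural. Invertibility of a structure
  cell thereby becomes a condition at objects, which survives the exchange of arguments.\<close>

lemma iso_arrow_functor_cat_iff:
  assumes A: "category A" and B: "category B"
  shows "iso_arrow (functor_cat A B) F G t \<longleftrightarrow>
    is_nt A B t \<and> NDom t = F \<and> NCod t = G \<and> (\<forall>x \<in> Obj A. iso_arrow B (FO F x) (FO G x) (NAt t x))"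
    (is "?l \<longleftrightarrow> ?r")
proof
  assume ?l
  then obtain s where t: "is_nt A B t" "NDom t = F" "NCod t = G"
    and s: "is_nt A B s" "NDom s = G" "NCod s = F"
    and st: "Comp (functor_cat A B) s t = Ident (functor_cat A B) F"
    and ts: "Comp (functor_cat A B) t s = Ident (functor_cat A B) G"
    unfolding iso_arrow_def by (auto simp: arrows_iff)
  have "iso_arrow B (FO F x) (FO G x) (NAt t x)" if x: "x \<in> Obj A" for x
    unfolding iso_arrow_def arrows_iff
    using t s x arg_cong[OF st, of "\<lambda>n. NAt n x"] arg_cong[OF ts, of "\<lambda>n. NAt n x"]
    by (auto intro!: bexI[of _ "NAt s x"] simp: arrows_iff)
  then show ?r using t by blast
next
  assume r: ?r
  then have t: "is_nt A B t" "NDom t = F" "NCod t = G" by blast+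
  have iso: "\<exists>g. g \<in> Arr B \<and> Dom B g = FO G x \<and> Cod B g = FO F x \<and>
      Comp B g (NAt t x) = Ident B (FO F x) \<and> Comp B (NAt t x) g = Ident B (FO G x)" if "x \<in> Obj A" for x
  proof -
    have "iso_arrow B (FO F x) (FO G x) (NAt t x)" using r that by blast
    then show ?thesis unfolding iso_arrow_def arrows_def by blast
  qed
  from iso obtain g where g: "\<And>x. x \<in> Obj A \<Longrightarrow> g x \<in> Arr B \<and> Dom B (g x) = FO G x \<and>
      Cod B (g x) = FO F x \<and> Comp B (g x) (NAt t x) = Ident B (FO F x) \<and>
      Comp B (NAt t x) (g x) = Ident B (FO G x)"
    by metis
  have FG: "is_functor A B F" "is_functor A B G" using t by auto
  have tx: "NAt t x \<in> Arr B" "Dom B (NAt t x) = FO F x" "Cod B (NAt t x) = FO G x" if "x \<in> Obj A" for x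
    using t that by auto
  have "is_nt A B (mk_nt A G F g)"
  proof (rule is_nt_mk_nt[OF A FG(2) FG(1)])
    fix f assume f: "f \<in> Arr A"
    let ?x = "Dom A f" and ?y = "Cod A f"
    have xy: "?x \<in> Obj A" "?y \<in> Obj A" using A f by auto
    \<comment> \<open>The identity \<open>Comp B (NAt t ?x) (g ?x)\<close> is inserted on the right;
      naturality of \<open>t\<close> carries its first factor past \<open>f\<close> to
      \<open>?y\<close>, where it cancels against \<open>g ?y\<close>.\<close>
    have "Comp B (g ?y) (FA G f) = Comp B (g ?y) (Comp B (FA G f) (Comp B (NAt t ?x) (g ?x)))"
      using B FG f xy g[OF xy(1)] by simp
    also have "\<dots> = Comp B (g ?y) (Comp B (Comp B (NAt t ?y) (FA F f)) (g ?x))"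
      using B FG f xy g[OF xy(1)] tx[OF xy(1)] nt_natural[OF t(1) f] t
      by (simp add: category.Comp_assoc)
    also have "\<dots> = Comp B (Comp B (g ?y) (NAt t ?y)) (Comp B (FA F f) (g ?x))"
      using B FG f xy g[OF xy(1)] g[OF xy(2)] tx[OF xy(2)]
        category.Comp_assoc[OF B, of "g ?y" "NAt t ?y" "Comp B (FA F f) (g ?x)"]
      by (simp add: category.Comp_assoc)
    also have "\<dots> = Comp B (FA F f) (g ?x)"
      using B FG f xy g[OF xy(1)] g[OF xy(2)] by simp
    finally show "Comp B (g ?y) (FA G f) = Comp B (FA F f) (g ?x)" .
  qed (use g in auto)
  then show ?l unfolding iso_arrow_def arrows_iff
    using t g by (auto intro!: bexI[of _ "mk_nt A G F g"] mk_nt_cong simp: arrows_iff)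
qed

section \<open>Two-categories of categories\<close>

lemma op2_simps [simp]:
  "Ob (op2 K) = Ob K"
  "Hom (op2 K) a b = Hom K b a"
  "One (op2 K) = One K"
  "Comp1 (op2 K) a b c g f = Comp1 K c b a f g"
  "Comp2 (op2 K) a b c t s = Comp2 K c b a s t"
  by (simp_all add: op2_def)

lemma Cat_of_simps [simp]:
  "Ob (Cat_of P) = {A. P A}"
  "Hom (Cat_of P) = functor_cat"
  "One (Cat_of P) = id_functor"
  "Comp1 (Cat_of P) A B C G F = fcomp A G F"
  "Comp2 (Cat_of P) A B C s t = hcomp A C s t"
  by (simp_all add: Cat_of_def)

lemma two_category_Cat_of:
  assumes P: "\<And>A. P A \<Longrightarrow> category A"
  shows "two_category (Cat_of P)"
proof (rule two_category.intro)
  fix a b c s f f' s' f'' t g g' t' g''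
  assume "a \<in> Ob (Cat_of P)" "b \<in> Ob (Cat_of P)" "c \<in> Ob (Cat_of P)"
    "s \<in> arrows (Hom (Cat_of P) a b) f f'" "s' \<in> arrows (Hom (Cat_of P) a b) f' f''"
    "t \<in> arrows (Hom (Cat_of P) b c) g g'" "t' \<in> arrows (Hom (Cat_of P) b c) g' g''"
  then have a: "category a" "category b" "category c"
    and s: "is_nt a b s" "NDom s = f" "NCod s = f'" and s': "is_nt a b s'" "NDom s' = f'" "NCod s' = f''"
    and t: "is_nt b c t" "NDom t = g" "NCod t = g'" and t': "is_nt b c t'" "NDom t' = g'" "NCod t' = g''"
    using P by (auto simp: arrows_iff)
  have f: "is_functor a b f'" "is_functor a b f''" "is_functor b c g" "is_functor b c g'"
    using s s' t t' by auto
  have "hcomp a c (mk_nt b (NDom t) (NCod t') (\<lambda>x. Comp c (NAt t' x) (NAt t x)))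
        (mk_nt a (NDom s) (NCod s') (\<lambda>x. Comp b (NAt s' x) (NAt s x))) =
      mk_nt a (NDom (hcomp a c t s)) (NCod (hcomp a c t' s'))
        (\<lambda>x. Comp c (NAt (hcomp a c t' s') x) (NAt (hcomp a c t s) x))"
  proof (subst hcomp_def, rule mk_nt_cong)
    fix x assume x: "x \<in> Obj a"
    note A = category.Comp_assoc[OF a(3)]
    \<comment> \<open>Naturality of \<open>t\<close> at the arrow \<open>NAt s' x\<close>;
      exchanging these two inner factors is the whole content of interchange.\<close>
    have n: "Comp c (NAt t (FO f'' x)) (FA g (NAt s' x)) = Comp c (FA g' (NAt s' x)) (NAt t (FO f' x))"
      using nt_natural[OF t(1), of "NAt s' x"] s' t x by simp
    have "Comp c (Comp c (NAt t' (FO f'' x)) (NAt t (FO f'' x))) (FA g (Comp b (NAt s' x) (NAt s x))) =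
        Comp c (NAt t' (FO f'' x)) (Comp c (Comp c (NAt t (FO f'' x)) (FA g (NAt s' x))) (FA g (NAt s x)))"
      using a s s' t t' f x by (simp add: A)
    also have "\<dots> = Comp c (Comp c (NAt t' (FO f'' x)) (FA g' (NAt s' x)))
        (Comp c (NAt t (FO f' x)) (FA g (NAt s x)))"
      unfolding n using a s s' t t' f x by (simp add: A)
    finally show "Comp c
        (NAt (mk_nt b (NDom t) (NCod t') (\<lambda>x. Comp c (NAt t' x) (NAt t x)))
          (FO (NCod (mk_nt a (NDom s) (NCod s') (\<lambda>x. Comp b (NAt s' x) (NAt s x)))) x))
        (FA (NDom (mk_nt b (NDom t) (NCod t') (\<lambda>x. Comp c (NAt t' x) (NAt t x))))
          (NAt (mk_nt a (NDom s) (NCod s') (\<lambda>x. Comp b (NAt s' x) (NAt s x))) x)) =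
        Comp c (NAt (hcomp a c t' s') x) (NAt (hcomp a c t s) x)"
      using a s s' t t' f x by simp
  qed (use s s' t t' in simp_all)
  then show "Comp2 (Cat_of P) a b c (Comp (Hom (Cat_of P) b c) t' t) (Comp (Hom (Cat_of P) a b) s' s) =
       Comp (Hom (Cat_of P) a c) (Comp2 (Cat_of P) a b c t' s') (Comp2 (Cat_of P) a b c t s)"
    by simp
next
  fix a b c d r s t
  assume "a \<in> Ob (Cat_of P)" "b \<in> Ob (Cat_of P)" "c \<in> Ob (Cat_of P)" "d \<in> Ob (Cat_of P)"
    "r \<in> Arr (Hom (Cat_of P) a b)" "s \<in> Arr (Hom (Cat_of P) b c)" "t \<in> Arr (Hom (Cat_of P) c d)"
  then have a: "category a" "category b" "category c" "category d"
    and r: "is_nt a b r" and s: "is_nt b c s" and t: "is_nt c d t"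
    using P by auto
  show "Comp2 (Cat_of P) a c d t (Comp2 (Cat_of P) a b c s r) =
       Comp2 (Cat_of P) a b d (Comp2 (Cat_of P) b c d t s) r"
    using a r s t
    by (auto simp: hcomp_def[of a d] category.Comp_assoc
        fcomp_assoc[OF nt_simps(1)[OF r]] fcomp_assoc[OF nt_simps(2)[OF r]] intro!: mk_nt_cong)
next
  fix a b c s f f' t g g'
  assume "a \<in> Ob (Cat_of P)" "b \<in> Ob (Cat_of P)" "c \<in> Ob (Cat_of P)"
    "s \<in> arrows (Hom (Cat_of P) a b) f f'" "t \<in> arrows (Hom (Cat_of P) b c) g g'"
  then show "Comp2 (Cat_of P) a b c t s \<in>
      arrows (Hom (Cat_of P) a c) (Comp1 (Cat_of P) a b c g f) (Comp1 (Cat_of P) a b c g' f')"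
    using P is_nt_hcomp[of a b c t s] by (auto simp: arrows_iff)
next
  fix a b s assume "a \<in> Ob (Cat_of P)" "b \<in> Ob (Cat_of P)" "s \<in> Arr (Hom (Cat_of P) a b)"
  then have a: "category a" "category b" and s: "is_nt a b s" using P by auto
  note F = nt_simps(1,2)[OF s]
  show "Comp2 (Cat_of P) a a b s (Id2 (Cat_of P) a a (One (Cat_of P) a)) = s"
    using a s by (auto simp: hcomp_def fcomp_id_right[OF F(1)] fcomp_id_right[OF F(2)] intro!: mk_nt_eqI[OF s])
  show "Comp2 (Cat_of P) a b b (Id2 (Cat_of P) b b (One (Cat_of P) b)) s = s"
    using a s by (auto simp: hcomp_def fcomp_id_left[OF F(1)] fcomp_id_left[OF F(2)] intro!: mk_nt_eqI[OF s])
qed (use P in \<open>auto simp: arrows_iff fcomp_id_left fcomp_id_right fcomp_assoc hcomp_def[of _ _ "mk_nt _ _ _ _"]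
    intro!: mk_nt_cong\<close>)

lemma (in two_category) two_category_op2: "two_category (op2 K)"
  by (rule two_category.intro)
    (simp_all add: hom_category one comp1 comp2 comp2_ident interchange comp1_one_left comp1_one_right
      comp1_assoc comp2_one_left comp2_one_right comp2_assoc)

lemma CAT_simps [simp]:
  "Ob CAT = {A. category A}"
  "Hom CAT = functor_cat"
  "One CAT = id_functor"
  "Comp1 CAT A B C G F = fcomp A G F"
  "Comp2 CAT A B C s t = hcomp A C s t"
  by (simp_all add: CAT_def)

section \<open>Representable 2-functors\<close>

context two_category begin

lemma Comp2_Arr:
  assumes "a \<in> Ob K" "b \<in> Ob K" "c \<in> Ob K" "t \<in> Arr (Hom K b c)" "s \<in> Arr (Hom K a b)"
  shows "Comp2 K a b c t s \<in> Arr (Hom K a c)"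
    and "Dom (Hom K a c) (Comp2 K a b c t s) = Comp1 K a b c (Dom (Hom K b c) t) (Dom (Hom K a b) s)"
    and "Cod (Hom K a c) (Comp2 K a b c t s) = Comp1 K a b c (Cod (Hom K b c) t) (Cod (Hom K a b) s)"
  using comp2[OF assms(1-3), of s "Dom (Hom K a b) s" "Cod (Hom K a b) s"
      t "Dom (Hom K b c) t" "Cod (Hom K b c) t"] assms
  by (auto simp: arrows_iff)

lemma Comp2_interchange:
  assumes "a \<in> Ob K" "b \<in> Ob K" "c \<in> Ob K"
    and "s \<in> Arr (Hom K a b)" "s' \<in> Arr (Hom K a b)" "Dom (Hom K a b) s' = Cod (Hom K a b) s"
    and "t \<in> Arr (Hom K b c)" "t' \<in> Arr (Hom K b c)" "Dom (Hom K b c) t' = Cod (Hom K b c) t"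
  shows "Comp (Hom K a c) (Comp2 K a b c t' s') (Comp2 K a b c t s) =
    Comp2 K a b c (Comp (Hom K b c) t' t) (Comp (Hom K a b) s' s)"
  using assms interchange[OF assms(1-3), of s "Dom (Hom K a b) s" "Cod (Hom K a b) s" s' "Cod (Hom K a b) s'"
      t "Dom (Hom K b c) t" "Cod (Hom K b c) t" t' "Cod (Hom K b c) t'"]
  by (auto simp: arrows_iff)

lemmas two_category_simps = hom_category one comp1 Comp2_Arr

lemma is_functor_pre_comp:
  assumes "B \<in> Ob K" "C \<in> Ob K" "X \<in> Ob K" "u \<in> Obj (Hom K B C)"
  shows "is_functor (Hom K C X) (Hom K B X) (pre_comp K B C X u)"
  unfolding pre_comp_def
  by (rule is_functor_mk_functor)
    (use assms in \<open>simp_all add: two_category_simps comp2_ident Comp2_interchange\<close>)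

lemma is_functor_post_comp:
  assumes "C \<in> Ob K" "X \<in> Ob K" "Y \<in> Ob K" "f \<in> Obj (Hom K X Y)"
  shows "is_functor (Hom K C X) (Hom K C Y) (post_comp K C X Y f)"
  unfolding post_comp_def
  by (rule is_functor_mk_functor)
    (use assms in \<open>simp_all add: two_category_simps comp2_ident Comp2_interchange\<close>)

lemma pre_comp_simps:
  "h \<in> Obj (Hom K C X) \<Longrightarrow> FO (pre_comp K B C X u) h = Comp1 K B C X h u"
  "t \<in> Arr (Hom K C X) \<Longrightarrow> FA (pre_comp K B C X u) t = Comp2 K B C X t (Id2 K B C u)"
  by (simp_all add: pre_comp_def)

lemma post_comp_simps:
  "h \<in> Obj (Hom K C X) \<Longrightarrow> FO (post_comp K C X Y f) h = Comp1 K C X Y f h"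
  "t \<in> Arr (Hom K C X) \<Longrightarrow> FA (post_comp K C X Y f) t = Comp2 K C X Y (Id2 K X Y f) t"
  by (simp_all add: post_comp_def)

lemma is_nt_pre_cell:
  assumes "B \<in> Ob K" "C \<in> Ob K" "X \<in> Ob K" "w \<in> Arr (Hom K B C)"
  shows "is_nt (Hom K C X) (Hom K B X) (pre_cell K B C X w)"
  unfolding pre_cell_def
  by (rule is_nt_mk_nt)
    (use assms in \<open>simp_all add: two_category_simps is_functor_pre_comp pre_comp_simps Comp2_interchange\<close>)

lemma is_nt_post_cell:
  assumes "C \<in> Ob K" "X \<in> Ob K" "Y \<in> Ob K" "w \<in> Arr (Hom K X Y)"
  shows "is_nt (Hom K C X) (Hom K C Y) (post_cell K C X Y w)"
  unfolding post_cell_def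
  by (rule is_nt_mk_nt)
    (use assms in \<open>simp_all add: two_category_simps is_functor_post_comp post_comp_simps Comp2_interchange\<close>)

lemma two_functor_representable:
  assumes X: "X \<in> Ob K"
  shows "two_functor (op2 K) CAT (representable K X)"
proof -
  have P: "is_functor (Hom K B C) (functor_cat (Hom K C X) (Hom K B X))
      (mk_functor (Hom K B C) (pre_comp K B C X) (pre_cell K B C X))"
    if B: "B \<in> Ob K" and C: "C \<in> Ob K" for B C
  proof (rule is_functor_mk_functor)
    fix u assume u: "u \<in> Obj (Hom K B C)"
    show "pre_cell K B C X (Id2 K B C u) = Ident (functor_cat (Hom K C X) (Hom K B X)) (pre_comp K B C X u)"
      using X B C u
      by (auto simp: pre_cell_def two_category_simps pre_comp_simps comp2_ident intro!: mk_nt_cong)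
  next
    fix w' w
    assume w: "w' \<in> Arr (Hom K B C)" "w \<in> Arr (Hom K B C)" "Dom (Hom K B C) w' = Cod (Hom K B C) w"
    show "pre_cell K B C X (Comp (Hom K B C) w' w) =
        Comp (functor_cat (Hom K C X) (Hom K B X)) (pre_cell K B C X w') (pre_cell K B C X w)"
      using X B C w
      by (auto simp: pre_cell_def two_category_simps Comp2_interchange intro!: mk_nt_cong)
  qed (use X B C in \<open>simp_all add: hom_category is_functor_pre_comp is_nt_pre_cell, simp_all add: pre_cell_def\<close>)
  have one': "pre_comp K C C X (One K C) = id_functor (Hom K C X)" if C: "C \<in> Ob K" for C
    unfolding pre_comp_def id_functor_def using X C
    by (intro mk_functor_cong) (auto simp: comp1_one_right comp2_one_right)
  \<comment> \<open>On 2-cells the identity of the composite of \<open>g\<close> and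
    \<open>f\<close> is split into two identities, by \<open>comp2_ident\<close> read from right to
    left, before associativity applies.\<close>
  have comp: "pre_comp K a c X (Comp1 K a b c g f) = fcomp (Hom K c X) (pre_comp K a b X f) (pre_comp K b c X g)"
    if "a \<in> Ob K" "b \<in> Ob K" "c \<in> Ob K" "f \<in> Obj (Hom K a b)" "g \<in> Obj (Hom K b c)" for a b c f g
    unfolding pre_comp_def[of _ a c] fcomp_def using X that
    by (intro mk_functor_cong)
      (auto simp: pre_comp_simps two_category_simps comp1_assoc comp2_assoc simp flip: comp2_ident)
  have cell: "pre_cell K a c X (Comp2 K a b c t s) =
      hcomp (Hom K c X) (Hom K a X) (pre_cell K a b X s) (pre_cell K b c X t)"
    if a: "a \<in> Ob K" "b \<in> Ob K" "c \<in> Ob K" and s: "s \<in> Arr (Hom K a b)" and t: "t \<in> Arr (Hom K b c)"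
    for a b c s t
    unfolding pre_cell_def hcomp_def using X a s t
    by (intro mk_nt_cong)
      (auto simp: two_category_simps comp pre_comp_simps Comp2_interchange comp2_assoc)
  show ?thesis
    unfolding two_functor_def representable_def using X P
    by (auto simp: hom_category one one' comp1 comp Comp2_Arr cell)
qed

end

section \<open>Isomorphisms of categories\<close>

text \<open>Stated by bijections, so that it makes sense before \<open>B\<close> is known to be a
  category; \<open>cat_iso_category\<close> derives that, and \<open>cat_iso_iso_functor\<close>
  supplies the inverse functor.\<close>

definition cat_iso :: "('o, 'a) cat \<Rightarrow> ('p, 'b) cat \<Rightarrow> ('o, 'a, 'p, 'b) functr \<Rightarrow> bool" where
  "cat_iso A B P \<longleftrightarrow> is_functor A B P \<and> bij_betw (FO P) (Obj A) (Obj B) \<and> bij_betw (FA P) (Arr A) (Arr B)"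

definition cat_inv :: "('o, 'a) cat \<Rightarrow> ('p, 'b) cat \<Rightarrow> ('o, 'a, 'p, 'b) functr \<Rightarrow> ('p, 'b, 'o, 'a) functr" where
  "cat_inv A B P = mk_functor B (inv_into (Obj A) (FO P)) (inv_into (Arr A) (FA P))"

lemma cat_isoI:
  assumes "is_functor A B P"
    and "\<And>y. y \<in> Obj B \<Longrightarrow> q y \<in> Obj A \<and> FO P (q y) = y"
    and "\<And>x. x \<in> Obj A \<Longrightarrow> q (FO P x) = x"
    and "\<And>g. g \<in> Arr B \<Longrightarrow> r g \<in> Arr A \<and> FA P (r g) = g"
    and "\<And>f. f \<in> Arr A \<Longrightarrow> r (FA P f) = f"
  shows "cat_iso A B P"
  unfolding cat_iso_def
  using assms by (auto intro!: bij_betw_byWitness[where f' = q] bij_betw_byWitness[where f' = r])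

lemma cat_iso_fcomp:
  assumes "category A" "cat_iso A B P" "cat_iso B C Q"
  shows "cat_iso A C (fcomp A Q P)"
proof -
  have "bij_betw (FO (fcomp A Q P)) (Obj A) (Obj C)"
    using assms bij_betw_trans[of "FO P" "Obj A" "Obj B" "FO Q" "Obj C"]
    by (subst bij_betw_cong[of _ _ "FO Q \<circ> FO P"]) (auto simp: cat_iso_def)
  moreover have "bij_betw (FA (fcomp A Q P)) (Arr A) (Arr C)"
    using assms bij_betw_trans[of "FA P" "Arr A" "Arr B" "FA Q" "Arr C"]
    by (subst bij_betw_cong[of _ _ "FA Q \<circ> FA P"]) (auto simp: cat_iso_def)
  ultimately show ?thesis
    using assms is_functor_fcomp[of A B P C Q] by (auto simp: cat_iso_def)
qed

context
  fixes A :: "('o, 'a) cat" and B :: "('p, 'b) cat" and P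
  assumes A: "category A" and P: "cat_iso A B P"
begin

lemma cat_iso_is_functor: "is_functor A B P"
  using P unfolding cat_iso_def by blast

lemma cat_inv_simps:
  "y \<in> Obj B \<Longrightarrow> FO (cat_inv A B P) y \<in> Obj A"
  "y \<in> Obj B \<Longrightarrow> FO P (FO (cat_inv A B P) y) = y"
  "x \<in> Obj A \<Longrightarrow> FO (cat_inv A B P) (FO P x) = x"
  "g \<in> Arr B \<Longrightarrow> FA (cat_inv A B P) g \<in> Arr A"
  "g \<in> Arr B \<Longrightarrow> FA P (FA (cat_inv A B P) g) = g"
  "f \<in> Arr A \<Longrightarrow> FA (cat_inv A B P) (FA P f) = f"
  using P cat_iso_is_functor unfolding cat_iso_def cat_inv_def
  by (auto simp: bij_betw_inv_into_left bij_betw_inv_into_right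
      intro: bij_betw_apply[OF bij_betw_inv_into])

lemma cat_iso_obtain:
  "y \<in> Obj B \<Longrightarrow> \<exists>x \<in> Obj A. y = FO P x"
  "g \<in> Arr B \<Longrightarrow> \<exists>f \<in> Arr A. g = FA P f"
  using cat_inv_simps by metis+

lemma cat_iso_eq_iff: "x \<in> Obj A \<Longrightarrow> y \<in> Obj A \<Longrightarrow> FO P x = FO P y \<longleftrightarrow> x = y"
  using cat_inv_simps(3) by metis

text \<open>Every object and arrow of \<open>B\<close> is an image under \<open>P\<close>, and
  composability lifts because \<open>FO P\<close> is injective. Functoriality is read from right to
  left, so that each law of \<open>B\<close> becomes the image of the law of
  \<open>A\<close>.\<close>

lemma cat_iso_category: "category B"
proof (rule categoryI)
  note F = cat_iso_is_functor
  fix h g f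
  assume "h \<in> Arr B" "g \<in> Arr B" "f \<in> Arr B" "Dom B h = Cod B g" "Dom B g = Cod B f"
  moreover then obtain h' g' f' where "h' \<in> Arr A" "g' \<in> Arr A" "f' \<in> Arr A"
    "h = FA P h'" "g = FA P g'" "f = FA P f'"
    using cat_iso_obtain(2) by metis
  ultimately show "Comp B h (Comp B g f) = Comp B (Comp B h g) f"
    using A F by (simp add: cat_iso_eq_iff category.Comp_assoc del: functor_simps(6) flip: functor_simps(6)[OF F])
qed (use A cat_iso_is_functor in \<open>auto dest!: cat_iso_obtain simp: cat_iso_eq_iff
    simp del: functor_simps(5,6) simp flip: functor_simps(5)[OF cat_iso_is_functor] functor_simps(6)[OF cat_iso_is_functor]\<close>)

lemma is_functor_cat_inv: "is_functor B A (cat_inv A B P)"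
proof -
  note F = cat_iso_is_functor
  have "is_functor B A (mk_functor B (FO (cat_inv A B P)) (FA (cat_inv A B P)))"
  proof (rule is_functor_mk_functor[OF cat_iso_category])
    fix g assume "g \<in> Arr B"
    then show "FA (cat_inv A B P) g \<in> Arr A \<and> Dom A (FA (cat_inv A B P) g) = FO (cat_inv A B P) (Dom B g) \<and>
        Cod A (FA (cat_inv A B P) g) = FO (cat_inv A B P) (Cod B g)"
      using A F by (auto dest!: cat_iso_obtain simp: cat_inv_simps)
  next
    fix y assume "y \<in> Obj B"
    then show "FA (cat_inv A B P) (Ident B y) = Ident A (FO (cat_inv A B P) y)"
      using A F by (auto dest!: cat_iso_obtain simp: cat_inv_simps simp del: functor_simps(5) simp flip: functor_simps(5)[OF F])
  next
    fix g f assume "g \<in> Arr B" "f \<in> Arr B" "Dom B g = Cod B f"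
    then show "FA (cat_inv A B P) (Comp B g f) = Comp A (FA (cat_inv A B P) g) (FA (cat_inv A B P) f)"
      using A F by (auto dest!: cat_iso_obtain simp: cat_inv_simps cat_iso_eq_iff simp del: functor_simps(6) simp flip: functor_simps(6)[OF F])
  qed (simp add: cat_inv_simps)
  then show ?thesis by (simp add: cat_inv_def mk_functor_def)
qed

lemma cat_iso_iso_functor: "iso_functor A B P"
  unfolding iso_functor_def fcomp_def id_functor_def
  using cat_iso_is_functor is_functor_cat_inv
  by (auto intro!: exI[of _ "cat_inv A B P"] mk_functor_cong simp: cat_inv_simps)

end

text \<open>
  The actions of \<open>Y\<close> on 1-cells and 2-cells are determined by naturality, being conjugates of those
  of \<open>X\<close>. In particular \<open>Y\<close> is a 2-functor.
\<close>

lemma two_naturally_isomorphic_transport: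
  fixes X :: "('o, 'm, 'c, 'p, 'a) cat_two_functr" and Y :: "('o, 'm, 'c, 'q, 'b) cat_two_functr"
  assumes K: "two_category K" and X: "two_functor K CAT X"
    and iso: "\<And>a. a \<in> Ob K \<Longrightarrow> cat_iso (P0 X a) (P0 Y a) (P a)"
    and Y_form: "\<And>a b. a \<in> Ob K \<Longrightarrow> b \<in> Ob K \<Longrightarrow> \<exists>y1 y2. P1 Y a b = mk_functor (Hom K a b) y1 y2"
    and Y_one_form: "\<And>a b f. a \<in> Ob K \<Longrightarrow> b \<in> Ob K \<Longrightarrow> f \<in> Obj (Hom K a b) \<Longrightarrow>
      \<exists>fo fa. FO (P1 Y a b) f = mk_functor (P0 Y a) fo fa"
    and Y_two_form: "\<And>a b t. a \<in> Ob K \<Longrightarrow> b \<in> Ob K \<Longrightarrow> t \<in> Arr (Hom K a b) \<Longrightarrow>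
      \<exists>n. FA (P1 Y a b) t =
        mk_nt (P0 Y a) (FO (P1 Y a b) (Dom (Hom K a b) t)) (FO (P1 Y a b) (Cod (Hom K a b) t)) n"
    and nat_Obj: "\<And>a b f x. a \<in> Ob K \<Longrightarrow> b \<in> Ob K \<Longrightarrow> f \<in> Obj (Hom K a b) \<Longrightarrow> x \<in> Obj (P0 X a) \<Longrightarrow>
      FO (FO (P1 Y a b) f) (FO (P a) x) = FO (P b) (FO (FO (P1 X a b) f) x)"
    and nat_Arr: "\<And>a b f x. a \<in> Ob K \<Longrightarrow> b \<in> Ob K \<Longrightarrow> f \<in> Obj (Hom K a b) \<Longrightarrow> x \<in> Arr (P0 X a) \<Longrightarrow>
      FA (FO (P1 Y a b) f) (FA (P a) x) = FA (P b) (FA (FO (P1 X a b) f) x)"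
    and nat_2: "\<And>a b t x. a \<in> Ob K \<Longrightarrow> b \<in> Ob K \<Longrightarrow> t \<in> Arr (Hom K a b) \<Longrightarrow> x \<in> Obj (P0 X a) \<Longrightarrow>
      NAt (FA (P1 Y a b) t) (FO (P a) x) = FA (P b) (NAt (FA (P1 X a b) t) x)"
  shows "two_naturally_isomorphic K X Y"
proof -
  have Xc: "category (P0 X a)" if "a \<in> Ob K" for a
    using X that by (auto simp: two_functor_def)
  have XF: "is_functor (Hom K a b) (functor_cat (P0 X a) (P0 X b)) (P1 X a b)"
    if "a \<in> Ob K" "b \<in> Ob K" for a b
    using X that by (auto simp: two_functor_def)
  have Yc: "category (P0 Y a)" if "a \<in> Ob K" for a
    using cat_iso_category[OF Xc iso] that by blast
  have PF: "is_functor (P0 X a) (P0 Y a) (P a)" if "a \<in> Ob K" for a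
    using cat_iso_is_functor[OF Xc iso] that by blast
  define Q where "Q a = cat_inv (P0 X a) (P0 Y a) (P a)" for a
  have QF: "is_functor (P0 Y a) (P0 X a) (Q a)" if "a \<in> Ob K" for a
    unfolding Q_def using is_functor_cat_inv[OF Xc iso] that by blast
  have PQ: "y \<in> Obj (P0 Y a) \<Longrightarrow> FO (P a) (FO (Q a) y) = y"
    "x \<in> Obj (P0 X a) \<Longrightarrow> FO (Q a) (FO (P a) x) = x"
    "g \<in> Arr (P0 Y a) \<Longrightarrow> FA (P a) (FA (Q a) g) = g"
    "f \<in> Arr (P0 X a) \<Longrightarrow> FA (Q a) (FA (P a) f) = f" if "a \<in> Ob K" for a x y f g
    unfolding Q_def using cat_inv_simps[OF Xc iso] that by blast+
  have homc: "category (Hom K a b)" if "a \<in> Ob K" "b \<in> Ob K" for a b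
    using K that by (rule two_category.hom_category)
  have Xf: "is_functor (P0 X a) (P0 X b) (FO (P1 X a b) f)"
    if "a \<in> Ob K" "b \<in> Ob K" "f \<in> Obj (Hom K a b)" for a b f
    using functor_simps(1)[OF XF] that by simp
  have Xt: "is_nt (P0 X a) (P0 X b) (FA (P1 X a b) t)"
    "NDom (FA (P1 X a b) t) = FO (P1 X a b) (Dom (Hom K a b) t)"
    "NCod (FA (P1 X a b) t) = FO (P1 X a b) (Cod (Hom K a b) t)"
    if "a \<in> Ob K" "b \<in> Ob K" "t \<in> Arr (Hom K a b)" for a b t
    using functor_simps(2-4)[OF XF] that by simp_all
  \<comment> \<open>Naturality at preimages under \<open>P a\<close> fixes the values on
    \<open>P0 Y a\<close>, and \<open>Y_one_form\<close> those outside. The formula presupposes no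
    functoriality of \<open>Y\<close>, which is read off from it below.\<close>
  have Y1: "FO (P1 Y a b) f = fcomp (P0 Y a) (P b) (fcomp (P0 Y a) (FO (P1 X a b) f) (Q a))"
    if ab: "a \<in> Ob K" "b \<in> Ob K" and f: "f \<in> Obj (Hom K a b)" for a b f
  proof -
    note Qa = QF[OF ab(1)]
    obtain fo fa where m: "FO (P1 Y a b) f = mk_functor (P0 Y a) fo fa"
      using Y_one_form[OF ab f] by blast
    have "fo y = FO (P b) (FO (FO (P1 X a b) f) (FO (Q a) y))" if "y \<in> Obj (P0 Y a)" for y
      using nat_Obj[OF ab f, of "FO (Q a) y"] that m ab PQ Qa by simp
    moreover have "fa y = FA (P b) (FA (FO (P1 X a b) f) (FA (Q a) y))" if "y \<in> Arr (P0 Y a)" for y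
      using nat_Arr[OF ab f, of "FA (Q a) y"] that m ab PQ Qa by simp
    ultimately show ?thesis unfolding m fcomp_def by (auto intro!: mk_functor_cong)
  qed
  have Y2: "FA (P1 Y a b) t =
      whisker_left (P0 Y a) (P b) (whisker_right (P0 Y a) (FA (P1 X a b) t) (Q a))"
    if ab: "a \<in> Ob K" "b \<in> Ob K" and t: "t \<in> Arr (Hom K a b)" for a b t
  proof -
    note Qa = QF[OF ab(1)]
    obtain n where m: "FA (P1 Y a b) t =
        mk_nt (P0 Y a) (FO (P1 Y a b) (Dom (Hom K a b) t)) (FO (P1 Y a b) (Cod (Hom K a b) t)) n"
      using Y_two_form[OF ab t] by blast
    have "n y = FA (P b) (NAt (FA (P1 X a b) t) (FO (Q a) y))" if "y \<in> Obj (P0 Y a)" for y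
      using nat_2[OF ab t, of "FO (Q a) y"] that m ab PQ Qa by simp
    then show ?thesis unfolding m whisker_left_def using ab t homc Xt
      by (auto simp: Y1 intro!: mk_nt_cong)
  qed
  have YF1: "is_functor (P0 Y a) (P0 Y b) (FO (P1 Y a b) f)"
    if ab: "a \<in> Ob K" "b \<in> Ob K" and f: "f \<in> Obj (Hom K a b)" for a b f
    unfolding Y1[OF ab f]
    by (intro is_functor_fcomp[of _ "P0 X b"] is_functor_fcomp[of _ "P0 X a"] Yc PF QF Xf that)
  have YF2: "is_nt (P0 Y a) (P0 Y b) (FA (P1 Y a b) t)"
    if ab: "a \<in> Ob K" "b \<in> Ob K" and t: "t \<in> Arr (Hom K a b)" for a b t
    unfolding Y2[OF ab t]
    by (intro is_nt_whisker_left[of _ "P0 X b"] is_nt_whisker_right[of _ "P0 X a"] Yc Xc PF QF Xt that)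
  have YF: "is_functor (Hom K a b) (functor_cat (P0 Y a) (P0 Y b)) (P1 Y a b)"
    if ab: "a \<in> Ob K" "b \<in> Ob K" for a b
  proof -
    note Qa = QF[OF ab(1)] and Pb = PF[OF ab(2)] and Xab = XF[OF ab]
    obtain y1 y2 where m: "P1 Y a b = mk_functor (Hom K a b) y1 y2"
      using Y_form[OF ab] by blast
    have "is_functor (Hom K a b) (functor_cat (P0 Y a) (P0 Y b))
        (mk_functor (Hom K a b) (FO (P1 Y a b)) (FA (P1 Y a b)))"
    proof (rule is_functor_mk_functor[OF homc[OF ab]])
      fix f assume f: "f \<in> Obj (Hom K a b)"
      note Xff = Xf[OF ab f]
      show "FA (P1 Y a b) (Ident (Hom K a b) f) = Ident (functor_cat (P0 Y a) (P0 Y b)) (FO (P1 Y a b) f)"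
        using ab f homc[OF ab] Qa Pb Xff functor_simps(5)[OF Xab f]
        by (auto simp: Y2 Y1 whisker_left_def intro!: mk_nt_cong)
    next
      fix g f assume fg: "g \<in> Arr (Hom K a b)" "f \<in> Arr (Hom K a b)" "Dom (Hom K a b) g = Cod (Hom K a b) f"
      note c = functor_simps(6)[OF Xab fg]
      show "FA (P1 Y a b) (Comp (Hom K a b) g f) =
          Comp (functor_cat (P0 Y a) (P0 Y b)) (FA (P1 Y a b) g) (FA (P1 Y a b) f)"
        using ab fg homc[OF ab] Qa Pb Xt[OF ab fg(1)] Xt[OF ab fg(2)] c
        by (auto simp: Y2 whisker_left_def intro!: mk_nt_cong)
    qed (use ab homc[OF ab] YF1 YF2 in \<open>auto simp: Y1 Y2 Xt\<close>)
    \<comment> \<open>By \<open>Y_form\<close> the functor \<open>P1 Y a b\<close> is its own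
      restriction.\<close>
    then show ?thesis unfolding m by (simp add: mk_functor_def)
  qed
  \<comment> \<open>Conjugates compose: in the middle \<open>Q b\<close> cancels \<open>P b\<close>
    on values of \<open>F\<close>, which lie in \<open>P0 X b\<close>.\<close>
  have conj_fcomp: "fcomp (P0 Y a) (P c) (fcomp (P0 Y a) (fcomp (P0 X a) G F) (Q a)) =
      fcomp (P0 Y a) (fcomp (P0 Y b) (P c) (fcomp (P0 Y b) G (Q b)))
        (fcomp (P0 Y a) (P b) (fcomp (P0 Y a) F (Q a)))"
    if "a \<in> Ob K" "b \<in> Ob K" "is_functor (P0 X a) (P0 X b) F" for a b c F and G :: "('p, 'a, 'p, 'a) functr"
    unfolding fcomp_def[of "P0 Y a"] using that QF[OF that(1)] PF[OF that(2)] PQ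
    by (auto intro!: mk_functor_cong)
  have "two_functor K CAT Y"
    unfolding two_functor_def
  proof (intro conjI ballI)
    fix a assume a: "a \<in> Ob K"
    have "FO (P1 X a a) (One K a) = id_functor (P0 X a)"
      using X a by (auto simp: two_functor_def)
    then show "FO (P1 Y a a) (One K a) = One CAT (P0 Y a)"
      using a QF[OF a] PQ two_category.one[OF K]
      by (auto simp: Y1 fcomp_def id_functor_def intro!: mk_functor_cong)
  next
    fix a b c f g
    assume a: "a \<in> Ob K" "b \<in> Ob K" "c \<in> Ob K" "f \<in> Obj (Hom K a b)" "g \<in> Obj (Hom K b c)"
    have "FO (P1 X a c) (Comp1 K a b c g f) = fcomp (P0 X a) (FO (P1 X b c) g) (FO (P1 X a b) f)"
      using X a by (auto simp: two_functor_def)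
    then show "FO (P1 Y a c) (Comp1 K a b c g f) =
        Comp1 CAT (P0 Y a) (P0 Y b) (P0 Y c) (FO (P1 Y b c) g) (FO (P1 Y a b) f)"
      using a Xf[OF a(1,2,4)] two_category.comp1[OF K] by (simp add: Y1 conj_fcomp)
  next
    fix a b c s t
    assume a: "a \<in> Ob K" "b \<in> Ob K" "c \<in> Ob K" "s \<in> Arr (Hom K a b)" "t \<in> Arr (Hom K b c)"
    note s = Xt[OF a(1,2,4)] and t = Xt[OF a(2,3,5)]
    have "FA (P1 X a c) (Comp2 K a b c t s) = hcomp (P0 X a) (P0 X c) (FA (P1 X b c) t) (FA (P1 X a b) s)"
      using X a by (auto simp: two_functor_def)
    moreover have "is_functor (P0 X a) (P0 X b) (FO (P1 X a b) (Dom (Hom K a b) s))"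
      "is_functor (P0 X a) (P0 X b) (FO (P1 X a b) (Cod (Hom K a b) s))"
      "is_functor (P0 X b) (P0 X c) (FO (P1 X b c) (Dom (Hom K b c) t))"
      using a homc by (auto intro!: Xf)
    ultimately show "FA (P1 Y a c) (Comp2 K a b c t s) =
        Comp2 CAT (P0 Y a) (P0 Y b) (P0 Y c) (FA (P1 Y b c) t) (FA (P1 Y a b) s)"
      using a PQ QF[OF a(1)] PF[OF a(2)] PF[OF a(3)] s t two_category.Comp2_Arr[OF K, of a b c t s]
      by (auto simp: Y2 hcomp_def[of "P0 Y a"] whisker_left_def[of "P0 Y a" "P c" "whisker_right _ _ _"]
          conj_fcomp intro!: mk_nt_cong)
  qed (use Yc YF in auto)
  moreover have "fcomp (P0 X a) (FO (P1 Y a b) f) (P a) = fcomp (P0 X a) (P b) (FO (P1 X a b) f)"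
    if "a \<in> Ob K" "b \<in> Ob K" "f \<in> Obj (Hom K a b)" for a b f
    using that by (auto simp: fcomp_def nat_Obj nat_Arr intro!: mk_functor_cong)
  moreover have "whisker_right (P0 X a) (FA (P1 Y a b) t) (P a) = whisker_left (P0 X a) (P b) (FA (P1 X a b) t)"
    if ab: "a \<in> Ob K" "b \<in> Ob K" and t: "t \<in> Arr (Hom K a b)" for a b t
  proof -
    obtain n where m: "FA (P1 Y a b) t =
        mk_nt (P0 Y a) (FO (P1 Y a b) (Dom (Hom K a b) t)) (FO (P1 Y a b) (Cod (Hom K a b) t)) n"
      using Y_two_form[OF ab t] by blast
    then have "NDom (FA (P1 Y a b) t) = FO (P1 Y a b) (Dom (Hom K a b) t)"
      "NCod (FA (P1 Y a b) t) = FO (P1 Y a b) (Cod (Hom K a b) t)" by simp_all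
    then show ?thesis
      unfolding whisker_right_def whisker_left_def
      using ab t homc Xt[OF ab t]
      by (auto simp: nat_2 fcomp_def nat_Obj nat_Arr intro!: mk_nt_cong mk_functor_cong)
  qed
  ultimately show ?thesis
    unfolding two_naturally_isomorphic_def
    using X cat_iso_iso_functor[OF Xc iso] by blast
qed

section \<open>Smallness\<close>

text \<open>
  Cones and their modifications live in types other than \<open>'u\<close>, where \<open>small\<close> makes no sense.
\<close>

context set_universe begin

definition ess_small :: "'x set \<Rightarrow> bool" where
  "ess_small S \<longleftrightarrow> (\<exists>X f. small elts X \<and> S \<subseteq> f ` X)"

lemma ess_small_subset: "ess_small S \<Longrightarrow> T \<subseteq> S \<Longrightarrow> ess_small T"
  unfolding ess_small_def by blast

lemma ess_small_image: "ess_small S \<Longrightarrow> ess_small (g ` S)"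
  unfolding ess_small_def by (metis image_comp image_mono)

lemma ess_small_if_small: "small elts X \<Longrightarrow> ess_small X"
  unfolding ess_small_def by (metis image_ident subset_refl)

text \<open>Each element of \<open>S\<close> is named by a chosen preimage in \<open>X\<close>; the
  names form a subset of \<open>X\<close>, small by \<open>separation\<close>. In this way the cones
  receive names in \<open>'u\<close>.\<close>

lemma ess_small_inj:
  assumes "ess_small S"
  obtains e :: "_ \<Rightarrow> 'u" where "inj_on e S" and "small elts (e ` S)"
proof -
  obtain X and f :: "'u \<Rightarrow> _" where X: "small elts X" "S \<subseteq> f ` X"
    using assms unfolding ess_small_def by blast
  have "inj_on (inv_into X f) S" using X(2) by (rule inj_on_inv_into)
  moreover have "small elts (inv_into X f ` S)"
    using X by (intro separation[OF X(1)]) (auto intro: inv_into_into)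
  ultimately show thesis by (rule that)
qed

lemma small_empty: "small elts {}"
  \<comment> \<open>\<open>undefined\<close> serves as an arbitrary element, whose extension is cut
    down to the empty set.\<close>
  using separation[of "elts undefined" "{}"] by (simp add: small_def)

text \<open>The members of \<open>Pow X\<close> are HOL sets; each is small by
  \<open>separation\<close> and hence the extension of an element counted by
  \<open>power_set\<close>.\<close>

lemma small_Pow:
  assumes "small elts X"
  shows "ess_small (Pow X)"
proof -
  obtain x where x: "X = elts x" using assms by (auto simp: small_def)
  have "Pow X \<subseteq> elts ` {y. elts y \<subseteq> elts x}"
  proof
    fix Y assume "Y \<in> Pow X"
    then have "small elts Y" using separation[OF assms] by blast
    then show "Y \<in> elts ` {y. elts y \<subseteq> elts x}"
      using \<open>Y \<in> Pow X\<close> x by (auto simp: small_def)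
  qed
  then show ?thesis unfolding ess_small_def using power_set by blast
qed

lemma ess_small_Pow:
  assumes "ess_small S"
  shows "ess_small (Pow S)"
proof -
  obtain X and f :: "'u \<Rightarrow> _" where X: "small elts X" "S \<subseteq> f ` X"
    using assms unfolding ess_small_def by blast
  have "Pow S \<subseteq> (`) f ` Pow X"
  proof
    fix T assume "T \<in> Pow S"
    then have "T \<subseteq> f ` X" using X(2) by blast
    then show "T \<in> (`) f ` Pow X" by (auto elim!: subset_imageE)
  qed
  then show ?thesis using ess_small_subset ess_small_image small_Pow[OF X(1)] by blast
qed

text \<open>Pairing has to be derived. The empty set \<open>z\<close> and its singleton
  \<open>w\<close> are distinct and both counted by the power set of \<open>w\<close>;
  \<open>replacement\<close> carries \<open>{z, w}\<close> onto \<open>{a, b}\<close>.\<close>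

lemma small_doubleton: "small elts {a, b}"
proof -
  obtain z where z: "elts z = {}" using small_empty by (auto simp: small_def)
  have "{y. elts y \<subseteq> elts z} = {z}" using z extensionality by auto
  then have "small elts {z}" using power_set[of z] by simp
  then obtain w where w: "elts w = {z}" by (auto simp: small_def)
  have "w \<noteq> z" using w z by auto
  have "{z, w} \<subseteq> {y. elts y \<subseteq> elts w}" using w z by auto
  then have "small elts {z, w}" using power_set[of w] separation by blast
  then have "small elts ((\<lambda>x. if x = z then a else b) ` {z, w})" by (rule replacement)
  then show ?thesis using \<open>w \<noteq> z\<close> by (simp add: insert_commute)
qed

lemma small_Un:
  assumes "small elts X" "small elts Y"
  shows "small elts (X \<union> Y)"
proof -
  obtain x y where "X = elts x" "Y = elts y" using assms by (auto simp: small_def)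
  then show ?thesis using union[OF small_doubleton[of x y]] by simp
qed

lemma small_UN:
  assumes "small elts X" and "\<And>x. x \<in> X \<Longrightarrow> small elts (f x)"
  shows "small elts (\<Union>x\<in>X. f x)"
proof -
  obtain g where g: "\<And>x. x \<in> X \<Longrightarrow> f x = elts (g x)"
    using assms(2) unfolding small_def image_iff by metis
  then have "(\<Union>x\<in>X. f x) = (\<Union>y\<in>g ` X. elts y)" by simp
  then show ?thesis using union[OF replacement[OF assms(1)]] by simp
qed

text \<open>Kuratowski pairs, formed as HOL sets of sets over \<open>'u\<close> rather than inside
  the universe, place \<open>X \<times> Y\<close> in a double power set; \<open>inv k\<close>
  decodes them.\<close>

lemma ess_small_Times:
  assumes "ess_small S" "ess_small T"
  shows "ess_small (S \<times> T)"
proof -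
  obtain X and f :: "'u \<Rightarrow> _" where X: "small elts X" "S \<subseteq> f ` X"
    using assms(1) unfolding ess_small_def by blast
  obtain Y and g :: "'u \<Rightarrow> _" where Y: "small elts Y" "T \<subseteq> g ` Y"
    using assms(2) unfolding ess_small_def by blast
  define k where "k = (\<lambda>(x, y). {{x :: 'u}, {x, y}})"
  have "x = x' \<and> y = y'" if "{{x}, {x, y}} = {{x'}, {x', y'}}" for x y x' y' :: 'u
    using that by (metis doubleton_eq_iff insert_absorb2)
  then have k: "inj k" unfolding k_def inj_def by auto
  have "ess_small (Pow (Pow (X \<union> Y)))"
    using X Y small_Un by (intro ess_small_Pow ess_small_if_small)
  then have "ess_small (k ` (X \<times> Y))"
    by (rule ess_small_subset) (auto simp: k_def)
  then have "ess_small ((map_prod f g \<circ> inv k) ` k ` (X \<times> Y))" by (rule ess_small_image)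
  then have "ess_small (map_prod f g ` (X \<times> Y))"
    using k by (simp add: image_image)
  then show ?thesis by (rule ess_small_subset) (use X(2) Y(2) in force)
qed

text \<open>
  Partial functions; the domain has to vary because the component maps of functors between different
  categories are extensional on different sets.
\<close>

definition partials :: "'x set \<Rightarrow> 'y set \<Rightarrow> ('x \<Rightarrow> 'y) set" where
  "partials S T = {h. \<exists>Z \<subseteq> S. h \<in> extensional Z \<and> h ` Z \<subseteq> T}"

lemma partialsI: "h \<in> extensional Z \<Longrightarrow> Z \<subseteq> S \<Longrightarrow> (\<And>x. x \<in> Z \<Longrightarrow> h x \<in> T) \<Longrightarrow> h \<in> partials S T"
  unfolding partials_def by blast

text \<open>A partial function is recovered from its graph, a subset of \<open>S \<times> T\<close>:
  off the domain of the graph its value is \<open>undefined\<close>, by extensionality.\<close>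

lemma ess_small_partials:
  assumes "ess_small S" "ess_small T"
  shows "ess_small (partials S T)"
proof -
  let ?fun = "\<lambda>G x. if x \<in> Domain G then THE y. (x, y) \<in> G else undefined"
  have "partials S T \<subseteq> ?fun ` Pow (S \<times> T)"
  proof
    fix h assume "h \<in> partials S T"
    then obtain Z where Z: "Z \<subseteq> S" "h \<in> extensional Z" "h ` Z \<subseteq> T" unfolding partials_def by blast
    have "h = ?fun ((\<lambda>x. (x, h x)) ` Z)" using Z(2) by (auto simp: extensional_def Domain_unfold image_iff)
    moreover have "(\<lambda>x. (x, h x)) ` Z \<in> Pow (S \<times> T)" using Z by auto
    ultimately show "h \<in> ?fun ` Pow (S \<times> T)" by blast
  qed
  then show ?thesis
    by (rule ess_small_subset[OF ess_small_image[OF ess_small_Pow[OF ess_small_Times[OF assms]]]])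
qed

end

text \<open>Cones and modifications are merely enclosed in iterated sets of partial functions
  between small sets, regardless of their laws. Collecting objects and arrows over all of
  \<open>Ob D\<close> makes these sets independent of the object at which a component lives.\<close>

lemma ess_small_pseudo_hom:
  fixes D :: "('u, 'u, 'u) two_cat" and J F :: "('u, 'u, 'u, 'u, 'u) cat_pseudo_functr"
  assumes "set_universe elts" and D: "small_two_category elts D"
    and J: "\<And>a. a \<in> Ob D \<Longrightarrow> small_category elts (P0 J a)"
    and F: "\<And>a. a \<in> Ob D \<Longrightarrow> small_category elts (P0 F a)"
  shows "set_universe.ess_small elts (Obj (pseudo_hom D J F))"
    and "set_universe.ess_small elts (Arr (pseudo_hom D J F))"
proof -
  interpret set_universe elts by fact
  have Ob: "small elts (Ob D)" using D by (simp add: small_two_category_def)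
  define OJ where "OJ = (\<Union>a\<in>Ob D. Obj (P0 J a))"
  define AJ where "AJ = (\<Union>a\<in>Ob D. Arr (P0 J a))"
  define OF where "OF = (\<Union>a\<in>Ob D. Obj (P0 F a))"
  define AF where "AF = (\<Union>a\<in>Ob D. Arr (P0 F a))"
  define M where "M = (\<Union>a\<in>Ob D. \<Union>b\<in>Ob D. Obj (Hom D a b))"
  have "small elts OJ" "small elts AJ" "small elts OF" "small elts AF" "small elts M"
    unfolding OJ_def AJ_def OF_def AF_def M_def
    using Ob J F D by (auto intro!: small_UN simp: small_category_def small_two_category_def)
  note small = this[THEN ess_small_if_small] ess_small_if_small[OF Ob]
  \<comment> \<open>Enclosures for functors, transformations, pseudo natural transformations and
    modifications. \<open>T1\<close> is packed into one partial function on triples, because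
    \<open>partials\<close> speaks of functions of one argument.\<close>
  define FS where "FS = (\<lambda>(x, y). \<lparr>FO = x, FA = y\<rparr>) ` (partials OJ OF \<times> partials AJ AF)"
  define NS where "NS = (\<lambda>(x, y, z). \<lparr>NDom = x, NCod = y, NAt = z\<rparr>) ` (FS \<times> FS \<times> partials OJ AF)"
  define PS where "PS = (\<lambda>(x, y). \<lparr>T0 = x, T1 = \<lambda>a b f. y (a, b, f)\<rparr>) `
    (partials (Ob D) FS \<times> partials (Ob D \<times> Ob D \<times> M) NS)"
  define MS where "MS = (\<lambda>(x, y, z). \<lparr>MDom = x, MCod = y, MAt = z\<rparr>) ` (PS \<times> PS \<times> partials (Ob D) NS)"
  have sub: "x \<in> Obj (P0 J a) \<Longrightarrow> x \<in> OJ" "f \<in> Arr (P0 J a) \<Longrightarrow> f \<in> AJ"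
    "y \<in> Obj (P0 F a) \<Longrightarrow> y \<in> OF" "g \<in> Arr (P0 F a) \<Longrightarrow> g \<in> AF" if "a \<in> Ob D" for a x f y g
    unfolding OJ_def AJ_def OF_def AF_def using that by blast+
  have FS: "ess_small FS" unfolding FS_def
    by (intro ess_small_image ess_small_Times ess_small_partials small)
  have NS: "ess_small NS" unfolding NS_def
    by (intro ess_small_image ess_small_Times ess_small_partials small FS)
  have PS: "ess_small PS" unfolding PS_def
    by (intro ess_small_image ess_small_Times ess_small_partials small FS NS)
  have MS: "ess_small MS" unfolding MS_def
    by (intro ess_small_image ess_small_Times ess_small_partials small PS NS)
  have FSI: "G \<in> FS" if "is_functor (P0 J a) (P0 F b) G" "a \<in> Ob D" "b \<in> Ob D" for a b G
  proof -
    have "FO G \<in> partials OJ OF"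
      using that by (intro partialsI[of _ "Obj (P0 J a)"])
        (auto simp: functor_extensional intro: sub(1) sub(3)[of b])
    moreover have "FA G \<in> partials AJ AF"
      using that by (intro partialsI[of _ "Arr (P0 J a)"])
        (auto simp: functor_extensional intro: sub(2) sub(4)[of b])
    ultimately show ?thesis unfolding FS_def by (intro image_eqI[of _ _ "(FO G, FA G)"]) simp_all
  qed
  have NSI: "t \<in> NS" if t: "is_nt (P0 J a) (P0 F b) t" "a \<in> Ob D" "b \<in> Ob D" for a b t
  proof -
    have "NAt t \<in> partials OJ AF"
      using that by (intro partialsI[of _ "Obj (P0 J a)"])
        (auto simp: nt_extensional intro: sub(1) sub(4)[of b])
    moreover have "NDom t \<in> FS" "NCod t \<in> FS" using t by (auto intro!: FSI[of a b])
    ultimately show ?thesis unfolding NS_def by (intro image_eqI[of _ _ "(NDom t, NCod t, NAt t)"]) simp_all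
  qed
  have PSI: "s \<in> PS" if s: "is_pseudo_nt D J F s" for s
  proof -
    have "T0 s \<in> partials (Ob D) FS"
      using s by (intro partialsI[of _ "Ob D"]) (auto simp: is_pseudo_nt_def intro!: FSI)
    moreover have "(\<lambda>(a, b, f). T1 s a b f) \<in> partials (Ob D \<times> Ob D \<times> M) NS"
    proof (rule partialsI)
      \<comment> \<open>The range of \<open>f\<close> depends on \<open>a\<close> and
        \<open>b\<close>, so the exact domain is only a part of the product
        \<open>Ob D \<times> Ob D \<times> M\<close>; outside it \<open>is_pseudo_nt\<close>
        prescribes \<open>undefined\<close>.\<close>
      show "(\<lambda>(a, b, f). T1 s a b f) \<in> extensional {(a, b, f). a \<in> Ob D \<and> b \<in> Ob D \<and> f \<in> Obj (Hom D a b)}"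
        using s by (auto simp: extensional_def is_pseudo_nt_def)
      fix x assume x: "x \<in> {(a, b, f). a \<in> Ob D \<and> b \<in> Ob D \<and> f \<in> Obj (Hom D a b)}"
      then obtain a b f where abf: "x = (a, b, f)" "a \<in> Ob D" "b \<in> Ob D" "f \<in> Obj (Hom D a b)" by blast
      then have "iso_arrow (functor_cat (P0 J a) (P0 F b))
        (fcomp (P0 J a) (FO (P1 F a b) f) (T0 s a))
        (fcomp (P0 J a) (T0 s b) (FO (P1 J a b) f))
        (T1 s a b f)"
        using s unfolding is_pseudo_nt_def by blast
      then have "is_nt (P0 J a) (P0 F b) (T1 s a b f)"
        unfolding iso_arrow_def by (simp add: arrows_iff)
      then show "(case x of (a, b, f) \<Rightarrow> T1 s a b f) \<in> NS" using abf by (auto intro: NSI)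
    qed (auto simp: M_def)
    ultimately show ?thesis unfolding PS_def by (intro image_eqI[of _ _ "(T0 s, \<lambda>(a, b, f). T1 s a b f)"]) simp_all
  qed
  have MSI: "m \<in> MS" if m: "is_modification D J F m" for m
  proof -
    have "MAt m \<in> partials (Ob D) NS"
      using m by (intro partialsI[of _ "Ob D"]) (auto simp: is_modification_def arrows_iff intro!: NSI)
    moreover have "MDom m \<in> PS" "MCod m \<in> PS" using m by (auto simp: is_modification_def intro!: PSI)
    ultimately show ?thesis unfolding MS_def by (intro image_eqI[of _ _ "(MDom m, MCod m, MAt m)"]) simp_all
  qed
  show "ess_small (Obj (pseudo_hom D J F))" "ess_small (Arr (pseudo_hom D J F))"
    using PS MS PSI MSI by (auto simp: pseudo_hom_def intro: ess_small_subset)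
qed

section \<open>Exchanging the arguments of a functor to a functor category\<close>

text \<open>For \<open>T\<close> from \<open>A\<close> to \<open>[C, B]\<close>, this is
  \<open>T\<close> followed by evaluation at \<open>c\<close>. Letting \<open>c\<close> vary gives
  \<open>swap\<close>, the transpose of \<open>T\<close>.\<close>

definition swap_at :: "('i, 'k) cat \<Rightarrow> ('i, 'k, ('o, 'a, 'p, 'b) functr, ('o, 'a, 'p, 'b) nt) functr \<Rightarrow>
    'o \<Rightarrow> ('i, 'k, 'p, 'b) functr" where
  "swap_at A T c = mk_functor A (\<lambda>j. FO (FO T j) c) (\<lambda>k. NAt (FA T k) c)"

definition swap :: "('i, 'k) cat \<Rightarrow> ('o, 'a) cat \<Rightarrow>
    ('i, 'k, ('o, 'a, 'p, 'b) functr, ('o, 'a, 'p, 'b) nt) functr \<Rightarrow>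
    ('o, 'a, ('i, 'k, 'p, 'b) functr, ('i, 'k, 'p, 'b) nt) functr" where
  "swap A C T = mk_functor C (swap_at A T)
    (\<lambda>u. mk_nt A (swap_at A T (Dom C u)) (swap_at A T (Cod C u)) (\<lambda>j. FA (FO T j) u))"

lemma swap_at_simps [simp]:
  "j \<in> Obj A \<Longrightarrow> FO (swap_at A T c) j = FO (FO T j) c"
  "k \<in> Arr A \<Longrightarrow> FA (swap_at A T c) k = NAt (FA T k) c"
  by (simp_all add: swap_at_def)

lemma swap_simps [simp]:
  "c \<in> Obj C \<Longrightarrow> FO (swap A C T) c = swap_at A T c"
  "u \<in> Arr C \<Longrightarrow> FA (swap A C T) u =
    mk_nt A (swap_at A T (Dom C u)) (swap_at A T (Cod C u)) (\<lambda>j. FA (FO T j) u)"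
  by (simp_all add: swap_def)

context
  fixes A :: "('i, 'k) cat" and B :: "('p, 'b) cat" and C :: "('o, 'a) cat" and T
  assumes A: "category A" and B: "category B" and C: "category C"
    and T: "is_functor A (functor_cat C B) T"
begin

lemma functor_to_functor_cat:
  "j \<in> Obj A \<Longrightarrow> is_functor C B (FO T j)"
  "k \<in> Arr A \<Longrightarrow> is_nt C B (FA T k)"
  "k \<in> Arr A \<Longrightarrow> NDom (FA T k) = FO T (Dom A k)"
  "k \<in> Arr A \<Longrightarrow> NCod (FA T k) = FO T (Cod A k)"
  "j \<in> Obj A \<Longrightarrow> c \<in> Obj C \<Longrightarrow> NAt (FA T (Ident A j)) c = Ident B (FO (FO T j) c)"
  "k' \<in> Arr A \<Longrightarrow> k \<in> Arr A \<Longrightarrow> Dom A k' = Cod A k \<Longrightarrow> c \<in> Obj C \<Longrightarrow>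
    NAt (FA T (Comp A k' k)) c = Comp B (NAt (FA T k') c) (NAt (FA T k) c)"
  using functor_simps[OF T] by simp_all

lemma functor_to_functor_cat_at:
  "j \<in> Obj A \<Longrightarrow> c \<in> Obj C \<Longrightarrow> FO (FO T j) c \<in> Obj B"
  "j \<in> Obj A \<Longrightarrow> u \<in> Arr C \<Longrightarrow> FA (FO T j) u \<in> Arr B"
  "j \<in> Obj A \<Longrightarrow> u \<in> Arr C \<Longrightarrow> Dom B (FA (FO T j) u) = FO (FO T j) (Dom C u)"
  "j \<in> Obj A \<Longrightarrow> u \<in> Arr C \<Longrightarrow> Cod B (FA (FO T j) u) = FO (FO T j) (Cod C u)"
  "k \<in> Arr A \<Longrightarrow> c \<in> Obj C \<Longrightarrow> NAt (FA T k) c \<in> Arr B"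
  "k \<in> Arr A \<Longrightarrow> c \<in> Obj C \<Longrightarrow> Dom B (NAt (FA T k) c) = FO (FO T (Dom A k)) c"
  "k \<in> Arr A \<Longrightarrow> c \<in> Obj C \<Longrightarrow> Cod B (NAt (FA T k) c) = FO (FO T (Cod A k)) c"
  using functor_simps(1-4)[OF functor_to_functor_cat(1)] nt_simps(3-5)[OF functor_to_functor_cat(2)]
  by (simp_all add: functor_to_functor_cat(3,4))

lemma is_functor_swap_at:
  assumes c: "c \<in> Obj C"
  shows "is_functor A B (swap_at A T c)"
  unfolding swap_at_def
  by (rule is_functor_mk_functor[OF A]) (use A c functor_to_functor_cat functor_to_functor_cat_at in auto)

text \<open>The cell at an arrow \<open>u\<close> of \<open>C\<close> is natural along
  \<open>k\<close> because its square is the naturality square of \<open>FA T k\<close> at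
  \<open>u\<close>, with its two paths interchanged.\<close>

lemma is_functor_swap: "is_functor C (functor_cat A B) (swap A C T)"
  unfolding swap_def
proof (rule is_functor_mk_functor[OF C])
  fix u assume u: "u \<in> Arr C"
  have "is_nt A B (mk_nt A (swap_at A T (Dom C u)) (swap_at A T (Cod C u)) (\<lambda>j. FA (FO T j) u))"
  proof (rule is_nt_mk_nt[OF A is_functor_swap_at is_functor_swap_at])
    fix j assume "j \<in> Obj A"
    then show "FA (FO T j) u \<in> Arr B \<and> Dom B (FA (FO T j) u) = FO (swap_at A T (Dom C u)) j \<and>
        Cod B (FA (FO T j) u) = FO (swap_at A T (Cod C u)) j"
      using u functor_simps[OF functor_to_functor_cat(1)] by simp
  next
    fix k assume k: "k \<in> Arr A"
    then show "Comp B (FA (FO T (Cod A k)) u) (FA (swap_at A T (Dom C u)) k) =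
         Comp B (FA (swap_at A T (Cod C u)) k) (FA (FO T (Dom A k)) u)"
      using nt_natural[OF functor_to_functor_cat(2) u] functor_to_functor_cat by simp
  qed (use u C in auto)
  then show "mk_nt A (swap_at A T (Dom C u)) (swap_at A T (Cod C u)) (\<lambda>j. FA (FO T j) u) \<in> Arr (functor_cat A B) \<and>
      Dom (functor_cat A B) (mk_nt A (swap_at A T (Dom C u)) (swap_at A T (Cod C u)) (\<lambda>j. FA (FO T j) u)) =
        swap_at A T (Dom C u) \<and>
      Cod (functor_cat A B) (mk_nt A (swap_at A T (Dom C u)) (swap_at A T (Cod C u)) (\<lambda>j. FA (FO T j) u)) =
        swap_at A T (Cod C u)"
    by simp
next
  fix c assume c: "c \<in> Obj C"
  show "mk_nt A (swap_at A T (Dom C (Ident C c))) (swap_at A T (Cod C (Ident C c))) (\<lambda>j. FA (FO T j) (Ident C c)) =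
      Ident (functor_cat A B) (swap_at A T c)"
    using c C functor_simps(5)[OF functor_to_functor_cat(1)] by (auto intro!: mk_nt_cong)
next
  fix v u assume "v \<in> Arr C" "u \<in> Arr C" "Dom C v = Cod C u"
  then show "mk_nt A (swap_at A T (Dom C (Comp C v u))) (swap_at A T (Cod C (Comp C v u)))
      (\<lambda>j. FA (FO T j) (Comp C v u)) =
    Comp (functor_cat A B) (mk_nt A (swap_at A T (Dom C v)) (swap_at A T (Cod C v)) (\<lambda>j. FA (FO T j) v))
      (mk_nt A (swap_at A T (Dom C u)) (swap_at A T (Cod C u)) (\<lambda>j. FA (FO T j) u))"
    using C functor_simps(6)[OF functor_to_functor_cat(1)] by (auto intro!: mk_nt_cong)
qed (simp add: is_functor_swap_at)

end

lemma swap_at_swap: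
  assumes "category A" "category B" "category C" and T: "is_functor A (functor_cat C B) T"
    and j: "j \<in> Obj A"
  shows "swap_at C (swap A C T) j = FO T j"
proof -
  note F = functor_to_functor_cat(1)[OF assms(1-4) j]
  show ?thesis
    using j unfolding swap_at_def by (subst mk_functor_eta[OF F, symmetric]) (auto intro!: mk_functor_cong)
qed

text \<open>Strictly involutive, since \<open>T\<close> and its values are extensional and
  \<open>mk_functor_eta\<close> and \<open>mk_nt_eqI\<close> absorb the restrictions. This is what
  makes the comparison of cones an isomorphism and not just an equivalence.\<close>

lemma swap_swap:
  assumes "category A" "category B" "category C" and T: "is_functor A (functor_cat C B) T"
  shows "swap C A (swap A C T) = T"
proof -
  note F = functor_to_functor_cat[OF assms]
  have "swap C A (swap A C T) = mk_functor A (FO T) (FA T)"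
    unfolding swap_def[of C A]
    using assms F swap_at_swap[OF assms]
    by (auto intro!: mk_functor_cong mk_nt_eqI)
  then show ?thesis using mk_functor_eta[OF T] by simp
qed

section \<open>Composition in the 2-category of categories\<close>

text \<open>A horizontal composite with an identity transformation is a whiskering. Here and in the
  next three lemmas the actions of \<open>Cat(C, -)\<close> and \<open>Cat(-, X)\<close> are
  computed in this way.\<close>

lemma post_comp_Cat_of [simp]:
  "is_functor C X h \<Longrightarrow> FO (post_comp (Cat_of P) C X Y f) h = fcomp C f h"
  "category Y \<Longrightarrow> is_functor X Y f \<Longrightarrow> is_nt C X t \<Longrightarrow>
    FA (post_comp (Cat_of P) C X Y f) t = whisker_left C f t"
  by (auto simp: post_comp_def hcomp_def whisker_left_def intro!: mk_nt_cong)

lemma pre_comp_Cat_of [simp]: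
  "is_functor C X h \<Longrightarrow> FO (pre_comp (Cat_of P) B C X u) h = fcomp B h u"
  "category X \<Longrightarrow> is_functor B C u \<Longrightarrow> is_nt C X t \<Longrightarrow>
    FA (pre_comp (Cat_of P) B C X u) t = whisker_right B t u"
  by (auto simp: pre_comp_def hcomp_def whisker_right_def intro!: mk_nt_cong)

lemma post_cell_Cat_of [simp]:
  "NDom (post_cell (Cat_of P) C X Y t) = post_comp (Cat_of P) C X Y (NDom t)"
  "NCod (post_cell (Cat_of P) C X Y t) = post_comp (Cat_of P) C X Y (NCod t)"
  "category Y \<Longrightarrow> is_nt X Y t \<Longrightarrow> is_functor C X h \<Longrightarrow>
    NAt (post_cell (Cat_of P) C X Y t) h = whisker_right C t h"
  by (auto simp: post_cell_def hcomp_def whisker_right_def intro!: mk_nt_cong)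

lemma pre_cell_Cat_of [simp]:
  "NDom (pre_cell (Cat_of P) B C X w) = pre_comp (Cat_of P) B C X (NDom w)"
  "NCod (pre_cell (Cat_of P) B C X w) = pre_comp (Cat_of P) B C X (NCod w)"
  "category X \<Longrightarrow> is_nt B C w \<Longrightarrow> is_functor C X h \<Longrightarrow>
    NAt (pre_cell (Cat_of P) B C X w) h = whisker_left B h w"
  by (auto simp: pre_cell_def hcomp_def whisker_left_def intro!: mk_nt_cong)

section \<open>Pseudo natural transformations, componentwise\<close>

text \<open>Records the typing of the data of a category-valued pseudo functor. It applies to
  \<open>J\<close> and \<open>F\<close> and also to \<open>hom_after\<close>, whose values are
  functor categories over other types, so that a single componentwise description covers the cones
  in both places.\<close>

locale cat_diagram = two_category D for D :: "('x, 'm, 'c) two_cat" +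
  fixes G :: "('x, 'm, 'c, 'o, 'a) cat_pseudo_functr"
  assumes cat: "a \<in> Ob D \<Longrightarrow> category (P0 G a)"
    and map1: "a \<in> Ob D \<Longrightarrow> b \<in> Ob D \<Longrightarrow> f \<in> Obj (Hom D a b) \<Longrightarrow>
      is_functor (P0 G a) (P0 G b) (FO (P1 G a b) f)"
    and map2: "a \<in> Ob D \<Longrightarrow> b \<in> Ob D \<Longrightarrow> t \<in> Arr (Hom D a b) \<Longrightarrow>
      is_nt (P0 G a) (P0 G b) (FA (P1 G a b) t) \<and>
      NDom (FA (P1 G a b) t) = FO (P1 G a b) (Dom (Hom D a b) t) \<and>
      NCod (FA (P1 G a b) t) = FO (P1 G a b) (Cod (Hom D a b) t)"
    and unit: "a \<in> Ob D \<Longrightarrow> is_nt (P0 G a) (P0 G a) (PUnit G a) \<and>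
      NDom (PUnit G a) = id_functor (P0 G a) \<and> NCod (PUnit G a) = FO (P1 G a a) (One D a)"
    and mult: "a \<in> Ob D \<Longrightarrow> b \<in> Ob D \<Longrightarrow> c \<in> Ob D \<Longrightarrow>
      f \<in> Obj (Hom D a b) \<Longrightarrow> g \<in> Obj (Hom D b c) \<Longrightarrow>
      is_nt (P0 G a) (P0 G c) (PComp G a b c g f) \<and>
      NDom (PComp G a b c g f) = fcomp (P0 G a) (FO (P1 G b c) g) (FO (P1 G a b) f) \<and>
      NCod (PComp G a b c g f) = FO (P1 G a c) (Comp1 D a b c g f)"

lemma iso_arrowD: "iso_arrow A x y f \<Longrightarrow> f \<in> Arr A \<and> Dom A f = x \<and> Cod A f = y"
  unfolding iso_arrow_def by (simp add: arrows_iff)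

lemma cat_diagram_pseudo_functor:
  assumes D: "two_category D" and P: "\<And>A. P A \<Longrightarrow> category A" and F: "pseudo_functor D (Cat_of P) F"
  shows "cat_diagram D F"
proof (intro cat_diagram.intro cat_diagram_axioms.intro D)
  fix a b assume ab: "a \<in> Ob D" "b \<in> Ob D"
  note L = pseudo_functor.local_functor[OF F ab, simplified]
  show "is_functor (P0 F a) (P0 F b) (FO (P1 F a b) f)" if "f \<in> Obj (Hom D a b)" for f
    using functor_simps(1)[OF L that] by simp
  show "is_nt (P0 F a) (P0 F b) (FA (P1 F a b) t) \<and>
      NDom (FA (P1 F a b) t) = FO (P1 F a b) (Dom (Hom D a b) t) \<and>
      NCod (FA (P1 F a b) t) = FO (P1 F a b) (Cod (Hom D a b) t)" if "t \<in> Arr (Hom D a b)" for t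
    using functor_simps(2-4)[OF L that] by simp
qed (use pseudo_functor.ob[OF F] pseudo_functor.unit_iso[OF F, THEN iso_arrowD]
    pseudo_functor.comp_iso[OF F, THEN iso_arrowD] P in auto)

lemma hom_after_simps [simp]:
  "P0 (hom_after K D F C) a = Hom K C (P0 F a)"
  "f \<in> Obj (Hom D a b) \<Longrightarrow> FO (P1 (hom_after K D F C) a b) f = post_comp K C (P0 F a) (P0 F b) (FO (P1 F a b) f)"
  "t \<in> Arr (Hom D a b) \<Longrightarrow> FA (P1 (hom_after K D F C) a b) t = post_cell K C (P0 F a) (P0 F b) (FA (P1 F a b) t)"
  "PUnit (hom_after K D F C) a = post_cell K C (P0 F a) (P0 F a) (PUnit F a)"
  "PComp (hom_after K D F C) a b c g f = post_cell K C (P0 F a) (P0 F c) (PComp F a b c g f)"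
  by (simp_all add: hom_after_def)

text \<open>\<open>Cat(C, -)\<close> preserves identity functors and composites strictly
  (\<open>post_id\<close>, \<open>post_fcomp\<close>); this gives the coherence cells of
  \<open>hom_after\<close> the required sources and targets.\<close>

lemma (in cat_diagram) cat_diagram_hom_after:
  assumes P: "\<And>A. P A \<Longrightarrow> category A" and G: "\<And>a. a \<in> Ob D \<Longrightarrow> P (P0 G a)" and C: "P C"
  shows "cat_diagram D (hom_after (Cat_of P) D G C)"
proof -
  interpret K: two_category "Cat_of P" by (rule two_category_Cat_of[OF P])
  have post_id: "post_comp (Cat_of P) C A A (id_functor A) = id_functor (functor_cat C A)"
    if "P A" for A
  proof -
    have "hcomp C A (mk_nt A (id_functor A) (id_functor A) (\<lambda>x. Ident A (FO (id_functor A) x))) t = t"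
      if "is_nt C A t" for t
      using K.comp2_one_left[of C A t] C \<open>P A\<close> that by simp
    then show ?thesis
      unfolding id_functor_def[of "functor_cat _ _"]
      by (subst post_comp_def, simp) (auto intro!: mk_functor_cong simp: fcomp_id_left)
  qed
  have post_fcomp: "post_comp (Cat_of P) C X Z (fcomp X g f) =
      fcomp (functor_cat C X) (post_comp (Cat_of P) C Y Z g) (post_comp (Cat_of P) C X Y f)"
    if X: "P X" "P Y" "P Z" and f: "is_functor X Y f" and g: "is_functor Y Z g" for X Y Z f g
  proof (rule functor_eqI)
    have c: "category C" "category X" "category Y" "category Z" using P C X by auto
    note gf = is_functor_fcomp[OF c(2) f g]
    show "is_functor (functor_cat C X) (functor_cat C Z) (post_comp (Cat_of P) C X Z (fcomp X g f))"
      using K.is_functor_post_comp[of C X Z] X C gf by simp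
    show "is_functor (functor_cat C X) (functor_cat C Z)
        (fcomp (functor_cat C X) (post_comp (Cat_of P) C Y Z g) (post_comp (Cat_of P) C X Y f))"
      using K.is_functor_post_comp[of C X Y f] K.is_functor_post_comp[of C Y Z g] X C f g c
      by (intro is_functor_fcomp[of _ "functor_cat C Y"]) simp_all
    fix t assume "t \<in> Arr (functor_cat C X)"
    then have t: "is_nt C X t" by simp
    have "whisker_left C (fcomp X g f) t = whisker_left C g (whisker_left C f t)"
      unfolding whisker_left_def[of C "fcomp X g f"] whisker_left_def[of C g]
      using t by (auto intro!: mk_nt_cong simp: fcomp_assoc[OF nt_simps(1)[OF t]] fcomp_assoc[OF nt_simps(2)[OF t]])
    then show "FA (post_comp (Cat_of P) C X Z (fcomp X g f)) t =
        FA (fcomp (functor_cat C X) (post_comp (Cat_of P) C Y Z g) (post_comp (Cat_of P) C X Y f)) t"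
      using t gf f g c is_nt_whisker_left[OF c(1,2) f t] by simp
  next
    fix h assume "h \<in> Obj (functor_cat C X)"
    then show "FO (post_comp (Cat_of P) C X Z (fcomp X g f)) h =
        FO (fcomp (functor_cat C X) (post_comp (Cat_of P) C Y Z g) (post_comp (Cat_of P) C X Y f)) h"
      using f P[OF C] is_functor_fcomp[of C X h Y f] by (simp add: fcomp_assoc)
  qed
  show ?thesis
  proof (intro cat_diagram.intro cat_diagram_axioms.intro two_category_axioms)
    fix a b f assume "a \<in> Ob D" "b \<in> Ob D" "f \<in> Obj (Hom D a b)"
    then show "is_functor (P0 (hom_after (Cat_of P) D G C) a) (P0 (hom_after (Cat_of P) D G C) b)
          (FO (P1 (hom_after (Cat_of P) D G C) a b) f)"
      using K.is_functor_post_comp[of C "P0 G a" "P0 G b"] C G map1 by simp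
  next
    fix a b t assume "a \<in> Ob D" "b \<in> Ob D" "t \<in> Arr (Hom D a b)"
    then show "is_nt (P0 (hom_after (Cat_of P) D G C) a) (P0 (hom_after (Cat_of P) D G C) b)
          (FA (P1 (hom_after (Cat_of P) D G C) a b) t) \<and>
      NDom (FA (P1 (hom_after (Cat_of P) D G C) a b) t) =
        FO (P1 (hom_after (Cat_of P) D G C) a b) (Dom (Hom D a b) t) \<and>
      NCod (FA (P1 (hom_after (Cat_of P) D G C) a b) t) =
        FO (P1 (hom_after (Cat_of P) D G C) a b) (Cod (Hom D a b) t)"
      using K.is_nt_post_cell[of C "P0 G a" "P0 G b"] C G map2 hom_category by simp
  next
    fix a assume "a \<in> Ob D"
    then show "is_nt (P0 (hom_after (Cat_of P) D G C) a) (P0 (hom_after (Cat_of P) D G C) a)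
          (PUnit (hom_after (Cat_of P) D G C) a) \<and>
         NDom (PUnit (hom_after (Cat_of P) D G C) a) = id_functor (P0 (hom_after (Cat_of P) D G C) a) \<and>
         NCod (PUnit (hom_after (Cat_of P) D G C) a) = FO (P1 (hom_after (Cat_of P) D G C) a a) (One D a)"
      using K.is_nt_post_cell[of C "P0 G a" "P0 G a"] C G unit one cat by (simp add: post_id)
  next
    fix a b c f g assume "a \<in> Ob D" "b \<in> Ob D" "c \<in> Ob D" "f \<in> Obj (Hom D a b)" "g \<in> Obj (Hom D b c)"
    then show "is_nt (P0 (hom_after (Cat_of P) D G C) a) (P0 (hom_after (Cat_of P) D G C) c)
          (PComp (hom_after (Cat_of P) D G C) a b c g f) \<and>
         NDom (PComp (hom_after (Cat_of P) D G C) a b c g f) =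
         fcomp (P0 (hom_after (Cat_of P) D G C) a) (FO (P1 (hom_after (Cat_of P) D G C) b c) g)
          (FO (P1 (hom_after (Cat_of P) D G C) a b) f) \<and>
         NCod (PComp (hom_after (Cat_of P) D G C) a b c g f) =
         FO (P1 (hom_after (Cat_of P) D G C) a c) (Comp1 D a b c g f)"
      using K.is_nt_post_cell[of C "P0 G a" "P0 G c"] C G mult map1 comp1 cat
      by (simp add: post_fcomp[of _ "P0 G b"])
  qed (use P C G cat in auto)
qed

locale cat_diagrams = J: cat_diagram D J + G: cat_diagram D G
  for D :: "('x, 'm, 'c) two_cat"
    and J :: "('x, 'm, 'c, 'i, 'k) cat_pseudo_functr"
    and G :: "('x, 'm, 'c, 'o, 'a) cat_pseudo_functr"
begin

text \<open>Each law equates transformations with a common source and target and may therefore be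
  tested at every \<open>j\<close>; invertibility is tested there by
  \<open>iso_arrow_functor_cat_iff\<close>. In the converse direction the endpoints of both sides
  have to be identified before \<open>mk_nt_cong\<close> compares components.\<close>

lemma is_pseudo_nt_iff:
  "is_pseudo_nt D J G s \<longleftrightarrow>
    T0 s \<in> extensional (Ob D) \<and>
    (\<forall>a b f. \<not> (a \<in> Ob D \<and> b \<in> Ob D \<and> f \<in> Obj (Hom D a b)) \<longrightarrow> T1 s a b f = undefined) \<and>
    (\<forall>a \<in> Ob D. is_functor (P0 J a) (P0 G a) (T0 s a)) \<and>
    (\<forall>a \<in> Ob D. \<forall>b \<in> Ob D. \<forall>f \<in> Obj (Hom D a b).
      is_nt (P0 J a) (P0 G b) (T1 s a b f) \<and>
      NDom (T1 s a b f) = fcomp (P0 J a) (FO (P1 G a b) f) (T0 s a) \<and>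
      NCod (T1 s a b f) = fcomp (P0 J a) (T0 s b) (FO (P1 J a b) f) \<and>
      (\<forall>j \<in> Obj (P0 J a). iso_arrow (P0 G b)
        (FO (FO (P1 G a b) f) (FO (T0 s a) j)) (FO (T0 s b) (FO (FO (P1 J a b) f) j))
        (NAt (T1 s a b f) j))) \<and>
    (\<forall>a \<in> Ob D. \<forall>b \<in> Ob D. \<forall>t \<in> Arr (Hom D a b). \<forall>j \<in> Obj (P0 J a).
      Comp (P0 G b) (FA (T0 s b) (NAt (FA (P1 J a b) t) j)) (NAt (T1 s a b (Dom (Hom D a b) t)) j) =
      Comp (P0 G b) (NAt (T1 s a b (Cod (Hom D a b) t)) j) (NAt (FA (P1 G a b) t) (FO (T0 s a) j))) \<and>
    (\<forall>a \<in> Ob D. \<forall>j \<in> Obj (P0 J a).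
      Comp (P0 G a) (NAt (T1 s a a (One D a)) j) (NAt (PUnit G a) (FO (T0 s a) j)) =
      FA (T0 s a) (NAt (PUnit J a) j)) \<and>
    (\<forall>a \<in> Ob D. \<forall>b \<in> Ob D. \<forall>c \<in> Ob D. \<forall>f \<in> Obj (Hom D a b). \<forall>g \<in> Obj (Hom D b c).
      \<forall>j \<in> Obj (P0 J a).
      Comp (P0 G c) (NAt (T1 s a c (Comp1 D a b c g f)) j) (NAt (PComp G a b c g f) (FO (T0 s a) j)) =
      Comp (P0 G c) (FA (T0 s c) (NAt (PComp J a b c g f) j))
        (Comp (P0 G c) (NAt (T1 s b c g) (FO (FO (P1 J a b) f) j))
          (FA (FO (P1 G b c) g) (NAt (T1 s a b f) j))))"
  (is "_ \<longleftrightarrow> ?T0 \<and> ?T1 \<and> ?F \<and> ?I \<and> ?N \<and> ?U \<and> ?C")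
proof -
  have iso: "iso_arrow (functor_cat (P0 J a) (P0 G b))
        (fcomp (P0 J a) (FO (P1 G a b) f) (T0 s a))
        (fcomp (P0 J a) (T0 s b) (FO (P1 J a b) f)) (T1 s a b f) \<longleftrightarrow>
      is_nt (P0 J a) (P0 G b) (T1 s a b f) \<and>
      NDom (T1 s a b f) = fcomp (P0 J a) (FO (P1 G a b) f) (T0 s a) \<and>
      NCod (T1 s a b f) = fcomp (P0 J a) (T0 s b) (FO (P1 J a b) f) \<and>
      (\<forall>j \<in> Obj (P0 J a). iso_arrow (P0 G b)
        (FO (FO (P1 G a b) f) (FO (T0 s a) j)) (FO (T0 s b) (FO (FO (P1 J a b) f) j))
        (NAt (T1 s a b f) j))"
    if "a \<in> Ob D" "b \<in> Ob D" for a b f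
    using iso_arrow_functor_cat_iff[OF J.cat G.cat] that by simp
  have nat: "(Comp (functor_cat (P0 J a) (P0 G b))
        (whisker_left (P0 J a) (T0 s b) (FA (P1 J a b) t)) (T1 s a b f) =
      Comp (functor_cat (P0 J a) (P0 G b))
        (T1 s a b g) (whisker_right (P0 J a) (FA (P1 G a b) t) (T0 s a))) \<longleftrightarrow>
      (\<forall>j \<in> Obj (P0 J a).
        Comp (P0 G b) (FA (T0 s b) (NAt (FA (P1 J a b) t) j)) (NAt (T1 s a b f) j) =
        Comp (P0 G b) (NAt (T1 s a b g) j) (NAt (FA (P1 G a b) t) (FO (T0 s a) j)))"
    (is "?l = ?r \<longleftrightarrow> ?p")
    if I: ?I and a: "a \<in> Ob D" "b \<in> Ob D" and t: "t \<in> arrows (Hom D a b) f g" for a b f g t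
  proof
    assume e: "?l = ?r"
    have "NAt ?l j = NAt ?r j" if "j \<in> Obj (P0 J a)" for j by (simp only: e)
    then show ?p using a J.map1 by simp
  next
    assume p: ?p
    have t': "t \<in> Arr (Hom D a b)" "Dom (Hom D a b) t = f" "Cod (Hom D a b) t = g"
      using t by (auto simp: arrows_iff)
    have "f \<in> Obj (Hom D a b)" "g \<in> Obj (Hom D a b)"
      using t' category.dom_obj[OF J.hom_category] category.cod_obj[OF J.hom_category] a by auto
    then show "?l = ?r" using p I a t' J.map2[OF a t'(1)] G.map2[OF a t'(1)]
      by (auto intro!: mk_nt_cong)
  qed
  have unit: "(Comp (functor_cat (P0 J a) (P0 G a))
        (T1 s a a (One D a)) (whisker_right (P0 J a) (PUnit G a) (T0 s a)) =
      whisker_left (P0 J a) (T0 s a) (PUnit J a)) \<longleftrightarrow>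
    (\<forall>j \<in> Obj (P0 J a).
      Comp (P0 G a) (NAt (T1 s a a (One D a)) j) (NAt (PUnit G a) (FO (T0 s a) j)) =
      FA (T0 s a) (NAt (PUnit J a) j))" (is "?l = ?r \<longleftrightarrow> ?p")
    if F: ?F and I: ?I and a: "a \<in> Ob D" for a
  proof
    assume e: "?l = ?r"
    have "NAt ?l j = NAt ?r j" if "j \<in> Obj (P0 J a)" for j by (simp only: e)
    then show ?p using a J.map1 by simp
  next
    assume p: ?p
    \<comment> \<open>The source of the left side has an identity functor after
      \<open>T0 s a\<close>, that of the right side has one before it.\<close>
    have "fcomp (P0 J a) (id_functor (P0 G a)) (T0 s a) = fcomp (P0 J a) (T0 s a) (id_functor (P0 J a))"
      using fcomp_id_left[of "P0 J a" "P0 G a" "T0 s a"] fcomp_id_right[of "P0 J a" "P0 G a" "T0 s a"] F a by simp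
    then show "?l = ?r" using p I a J.unit[OF a] G.unit[OF a] J.one[OF a]
      unfolding whisker_left_def by (auto intro!: mk_nt_cong)
  qed
  have mult: "(Comp (functor_cat (P0 J a) (P0 G c))
        (T1 s a c (Comp1 D a b c g f)) (whisker_right (P0 J a) (PComp G a b c g f) (T0 s a)) =
      Comp (functor_cat (P0 J a) (P0 G c))
        (whisker_left (P0 J a) (T0 s c) (PComp J a b c g f))
        (Comp (functor_cat (P0 J a) (P0 G c))
          (whisker_right (P0 J a) (T1 s b c g) (FO (P1 J a b) f))
          (whisker_left (P0 J a) (FO (P1 G b c) g) (T1 s a b f)))) \<longleftrightarrow>
      (\<forall>j \<in> Obj (P0 J a).
      Comp (P0 G c) (NAt (T1 s a c (Comp1 D a b c g f)) j) (NAt (PComp G a b c g f) (FO (T0 s a) j)) =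
      Comp (P0 G c) (FA (T0 s c) (NAt (PComp J a b c g f) j))
        (Comp (P0 G c) (NAt (T1 s b c g) (FO (FO (P1 J a b) f) j))
          (FA (FO (P1 G b c) g) (NAt (T1 s a b f) j))))" (is "?l = ?r \<longleftrightarrow> ?p")
    if F: ?F and I: ?I and a: "a \<in> Ob D" "b \<in> Ob D" "c \<in> Ob D"
      and f: "f \<in> Obj (Hom D a b)" and g: "g \<in> Obj (Hom D b c)" for a b c f g
  proof
    assume e: "?l = ?r"
    have "NAt ?l j = NAt ?r j" if "j \<in> Obj (P0 J a)" for j by (simp only: e)
    then show ?p using a J.map1 by simp
  next
    assume p: ?p
    have "fcomp (P0 J a) (fcomp (P0 G a) (FO (P1 G b c) g) (FO (P1 G a b) f)) (T0 s a) =
        fcomp (P0 J a) (FO (P1 G b c) g) (fcomp (P0 J a) (FO (P1 G a b) f) (T0 s a))"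
      using fcomp_assoc F a by blast
    then show "?l = ?r"
      using p I a f g J.mult[OF a f g] G.mult[OF a f g] J.comp1[OF a f g]
      by (auto intro!: mk_nt_cong)
  qed
  have N: "(\<forall>a \<in> Ob D. \<forall>b \<in> Ob D. \<forall>f g. \<forall>t \<in> arrows (Hom D a b) f g.
      Comp (functor_cat (P0 J a) (P0 G b))
        (whisker_left (P0 J a) (T0 s b) (FA (P1 J a b) t)) (T1 s a b f) =
      Comp (functor_cat (P0 J a) (P0 G b))
        (T1 s a b g) (whisker_right (P0 J a) (FA (P1 G a b) t) (T0 s a))) \<longleftrightarrow> ?N" if I: ?I
    using nat[OF I] unfolding arrows_def by blast
  have U: "(\<forall>a \<in> Ob D.
      Comp (functor_cat (P0 J a) (P0 G a))
        (T1 s a a (One D a)) (whisker_right (P0 J a) (PUnit G a) (T0 s a)) =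
      whisker_left (P0 J a) (T0 s a) (PUnit J a)) \<longleftrightarrow> ?U" if ?F ?I
    using unit[OF that] by blast
  have C: "(\<forall>a \<in> Ob D. \<forall>b \<in> Ob D. \<forall>c \<in> Ob D. \<forall>f \<in> Obj (Hom D a b). \<forall>g \<in> Obj (Hom D b c).
      Comp (functor_cat (P0 J a) (P0 G c))
        (T1 s a c (Comp1 D a b c g f)) (whisker_right (P0 J a) (PComp G a b c g f) (T0 s a)) =
      Comp (functor_cat (P0 J a) (P0 G c))
        (whisker_left (P0 J a) (T0 s c) (PComp J a b c g f))
        (Comp (functor_cat (P0 J a) (P0 G c))
          (whisker_right (P0 J a) (T1 s b c g) (FO (P1 J a b) f))
          (whisker_left (P0 J a) (FO (P1 G b c) g) (T1 s a b f)))) \<longleftrightarrow> ?C" if ?F ?I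
    using mult[OF that] by blast
  have I: "(\<forall>a \<in> Ob D. \<forall>b \<in> Ob D. \<forall>f \<in> Obj (Hom D a b).
      iso_arrow (functor_cat (P0 J a) (P0 G b))
        (fcomp (P0 J a) (FO (P1 G a b) f) (T0 s a))
        (fcomp (P0 J a) (T0 s b) (FO (P1 J a b) f))
        (T1 s a b f)) \<longleftrightarrow> ?I"
    using iso by blast
  \<comment> \<open>\<open>conj_cong\<close> passes the earlier conjuncts, functoriality and typing
    of the cells, to the equivalences for the later ones, which were proved under them.\<close>
  show ?thesis unfolding is_pseudo_nt_def I by (intro conj_cong refl N U C; assumption)
qed

lemma pseudo_ntD:
  assumes "is_pseudo_nt D J G s"
  shows "T0 s \<in> extensional (Ob D)"
    and "\<not> (a \<in> Ob D \<and> b \<in> Ob D \<and> f \<in> Obj (Hom D a b)) \<Longrightarrow> T1 s a b f = undefined"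
    and "a \<in> Ob D \<Longrightarrow> is_functor (P0 J a) (P0 G a) (T0 s a)"
    and "a \<in> Ob D \<Longrightarrow> b \<in> Ob D \<Longrightarrow> f \<in> Obj (Hom D a b) \<Longrightarrow> is_nt (P0 J a) (P0 G b) (T1 s a b f)"
    and "a \<in> Ob D \<Longrightarrow> b \<in> Ob D \<Longrightarrow> f \<in> Obj (Hom D a b) \<Longrightarrow>
      NDom (T1 s a b f) = fcomp (P0 J a) (FO (P1 G a b) f) (T0 s a)"
    and "a \<in> Ob D \<Longrightarrow> b \<in> Ob D \<Longrightarrow> f \<in> Obj (Hom D a b) \<Longrightarrow>
      NCod (T1 s a b f) = fcomp (P0 J a) (T0 s b) (FO (P1 J a b) f)"
    and "a \<in> Ob D \<Longrightarrow> b \<in> Ob D \<Longrightarrow> f \<in> Obj (Hom D a b) \<Longrightarrow> j \<in> Obj (P0 J a) \<Longrightarrow> iso_arrow (P0 G b)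
        (FO (FO (P1 G a b) f) (FO (T0 s a) j)) (FO (T0 s b) (FO (FO (P1 J a b) f) j))
        (NAt (T1 s a b f) j)"
    and "a \<in> Ob D \<Longrightarrow> b \<in> Ob D \<Longrightarrow> t \<in> Arr (Hom D a b) \<Longrightarrow> j \<in> Obj (P0 J a) \<Longrightarrow>
      Comp (P0 G b) (FA (T0 s b) (NAt (FA (P1 J a b) t) j)) (NAt (T1 s a b (Dom (Hom D a b) t)) j) =
      Comp (P0 G b) (NAt (T1 s a b (Cod (Hom D a b) t)) j) (NAt (FA (P1 G a b) t) (FO (T0 s a) j))"
    and "a \<in> Ob D \<Longrightarrow> j \<in> Obj (P0 J a) \<Longrightarrow>
      Comp (P0 G a) (NAt (T1 s a a (One D a)) j) (NAt (PUnit G a) (FO (T0 s a) j)) =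
      FA (T0 s a) (NAt (PUnit J a) j)"
    and "a \<in> Ob D \<Longrightarrow> b \<in> Ob D \<Longrightarrow> c \<in> Ob D \<Longrightarrow> f \<in> Obj (Hom D a b) \<Longrightarrow> g \<in> Obj (Hom D b c) \<Longrightarrow>
      j \<in> Obj (P0 J a) \<Longrightarrow>
      Comp (P0 G c) (NAt (T1 s a c (Comp1 D a b c g f)) j) (NAt (PComp G a b c g f) (FO (T0 s a) j)) =
      Comp (P0 G c) (FA (T0 s c) (NAt (PComp J a b c g f) j))
        (Comp (P0 G c) (NAt (T1 s b c g) (FO (FO (P1 J a b) f) j))
          (FA (FO (P1 G b c) g) (NAt (T1 s a b f) j)))"
  using assms unfolding is_pseudo_nt_iff by simp_all

lemma is_modification_iff:
  "is_modification D J G m \<longleftrightarrow>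
    is_pseudo_nt D J G (MDom m) \<and> is_pseudo_nt D J G (MCod m) \<and>
    MAt m \<in> extensional (Ob D) \<and>
    (\<forall>a \<in> Ob D. is_nt (P0 J a) (P0 G a) (MAt m a) \<and>
      NDom (MAt m a) = T0 (MDom m) a \<and> NCod (MAt m a) = T0 (MCod m) a) \<and>
    (\<forall>a \<in> Ob D. \<forall>b \<in> Ob D. \<forall>f \<in> Obj (Hom D a b). \<forall>j \<in> Obj (P0 J a).
      Comp (P0 G b) (NAt (MAt m b) (FO (FO (P1 J a b) f) j)) (NAt (T1 (MDom m) a b f) j) =
      Comp (P0 G b) (NAt (T1 (MCod m) a b f) j) (FA (FO (P1 G a b) f) (NAt (MAt m a) j)))"
  (is "_ \<longleftrightarrow> ?D \<and> ?C \<and> ?E \<and> ?A \<and> ?N")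
proof -
  have N: "(Comp (functor_cat (P0 J a) (P0 G b))
        (whisker_right (P0 J a) (MAt m b) (FO (P1 J a b) f)) (T1 (MDom m) a b f) =
      Comp (functor_cat (P0 J a) (P0 G b))
        (T1 (MCod m) a b f) (whisker_left (P0 J a) (FO (P1 G a b) f) (MAt m a))) \<longleftrightarrow>
      (\<forall>j \<in> Obj (P0 J a).
        Comp (P0 G b) (NAt (MAt m b) (FO (FO (P1 J a b) f) j)) (NAt (T1 (MDom m) a b f) j) =
        Comp (P0 G b) (NAt (T1 (MCod m) a b f) j) (FA (FO (P1 G a b) f) (NAt (MAt m a) j)))"
    (is "?l = ?r \<longleftrightarrow> ?p")
    if D: ?D and C: ?C and A: ?A and a: "a \<in> Ob D" "b \<in> Ob D" and f: "f \<in> Obj (Hom D a b)" for a b f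
  proof
    assume e: "?l = ?r"
    have "NAt ?l j = NAt ?r j" if "j \<in> Obj (P0 J a)" for j by (simp only: e)
    then show ?p using a J.map1 by simp
  next
    assume p: ?p
    then show "?l = ?r" using A a f pseudo_ntD(5,6)[OF D a f] pseudo_ntD(5,6)[OF C a f]
      by (auto intro!: mk_nt_cong)
  qed
  have A: "(\<forall>a \<in> Ob D.
      MAt m a \<in> arrows (functor_cat (P0 J a) (P0 G a)) (T0 (MDom m) a) (T0 (MCod m) a)) \<longleftrightarrow> ?A"
    by (simp add: arrows_iff)
  have N': "(\<forall>a \<in> Ob D. \<forall>b \<in> Ob D. \<forall>f \<in> Obj (Hom D a b).
      Comp (functor_cat (P0 J a) (P0 G b))
        (whisker_right (P0 J a) (MAt m b) (FO (P1 J a b) f)) (T1 (MDom m) a b f) =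
      Comp (functor_cat (P0 J a) (P0 G b))
        (T1 (MCod m) a b f) (whisker_left (P0 J a) (FO (P1 G a b) f) (MAt m a))) \<longleftrightarrow> ?N"
    if ?D ?C ?A
    using N[OF that] by blast
  show ?thesis unfolding is_modification_def A using N' by blast
qed

lemma modificationD:
  assumes "is_modification D J G m"
  shows "is_pseudo_nt D J G (MDom m)" and "is_pseudo_nt D J G (MCod m)"
    and "MAt m \<in> extensional (Ob D)"
    and "a \<in> Ob D \<Longrightarrow> is_nt (P0 J a) (P0 G a) (MAt m a)"
    and "a \<in> Ob D \<Longrightarrow> NDom (MAt m a) = T0 (MDom m) a"
    and "a \<in> Ob D \<Longrightarrow> NCod (MAt m a) = T0 (MCod m) a"
    and "a \<in> Ob D \<Longrightarrow> b \<in> Ob D \<Longrightarrow> f \<in> Obj (Hom D a b) \<Longrightarrow> j \<in> Obj (P0 J a) \<Longrightarrow>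
      Comp (P0 G b) (NAt (MAt m b) (FO (FO (P1 J a b) f) j)) (NAt (T1 (MDom m) a b f) j) =
      Comp (P0 G b) (NAt (T1 (MCod m) a b f) j) (FA (FO (P1 G a b) f) (NAt (MAt m a) j))"
  using assms unfolding is_modification_iff by simp_all

lemma pseudo_hom_simps:
  "Obj (pseudo_hom D J G) = {s. is_pseudo_nt D J G s}"
  "Arr (pseudo_hom D J G) = {m. is_modification D J G m}"
  "Dom (pseudo_hom D J G) = MDom"
  "Cod (pseudo_hom D J G) = MCod"
  "Ident (pseudo_hom D J G) s = \<lparr>MDom = s, MCod = s,
    MAt = (\<lambda>a \<in> Ob D. Ident (functor_cat (P0 J a) (P0 G a)) (T0 s a))\<rparr>"
  "Comp (pseudo_hom D J G) n m = \<lparr>MDom = MDom m, MCod = MCod n,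
    MAt = (\<lambda>a \<in> Ob D. Comp (functor_cat (P0 J a) (P0 G a)) (MAt n a) (MAt m a))\<rparr>"
  by (simp_all add: pseudo_hom_def)

lemma pseudo_nt_eqI:
  assumes "is_pseudo_nt D J G s" "is_pseudo_nt D J G s'"
    and "\<And>a. a \<in> Ob D \<Longrightarrow> T0 s a = T0 s' a"
    and "\<And>a b f. a \<in> Ob D \<Longrightarrow> b \<in> Ob D \<Longrightarrow> f \<in> Obj (Hom D a b) \<Longrightarrow> T1 s a b f = T1 s' a b f"
  shows "s = s'"
proof -
  have "T0 s = T0 s'" using pseudo_ntD(1)[OF assms(1)] pseudo_ntD(1)[OF assms(2)] assms(3)
    by (rule extensionalityI)
  moreover have "T1 s = T1 s'"
    using pseudo_ntD(2)[OF assms(1)] pseudo_ntD(2)[OF assms(2)] assms(4) by (intro ext) metis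
  ultimately show ?thesis by simp
qed

lemma modification_eqI:
  assumes "is_modification D J G m" "is_modification D J G m'"
    and "MDom m = MDom m'" "MCod m = MCod m'"
    and "\<And>a. a \<in> Ob D \<Longrightarrow> MAt m a = MAt m' a"
  shows "m = m'"
proof -
  have "MAt m = MAt m'"
    using modificationD(3)[OF assms(1)] modificationD(3)[OF assms(2)] assms(5)
    by (rule extensionalityI)
  then show ?thesis using assms by simp
qed

lemma is_modification_Ident:
  assumes s: "is_pseudo_nt D J G s"
  shows "is_modification D J G (Ident (pseudo_hom D J G) s)"
  unfolding is_modification_iff pseudo_hom_simps
proof (simp add: s, intro conjI ballI)
  fix a assume a: "a \<in> Ob D"
  then show "is_nt (P0 J a) (P0 G a) (mk_nt (P0 J a) (T0 s a) (T0 s a) (\<lambda>x. Ident (P0 G a) (FO (T0 s a) x)))"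
    using J.cat G.cat pseudo_ntD(3)[OF s] by simp
next
  fix a b f j assume a: "a \<in> Ob D" "b \<in> Ob D" "f \<in> Obj (Hom D a b)" and j: "j \<in> Obj (P0 J a)"
  note T = pseudo_ntD(3)[OF s a(1)] pseudo_ntD(3)[OF s a(2)] pseudo_ntD(4-6)[OF s a]
    G.map1[OF a] J.map1[OF a]
  have j': "FO (FO (P1 J a b) f) j \<in> Obj (P0 J b)" "FO (T0 s a) j \<in> Obj (P0 G a)" using T j by auto
  show "Comp (P0 G b) (NAt (mk_nt (P0 J b) (T0 s b) (T0 s b) (\<lambda>x. Ident (P0 G b) (FO (T0 s b) x)))
          (FO (FO (P1 J a b) f) j)) (NAt (T1 s a b f) j) =
       Comp (P0 G b) (NAt (T1 s a b f) j) (FA (FO (P1 G a b) f) (Ident (P0 G a) (FO (T0 s a) j)))"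
    using a j j' T G.cat by simp
qed

text \<open>The square of \<open>m\<close> is pasted to that of \<open>n\<close>, and functoriality
  of \<open>FO (P1 G a b) f\<close> merges the two components on the right.\<close>

lemma is_modification_Comp:
  assumes n: "is_modification D J G n" and m: "is_modification D J G m" and nm: "MDom n = MCod m"
  shows "is_modification D J G (Comp (pseudo_hom D J G) n m)"
  unfolding is_modification_iff pseudo_hom_simps
proof (simp add: modificationD(1,2)[OF n] modificationD(1,2)[OF m], intro conjI ballI)
  fix a assume a: "a \<in> Ob D"
  show "is_nt (P0 J a) (P0 G a) (mk_nt (P0 J a) (NDom (MAt m a)) (NCod (MAt n a))
        (\<lambda>x. Comp (P0 G a) (NAt (MAt n a) x) (NAt (MAt m a) x)))"
    using is_nt_Comp[OF J.cat G.cat modificationD(4)[OF n] modificationD(4)[OF m]]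
      modificationD(5)[OF n] modificationD(6)[OF m] a nm by simp
  show "NDom (MAt m a) = T0 (MDom m) a" "NCod (MAt n a) = T0 (MCod n) a"
    using a modificationD(5)[OF m] modificationD(6)[OF n] by simp_all
next
  fix a b f j assume a: "a \<in> Ob D" "b \<in> Ob D" and f: "f \<in> Obj (Hom D a b)" and j: "j \<in> Obj (P0 J a)"
  note A = category.Comp_assoc[OF G.cat[OF a(2)]]
  note Jf = J.map1[OF a f] and Gf = G.map1[OF a f]
  note na = modificationD(4-6)[OF n a(1)] and nb = modificationD(4-6)[OF n a(2)]
  note ma = modificationD(4-6)[OF m a(1)] and mb = modificationD(4-6)[OF m a(2)]
  note tm = pseudo_ntD(4-6)[OF modificationD(1)[OF m] a f]
  note tn = pseudo_ntD(4-6)[OF modificationD(1)[OF n] a f]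
  note tn' = pseudo_ntD(4-6)[OF modificationD(2)[OF n] a f]
  note c = G.cat[OF a(1)] G.cat[OF a(2)]
  let ?C = "Comp (P0 G b)" and ?j = "FO (FO (P1 J a b) f) j"
  have j': "?j \<in> Obj (P0 J b)" using Jf j by simp
  have "?C (?C (NAt (MAt n b) ?j) (NAt (MAt m b) ?j)) (NAt (T1 (MDom m) a b f) j) =
      ?C (NAt (MAt n b) ?j) (?C (NAt (MAt m b) ?j) (NAt (T1 (MDom m) a b f) j))"
    using j j' nb mb nm tm c by (simp add: A)
  also have "\<dots> = ?C (?C (NAt (MAt n b) ?j) (NAt (T1 (MCod m) a b f) j)) (FA (FO (P1 G a b) f) (NAt (MAt m a) j))"
    unfolding modificationD(7)[OF m a f j] using j j' nb ma nm tn c Gf by (simp add: A)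
  also have "\<dots> = ?C (NAt (T1 (MCod n) a b f) j)
      (?C (FA (FO (P1 G a b) f) (NAt (MAt n a) j)) (FA (FO (P1 G a b) f) (NAt (MAt m a) j)))"
    unfolding modificationD(7)[OF n a f j, unfolded nm] using j j' na ma nm tn' c Gf by (simp add: A)
  also have "?C (FA (FO (P1 G a b) f) (NAt (MAt n a) j)) (FA (FO (P1 G a b) f) (NAt (MAt m a) j)) =
      FA (FO (P1 G a b) f) (Comp (P0 G a) (NAt (MAt n a) j) (NAt (MAt m a) j))"
    using Gf j na ma nm by simp
  finally show "?C (NAt (mk_nt (P0 J b) (NDom (MAt m b)) (NCod (MAt n b))
          (\<lambda>x. ?C (NAt (MAt n b) x) (NAt (MAt m b) x))) ?j) (NAt (T1 (MDom m) a b f) j) =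
      ?C (NAt (T1 (MCod n) a b f) j)
        (FA (FO (P1 G a b) f) (Comp (P0 G a) (NAt (MAt n a) j) (NAt (MAt m a) j)))"
    using j' by simp
qed

text \<open>Unit and associativity laws hold at each \<open>a\<close> in the functor category
  \<open>[J a, G a]\<close>; extensionality of \<open>MAt\<close> lifts them to
  modifications.\<close>

lemma category_pseudo_hom: "category (pseudo_hom D J G)"
proof (rule categoryI)
  fix s assume "s \<in> Obj (pseudo_hom D J G)"
  then show "Ident (pseudo_hom D J G) s \<in> Arr (pseudo_hom D J G) \<and>
      Dom (pseudo_hom D J G) (Ident (pseudo_hom D J G) s) = s \<and>
      Cod (pseudo_hom D J G) (Ident (pseudo_hom D J G) s) = s"
    using is_modification_Ident by (simp add: pseudo_hom_simps)
next
  fix n m assume "n \<in> Arr (pseudo_hom D J G)" "m \<in> Arr (pseudo_hom D J G)"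
    "Dom (pseudo_hom D J G) n = Cod (pseudo_hom D J G) m"
  then show "Comp (pseudo_hom D J G) n m \<in> Arr (pseudo_hom D J G) \<and>
      Dom (pseudo_hom D J G) (Comp (pseudo_hom D J G) n m) = Dom (pseudo_hom D J G) m \<and>
      Cod (pseudo_hom D J G) (Comp (pseudo_hom D J G) n m) = Cod (pseudo_hom D J G) n"
    using is_modification_Comp[of n m] by (simp add: pseudo_hom_simps)
next
  fix m assume "m \<in> Arr (pseudo_hom D J G)"
  then have m: "is_modification D J G m" by (simp add: pseudo_hom_simps)
  note t = modificationD(4-6)[OF m]
  have "is_modification D J G (Comp (pseudo_hom D J G) m (Ident (pseudo_hom D J G) (MDom m)))"
    "is_modification D J G (Comp (pseudo_hom D J G) (Ident (pseudo_hom D J G) (MCod m)) m)"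
    using m by (auto intro!: is_modification_Comp is_modification_Ident modificationD(1,2))
      (auto simp: pseudo_hom_simps)
  moreover have "MAt (Comp (pseudo_hom D J G) m (Ident (pseudo_hom D J G) (MDom m))) a = MAt m a"
    "MAt (Comp (pseudo_hom D J G) (Ident (pseudo_hom D J G) (MCod m)) m) a = MAt m a" if a: "a \<in> Ob D" for a
    using modificationD(4-6)[OF m a] G.cat[OF a] a
    by (auto simp: pseudo_hom_simps intro!: mk_nt_eqI)
  ultimately have "Comp (pseudo_hom D J G) m (Ident (pseudo_hom D J G) (MDom m)) = m"
    "Comp (pseudo_hom D J G) (Ident (pseudo_hom D J G) (MCod m)) m = m"
    using m by (auto intro!: modification_eqI) (auto simp: pseudo_hom_simps)
  then show "Comp (pseudo_hom D J G) m (Ident (pseudo_hom D J G) (Dom (pseudo_hom D J G) m)) = m \<and>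
      Comp (pseudo_hom D J G) (Ident (pseudo_hom D J G) (Cod (pseudo_hom D J G) m)) m = m"
    by (simp add: pseudo_hom_simps)
next
  fix h n m
  assume "h \<in> Arr (pseudo_hom D J G)" "n \<in> Arr (pseudo_hom D J G)" "m \<in> Arr (pseudo_hom D J G)"
    "Dom (pseudo_hom D J G) h = Cod (pseudo_hom D J G) n" "Dom (pseudo_hom D J G) n = Cod (pseudo_hom D J G) m"
  then have h: "is_modification D J G h" "is_modification D J G n" "is_modification D J G m"
    "MDom h = MCod n" "MDom n = MCod m" by (simp_all add: pseudo_hom_simps)
  have "Comp (functor_cat (P0 J a) (P0 G a)) (MAt h a) (Comp (functor_cat (P0 J a) (P0 G a)) (MAt n a) (MAt m a)) =
      Comp (functor_cat (P0 J a) (P0 G a)) (Comp (functor_cat (P0 J a) (P0 G a)) (MAt h a) (MAt n a)) (MAt m a)"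
    if a: "a \<in> Ob D" for a
    using category.Comp_assoc[OF category_functor_cat[OF J.cat[OF a] G.cat[OF a]]] h
      modificationD(4-6)[OF h(1) a] modificationD(4-6)[OF h(2) a] modificationD(4-6)[OF h(3) a]
    by (simp del: functor_cat_simps(6))
  then show "Comp (pseudo_hom D J G) h (Comp (pseudo_hom D J G) n m) =
      Comp (pseudo_hom D J G) (Comp (pseudo_hom D J G) h n) m"
    unfolding pseudo_hom_simps by (auto simp del: functor_cat_simps(6) intro!: restrict_ext)
qed (auto simp: pseudo_hom_simps modificationD(1,2))

end

section \<open>Pseudo natural transformations into functor categories\<close>

text \<open>\<open>P\<close> abstracts from smallness: the comparison below works for the categories
  of any class that contains all values of \<open>F\<close>. Facts prefixed \<open>G.\<close> are
  about the diagram \<open>F\<close> here.\<close>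

locale cat_cones = cat_diagrams D J F
  for D :: "('x, 'm, 'c) two_cat"
    and J :: "('x, 'm, 'c, 'i, 'k) cat_pseudo_functr"
    and F :: "('x, 'm, 'c, 'o, 'a) cat_pseudo_functr" +
  fixes P :: "('o, 'a) cat \<Rightarrow> bool"
  assumes P_category: "P A \<Longrightarrow> category A"
    and P_F: "a \<in> Ob D \<Longrightarrow> P (P0 F a)"
begin

abbreviation L :: "(('x, 'm, 'i, 'k, 'o, 'a) pseudo_nt, ('x, 'm, 'i, 'k, 'o, 'a) modif) cat" where
  "L \<equiv> pseudo_hom D J F"

abbreviation HomF :: "('o, 'a) cat \<Rightarrow>
    ('x, 'm, 'c, ('o, 'a, 'o, 'a) functr, ('o, 'a, 'o, 'a) nt) cat_pseudo_functr" where
  "HomF C \<equiv> hom_after (Cat_of P) D F C"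

lemma cat_diagrams_HomF: "P C \<Longrightarrow> cat_diagrams D J (HomF C)"
  by (intro cat_diagrams.intro J.cat_diagram_axioms G.cat_diagram_hom_after P_category P_F)

end

text \<open>Facts prefixed \<open>H.\<close> concern cones over \<open>Cat(C, F -)\<close>, while
  the unprefixed ones concern the cones that form \<open>L\<close>.\<close>

locale cat_cones_at = cat_cones +
  fixes C assumes P_C: "P C"
begin

sublocale H: cat_diagrams D J "HomF C"
  by (rule cat_diagrams_HomF[OF P_C])

lemma C: "category C" using P_category[OF P_C] .

text \<open>\<open>H\<close> followed by the functor from \<open>L\<close> to
  \<open>[J a, F a]\<close> that keeps the component of a cone at \<open>a\<close>. Its transpose
  becomes the component at \<open>a\<close> of the cone over \<open>Cat(C, F -)\<close>.\<close>

definition proj :: "'a \<Rightarrow> _" where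
  "proj a H = mk_functor C (\<lambda>c. T0 (FO H c) a) (\<lambda>u. MAt (FA H u) a)"

text \<open>The structure cells at \<open>f\<close> and \<open>j\<close> of all the cones
  \<open>FO H c\<close>, read as one transformation between functors from \<open>C\<close> to
  \<open>P0 F b\<close>.\<close>

definition curry_cell where
  "curry_cell H a b f j = mk_nt C (fcomp C (FO (P1 F a b) f) (swap_at C (proj a H) j))
    (swap_at C (proj b H) (FO (FO (P1 J a b) f) j)) (\<lambda>c. NAt (T1 (FO H c) a b f) j)"

definition curry_obj where
  "curry_obj H = \<lparr>T0 = (\<lambda>a \<in> Ob D. swap C (P0 J a) (proj a H)),
    T1 = (\<lambda>a b f. if a \<in> Ob D \<and> b \<in> Ob D \<and> f \<in> Obj (Hom D a b)
      then mk_nt (P0 J a)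
        (fcomp (P0 J a) (FO (P1 (HomF C) a b) f) (swap C (P0 J a) (proj a H)))
        (fcomp (P0 J a) (swap C (P0 J b) (proj b H)) (FO (P1 J a b) f))
        (curry_cell H a b f)
      else undefined)\<rparr>"

definition curry_arr where
  "curry_arr t = \<lparr>MDom = curry_obj (NDom t), MCod = curry_obj (NCod t),
    MAt = (\<lambda>a \<in> Ob D. mk_nt (P0 J a) (swap C (P0 J a) (proj a (NDom t))) (swap C (P0 J a) (proj a (NCod t)))
      (\<lambda>j. mk_nt C (swap_at C (proj a (NDom t)) j) (swap_at C (proj a (NCod t)) j)
        (\<lambda>c. NAt (MAt (NAt t c) a) j)))\<rparr>"

text \<open>Evaluation of a cone \<open>s\<close> over \<open>Cat(C, F -)\<close> at the object
  \<open>c\<close>; \<open>uncurry_obj\<close> lets \<open>c\<close> vary.\<close>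

definition uncurry_at where
  "uncurry_at s c = \<lparr>T0 = (\<lambda>a \<in> Ob D. swap_at (P0 J a) (T0 s a) c),
    T1 = (\<lambda>a b f. if a \<in> Ob D \<and> b \<in> Ob D \<and> f \<in> Obj (Hom D a b)
      then mk_nt (P0 J a)
        (fcomp (P0 J a) (FO (P1 F a b) f) (swap_at (P0 J a) (T0 s a) c))
        (fcomp (P0 J a) (swap_at (P0 J b) (T0 s b) c) (FO (P1 J a b) f))
        (\<lambda>j. NAt (NAt (T1 s a b f) j) c)
      else undefined)\<rparr>"

definition uncurry_obj where
  "uncurry_obj s = mk_functor C (uncurry_at s)
    (\<lambda>u. \<lparr>MDom = uncurry_at s (Dom C u), MCod = uncurry_at s (Cod C u),
      MAt = (\<lambda>a \<in> Ob D. FA (swap (P0 J a) C (T0 s a)) u)\<rparr>)"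

definition uncurry_arr where
  "uncurry_arr m = mk_nt C (uncurry_obj (MDom m)) (uncurry_obj (MCod m))
    (\<lambda>c. \<lparr>MDom = uncurry_at (MDom m) c, MCod = uncurry_at (MCod m) c,
      MAt = (\<lambda>a \<in> Ob D. mk_nt (P0 J a) (swap_at (P0 J a) (T0 (MDom m) a) c)
        (swap_at (P0 J a) (T0 (MCod m) a) c) (\<lambda>j. NAt (NAt (MAt m a) j) c))\<rparr>)"

section \<open>From functors into \<open>L\<close> to cones over \<open>Cat(C, F -)\<close>\<close>

context
  fixes H assumes H: "is_functor C L H"
begin

lemma FO_pseudo_nt: "c \<in> Obj C \<Longrightarrow> is_pseudo_nt D J F (FO H c)"
  using functor_simps(1)[OF H] by (simp add: pseudo_hom_simps)

lemma FA_modification: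
  "u \<in> Arr C \<Longrightarrow> is_modification D J F (FA H u)"
  "u \<in> Arr C \<Longrightarrow> MDom (FA H u) = FO H (Dom C u)"
  "u \<in> Arr C \<Longrightarrow> MCod (FA H u) = FO H (Cod C u)"
  using functor_simps(2-4)[OF H] by (simp_all add: pseudo_hom_simps)

lemma is_functor_proj:
  assumes a: "a \<in> Ob D"
  shows "is_functor C (functor_cat (P0 J a) (P0 F a)) (proj a H)"
  unfolding proj_def
proof (rule is_functor_mk_functor[OF C])
  fix c assume c: "c \<in> Obj C"
  then show "T0 (FO H c) a \<in> Obj (functor_cat (P0 J a) (P0 F a))"
    using pseudo_ntD(3)[OF FO_pseudo_nt a] by simp
  show "MAt (FA H (Ident C c)) a = Ident (functor_cat (P0 J a) (P0 F a)) (T0 (FO H c) a)"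
    using a c functor_simps(5)[OF H] by (simp add: pseudo_hom_simps)
next
  fix u assume u: "u \<in> Arr C"
  then show "MAt (FA H u) a \<in> Arr (functor_cat (P0 J a) (P0 F a)) \<and>
       Dom (functor_cat (P0 J a) (P0 F a)) (MAt (FA H u) a) = T0 (FO H (Dom C u)) a \<and>
       Cod (functor_cat (P0 J a) (P0 F a)) (MAt (FA H u) a) = T0 (FO H (Cod C u)) a"
    using modificationD(4-6)[OF FA_modification(1)[OF u] a] FA_modification(2,3) by simp
next
  fix v u assume "v \<in> Arr C" "u \<in> Arr C" "Dom C v = Cod C u"
  then show "MAt (FA H (Comp C v u)) a = Comp (functor_cat (P0 J a) (P0 F a)) (MAt (FA H v) a) (MAt (FA H u) a)"
    using a functor_simps(6)[OF H] by (simp add: pseudo_hom_simps)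
qed

lemma proj_simps:
  "c \<in> Obj C \<Longrightarrow> FO (proj a H) c = T0 (FO H c) a"
  "u \<in> Arr C \<Longrightarrow> FA (proj a H) u = MAt (FA H u) a"
  by (simp_all add: proj_def)

lemma swap_proj:
  assumes a: "a \<in> Ob D"
  shows "is_functor (P0 J a) (functor_cat C (P0 F a)) (swap C (P0 J a) (proj a H))"
    and "j \<in> Obj (P0 J a) \<Longrightarrow> is_functor C (P0 F a) (swap_at C (proj a H) j)"
  using is_functor_swap[OF C G.cat J.cat is_functor_proj] is_functor_swap_at[OF C G.cat J.cat is_functor_proj] a
  by simp_all

text \<open>Naturality along an arrow \<open>u\<close> of \<open>C\<close> is exactly the
  modification law of \<open>FA H u\<close> at \<open>f\<close> and \<open>j\<close>.\<close>

lemma is_nt_curry_cell: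
  assumes a: "a \<in> Ob D" "b \<in> Ob D" and f: "f \<in> Obj (Hom D a b)" and j: "j \<in> Obj (P0 J a)"
  shows "is_nt C (P0 F b) (curry_cell H a b f j)"
proof -
  have j': "FO (FO (P1 J a b) f) j \<in> Obj (P0 J b)" using functor_simps(1)[OF J.map1[OF a f] j] .
  note Ff = G.map1[OF a f]
  show ?thesis
    unfolding curry_cell_def
  proof (rule is_nt_mk_nt[OF C])
    show "is_functor C (P0 F b) (fcomp C (FO (P1 F a b) f) (swap_at C (proj a H) j))"
      using is_functor_fcomp[OF C swap_proj(2)[OF a(1) j] Ff] .
    show "is_functor C (P0 F b) (swap_at C (proj b H) (FO (FO (P1 J a b) f) j))"
      using swap_proj(2)[OF a(2) j'] .
    fix c assume c: "c \<in> Obj C"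
    note s = FO_pseudo_nt[OF c]
    note T = pseudo_ntD(3)[OF s a(1)] pseudo_ntD(3)[OF s a(2)] pseudo_ntD(4-6)[OF s a f]
    show "NAt (T1 (FO H c) a b f) j \<in> Arr (P0 F b) \<and>
         Dom (P0 F b) (NAt (T1 (FO H c) a b f) j) = FO (fcomp C (FO (P1 F a b) f) (swap_at C (proj a H) j)) c \<and>
         Cod (P0 F b) (NAt (T1 (FO H c) a b f) j) = FO (swap_at C (proj b H) (FO (FO (P1 J a b) f) j)) c"
      using c j T by (simp add: proj_simps)
  next
    fix u assume u: "u \<in> Arr C"
    show "Comp (P0 F b) (NAt (T1 (FO H (Cod C u)) a b f) j)
          (FA (fcomp C (FO (P1 F a b) f) (swap_at C (proj a H) j)) u) =
         Comp (P0 F b) (FA (swap_at C (proj b H) (FO (FO (P1 J a b) f) j)) u)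
          (NAt (T1 (FO H (Dom C u)) a b f) j)"
      using modificationD(7)[OF FA_modification(1)[OF u] a f j] u FA_modification(2,3)[OF u]
      by (simp add: proj_simps)
  qed
qed

lemma curry_cell_simps:
  "NDom (curry_cell H a b f j) = fcomp C (FO (P1 F a b) f) (swap_at C (proj a H) j)"
  "NCod (curry_cell H a b f j) = swap_at C (proj b H) (FO (FO (P1 J a b) f) j)"
  "c \<in> Obj C \<Longrightarrow> NAt (curry_cell H a b f j) c = NAt (T1 (FO H c) a b f) j"
  by (simp_all add: curry_cell_def)

lemma curry_obj_simps:
  "a \<in> Ob D \<Longrightarrow> T0 (curry_obj H) a = swap C (P0 J a) (proj a H)"
  "a \<in> Ob D \<Longrightarrow> b \<in> Ob D \<Longrightarrow> f \<in> Obj (Hom D a b) \<Longrightarrow>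
    T1 (curry_obj H) a b f = mk_nt (P0 J a)
        (fcomp (P0 J a) (FO (P1 (HomF C) a b) f) (swap C (P0 J a) (proj a H)))
        (fcomp (P0 J a) (swap C (P0 J b) (proj b H)) (FO (P1 J a b) f))
        (curry_cell H a b f)"
  by (simp_all add: curry_obj_def)

text \<open>Naturality along an arrow \<open>k\<close> of \<open>P0 J a\<close> is tested at each
  \<open>c\<close>, where it is the naturality of the structure cell of the cone
  \<open>FO H c\<close>.\<close>

lemma is_nt_curry_obj_T1:
  assumes a: "a \<in> Ob D" "b \<in> Ob D" and f: "f \<in> Obj (Hom D a b)"
  shows "is_nt (P0 J a) (functor_cat C (P0 F b)) (T1 (curry_obj H) a b f)"
  unfolding curry_obj_simps(2)[OF a f]
proof (rule is_nt_mk_nt[OF J.cat[OF a(1)]])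
  note S = swap_proj[OF a(1)] swap_proj[OF a(2)]
  note Ff = G.map1[OF a f] and Jf = J.map1[OF a f] and Hf = H.G.map1[OF a f]
  show "is_functor (P0 J a) (functor_cat C (P0 F b))
     (fcomp (P0 J a) (FO (P1 (HomF C) a b) f) (swap C (P0 J a) (proj a H)))"
    using is_functor_fcomp[OF J.cat[OF a(1)] S(1)] Hf by simp
  show "is_functor (P0 J a) (functor_cat C (P0 F b))
     (fcomp (P0 J a) (swap C (P0 J b) (proj b H)) (FO (P1 J a b) f))"
    using is_functor_fcomp[OF J.cat[OF a(1)] Jf S(3)] .
  fix j assume j: "j \<in> Obj (P0 J a)"
  show "curry_cell H a b f j \<in> Arr (functor_cat C (P0 F b)) \<and>
      Dom (functor_cat C (P0 F b)) (curry_cell H a b f j) =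
        FO (fcomp (P0 J a) (FO (P1 (HomF C) a b) f) (swap C (P0 J a) (proj a H))) j \<and>
      Cod (functor_cat C (P0 F b)) (curry_cell H a b f j) =
        FO (fcomp (P0 J a) (swap C (P0 J b) (proj b H)) (FO (P1 J a b) f)) j"
    using is_nt_curry_cell[OF a f j] j f S(2)[OF j] Jf by (simp add: curry_cell_simps)
next
  note S = swap_proj[OF a(1)] swap_proj[OF a(2)]
  note Ff = G.map1[OF a f] and Jf = J.map1[OF a f] and Fb = G.cat[OF a(2)] and Ja = J.cat[OF a(1)]
  fix k assume k: "k \<in> Arr (P0 J a)"
  note Sk = functor_simps(2-4)[OF S(1) k]
  have Jk: "FA (FO (P1 J a b) f) k \<in> Arr (P0 J b)" using Jf k by simp
  have "Comp (P0 F b) (NAt (T1 (FO H c) a b f) (Cod (P0 J a) k)) (FA (FO (P1 F a b) f) (FA (T0 (FO H c) a) k)) =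
      Comp (P0 F b) (FA (T0 (FO H c) b) (FA (FO (P1 J a b) f) k)) (NAt (T1 (FO H c) a b f) (Dom (P0 J a) k))"
    if c: "c \<in> Obj C" for c
  proof -
    note s = FO_pseudo_nt[OF c]
    show ?thesis
      using nt_natural[OF pseudo_ntD(4)[OF s a f] k] pseudo_ntD(5,6)[OF s a f] k by simp
  qed
  then show "Comp (functor_cat C (P0 F b)) (curry_cell H a b f (Cod (P0 J a) k))
        (FA (fcomp (P0 J a) (FO (P1 (HomF C) a b) f) (swap C (P0 J a) (proj a H))) k) =
       Comp (functor_cat C (P0 F b)) (FA (fcomp (P0 J a) (swap C (P0 J b) (proj b H)) (FO (P1 J a b) f)) k)
        (curry_cell H a b f (Dom (P0 J a) k))"
    using k f Sk Jk Jf Ff Fb Ja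
    by (auto simp: curry_cell_simps proj_simps intro!: mk_nt_cong)
qed

text \<open>At \<open>j\<close> each law equates transformations between functors on
  \<open>C\<close>; its component at \<open>c\<close> is the same law for the cone
  \<open>FO H c\<close>. Invertibility is handled by a second use of
  \<open>iso_arrow_functor_cat_iff\<close>, now over \<open>C\<close>.\<close>

lemma curry_obj_pseudo_nt: "is_pseudo_nt D J (HomF C) (curry_obj H)"
  unfolding H.is_pseudo_nt_iff
proof (intro conjI ballI)
  show "T0 (curry_obj H) \<in> extensional (Ob D)" by (simp add: curry_obj_def)
  show "\<forall>a b f. \<not> (a \<in> Ob D \<and> b \<in> Ob D \<and> f \<in> Obj (Hom D a b)) \<longrightarrow> T1 (curry_obj H) a b f = undefined"
    by (simp add: curry_obj_def)
  show "is_functor (P0 J a) (P0 (HomF C) a) (T0 (curry_obj H) a)" if "a \<in> Ob D" for a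
    using swap_proj(1)[OF that] that by (simp add: curry_obj_simps)
next
  fix a b f assume a: "a \<in> Ob D" "b \<in> Ob D" and f: "f \<in> Obj (Hom D a b)"
  show "is_nt (P0 J a) (P0 (HomF C) b) (T1 (curry_obj H) a b f)"
    using is_nt_curry_obj_T1[OF a f] by simp
  show "NDom (T1 (curry_obj H) a b f) = fcomp (P0 J a) (FO (P1 (HomF C) a b) f) (T0 (curry_obj H) a)"
    "NCod (T1 (curry_obj H) a b f) = fcomp (P0 J a) (T0 (curry_obj H) b) (FO (P1 J a b) f)"
    using a f by (simp_all add: curry_obj_simps)
  fix j assume j: "j \<in> Obj (P0 J a)"
  have j': "FO (FO (P1 J a b) f) j \<in> Obj (P0 J b)" using functor_simps(1)[OF J.map1[OF a f] j] .
  have "iso_arrow (functor_cat C (P0 F b)) (fcomp C (FO (P1 F a b) f) (swap_at C (proj a H) j))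
    (swap_at C (proj b H) (FO (FO (P1 J a b) f) j)) (curry_cell H a b f j)"
    unfolding iso_arrow_functor_cat_iff[OF C G.cat[OF a(2)]]
    using is_nt_curry_cell[OF a f j] pseudo_ntD(7)[OF FO_pseudo_nt a f j] j j'
    by (simp add: curry_cell_simps proj_simps)
  then show "iso_arrow (P0 (HomF C) b) (FO (FO (P1 (HomF C) a b) f) (FO (T0 (curry_obj H) a) j))
        (FO (T0 (curry_obj H) b) (FO (FO (P1 J a b) f) j)) (NAt (T1 (curry_obj H) a b f) j)"
    using a f j j' swap_proj(2)[OF a(1) j] by (simp add: curry_obj_simps)
next
  fix a b t j assume a: "a \<in> Ob D" "b \<in> Ob D" and t: "t \<in> Arr (Hom D a b)" and j: "j \<in> Obj (P0 J a)"
  have fg: "Dom (Hom D a b) t \<in> Obj (Hom D a b)" "Cod (Hom D a b) t \<in> Obj (Hom D a b)"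
    using J.hom_category[OF a] t by simp_all
  note Jt = J.map2[OF a t] and Ft = G.map2[OF a t] and S = swap_proj(2)[OF a(1) j]
  note k = nt_simps(3-5)[OF conjunct1[OF Jt] j]
  show "Comp (P0 (HomF C) b) (FA (T0 (curry_obj H) b) (NAt (FA (P1 J a b) t) j))
          (NAt (T1 (curry_obj H) a b (Dom (Hom D a b) t)) j) =
        Comp (P0 (HomF C) b) (NAt (T1 (curry_obj H) a b (Cod (Hom D a b) t)) j)
          (NAt (FA (P1 (HomF C) a b) t) (FO (T0 (curry_obj H) a) j))"
    using a t j fg Jt Ft k S G.cat[OF a(2)] pseudo_ntD(8)[OF FO_pseudo_nt a t j]
    by (auto simp: curry_obj_simps curry_cell_simps proj_simps intro!: mk_nt_cong)
next
  fix a j assume a: "a \<in> Ob D" and j: "j \<in> Obj (P0 J a)"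
  note Ja = J.unit[OF a] and Fa = G.unit[OF a] and S = swap_proj(2)[OF a j]
  note k = nt_simps(3-5)[OF conjunct1[OF Ja] j]
  show "Comp (P0 (HomF C) a) (NAt (T1 (curry_obj H) a a (One D a)) j)
          (NAt (PUnit (HomF C) a) (FO (T0 (curry_obj H) a) j)) =
         FA (T0 (curry_obj H) a) (NAt (PUnit J a) j)"
    using a j J.one[OF a] Ja Fa k S G.cat[OF a] pseudo_ntD(9)[OF FO_pseudo_nt a j]
    by (auto simp: curry_obj_simps curry_cell_simps proj_simps fcomp_id_left intro!: mk_nt_cong)
next
  fix a b c f g j assume a: "a \<in> Ob D" "b \<in> Ob D" "c \<in> Ob D"
    and f: "f \<in> Obj (Hom D a b)" and g: "g \<in> Obj (Hom D b c)" and j: "j \<in> Obj (P0 J a)"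
  note Jgf = J.mult[OF a f g] and Fgf = G.mult[OF a f g] and S = swap_proj(2)[OF a(1) j]
  note k = nt_simps(3-5)[OF conjunct1[OF Jgf] j]
  have j': "FO (FO (P1 J a b) f) j \<in> Obj (P0 J b)" using functor_simps(1)[OF J.map1[OF a(1,2) f] j] .
  show "Comp (P0 (HomF C) c) (NAt (T1 (curry_obj H) a c (Comp1 D a b c g f)) j)
          (NAt (PComp (HomF C) a b c g f) (FO (T0 (curry_obj H) a) j)) =
         Comp (P0 (HomF C) c) (FA (T0 (curry_obj H) c) (NAt (PComp J a b c g f) j))
          (Comp (P0 (HomF C) c) (NAt (T1 (curry_obj H) b c g) (FO (FO (P1 J a b) f) j))
            (FA (FO (P1 (HomF C) b c) g) (NAt (T1 (curry_obj H) a b f) j)))"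
    using a j f g J.comp1[OF a f g] Jgf Fgf k j' S G.cat G.map1[OF a(2,3) g] is_nt_curry_cell[OF a(1,2) f j]
      pseudo_ntD(10)[OF FO_pseudo_nt a f g j]
    by (auto simp: curry_obj_simps curry_cell_simps proj_simps fcomp_assoc[OF S] intro!: mk_nt_cong)
qed

end

lemma curry_arr_simps:
  "MDom (curry_arr t) = curry_obj (NDom t)"
  "MCod (curry_arr t) = curry_obj (NCod t)"
  "a \<in> Ob D \<Longrightarrow> MAt (curry_arr t) a =
    mk_nt (P0 J a) (swap C (P0 J a) (proj a (NDom t))) (swap C (P0 J a) (proj a (NCod t)))
      (\<lambda>j. mk_nt C (swap_at C (proj a (NDom t)) j) (swap_at C (proj a (NCod t)) j)
        (\<lambda>c. NAt (MAt (NAt t c) a) j))"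
  by (simp_all add: curry_arr_def)

section \<open>From transformations of functors into \<open>L\<close> to modifications\<close>

context
  fixes t assumes t: "is_nt C L t"
begin

lemma NDom_NCod_functor: "is_functor C L (NDom t)" "is_functor C L (NCod t)"
  using t by simp_all

lemma NAt_modification:
  "c \<in> Obj C \<Longrightarrow> is_modification D J F (NAt t c)"
  "c \<in> Obj C \<Longrightarrow> MDom (NAt t c) = FO (NDom t) c"
  "c \<in> Obj C \<Longrightarrow> MCod (NAt t c) = FO (NCod t) c"
  using nt_simps(3-5)[OF t] by (simp_all add: pseudo_hom_simps)

lemma NAt_MAt:
  assumes "a \<in> Ob D" "c \<in> Obj C"
  shows "is_nt (P0 J a) (P0 F a) (MAt (NAt t c) a)"
    and "NDom (MAt (NAt t c) a) = T0 (FO (NDom t) c) a"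
    and "NCod (MAt (NAt t c) a) = T0 (FO (NCod t) c) a"
  using modificationD(4-6)[OF NAt_modification(1)[OF assms(2)] assms(1)]
    NAt_modification(2,3)[OF assms(2)] by simp_all

lemma is_nt_curry_arr_cell:
  assumes a: "a \<in> Ob D" and j: "j \<in> Obj (P0 J a)"
  shows "is_nt C (P0 F a) (mk_nt C (swap_at C (proj a (NDom t)) j) (swap_at C (proj a (NCod t)) j)
        (\<lambda>c. NAt (MAt (NAt t c) a) j))"
proof (rule is_nt_mk_nt[OF C swap_proj(2)[OF NDom_NCod_functor(1) a j] swap_proj(2)[OF NDom_NCod_functor(2) a j]])
  fix c assume c: "c \<in> Obj C"
  show "NAt (MAt (NAt t c) a) j \<in> Arr (P0 F a) \<and>
         Dom (P0 F a) (NAt (MAt (NAt t c) a) j) = FO (swap_at C (proj a (NDom t)) j) c \<and>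
         Cod (P0 F a) (NAt (MAt (NAt t c) a) j) = FO (swap_at C (proj a (NCod t)) j) c"
    using NAt_MAt[OF a c] j c by (simp add: proj_simps NDom_NCod_functor)
next
  fix u assume u: "u \<in> Arr C"
  \<comment> \<open>The naturality square of \<open>t\<close> at \<open>u\<close> is an equation of
    modifications; its component at \<open>a\<close> and \<open>j\<close> is the square
    wanted.\<close>
  have "NAt (MAt (Comp L (NAt t (Cod C u)) (FA (NDom t) u)) a) j =
      NAt (MAt (Comp L (FA (NCod t) u) (NAt t (Dom C u))) a) j"
    using nt_natural[OF t u] by simp
  then show "Comp (P0 F a) (NAt (MAt (NAt t (Cod C u)) a) j) (FA (swap_at C (proj a (NDom t)) j) u) =
      Comp (P0 F a) (FA (swap_at C (proj a (NCod t)) j) u) (NAt (MAt (NAt t (Dom C u)) a) j)"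
    using a j u by (simp add: proj_simps NDom_NCod_functor pseudo_hom_simps)
qed

text \<open>Naturality along \<open>k\<close> and the modification law are tested at each
  \<open>c\<close>, where they hold because \<open>NAt t c\<close> is a modification; naturality in
  \<open>c\<close> comes from \<open>is_nt_curry_arr_cell\<close>.\<close>

lemma curry_arr_modification: "is_modification D J (HomF C) (curry_arr t)"
  unfolding H.is_modification_iff
proof (intro conjI ballI)
  show "is_pseudo_nt D J (HomF C) (MDom (curry_arr t))" "is_pseudo_nt D J (HomF C) (MCod (curry_arr t))"
    using curry_obj_pseudo_nt NDom_NCod_functor by (simp_all add: curry_arr_simps)
  show "MAt (curry_arr t) \<in> extensional (Ob D)" by (simp add: curry_arr_def)
next
  fix a assume a: "a \<in> Ob D"
  note S = swap_proj[OF NDom_NCod_functor(1) a] and S' = swap_proj[OF NDom_NCod_functor(2) a]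
  show "NDom (MAt (curry_arr t) a) = T0 (MDom (curry_arr t)) a" "NCod (MAt (curry_arr t) a) = T0 (MCod (curry_arr t)) a"
    using a by (simp_all add: curry_arr_simps curry_obj_simps NDom_NCod_functor)
  have "is_nt (P0 J a) (functor_cat C (P0 F a)) (MAt (curry_arr t) a)"
    unfolding curry_arr_simps(3)[OF a]
  proof (rule is_nt_mk_nt[OF J.cat[OF a] S(1) S'(1)])
    fix j assume j: "j \<in> Obj (P0 J a)"
    show "mk_nt C (swap_at C (proj a (NDom t)) j) (swap_at C (proj a (NCod t)) j) (\<lambda>c. NAt (MAt (NAt t c) a) j)
        \<in> Arr (functor_cat C (P0 F a)) \<and>
      Dom (functor_cat C (P0 F a)) (mk_nt C (swap_at C (proj a (NDom t)) j) (swap_at C (proj a (NCod t)) j)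
        (\<lambda>c. NAt (MAt (NAt t c) a) j)) = FO (swap C (P0 J a) (proj a (NDom t))) j \<and>
      Cod (functor_cat C (P0 F a)) (mk_nt C (swap_at C (proj a (NDom t)) j) (swap_at C (proj a (NCod t)) j)
        (\<lambda>c. NAt (MAt (NAt t c) a) j)) = FO (swap C (P0 J a) (proj a (NCod t))) j"
      using is_nt_curry_arr_cell[OF a j] j by simp
  next
    fix k assume k: "k \<in> Arr (P0 J a)"
    have "Comp (P0 F a) (NAt (MAt (NAt t c) a) (Cod (P0 J a) k)) (FA (T0 (FO (NDom t) c) a) k) =
      Comp (P0 F a) (FA (T0 (FO (NCod t) c) a) k) (NAt (MAt (NAt t c) a) (Dom (P0 J a) k))"
      if c: "c \<in> Obj C" for c
      using nt_natural[OF NAt_MAt(1)[OF a c] k] NAt_MAt(2,3)[OF a c] by simp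
    then show "Comp (functor_cat C (P0 F a)) (mk_nt C (swap_at C (proj a (NDom t)) (Cod (P0 J a) k))
          (swap_at C (proj a (NCod t)) (Cod (P0 J a) k)) (\<lambda>c. NAt (MAt (NAt t c) a) (Cod (P0 J a) k)))
        (FA (swap C (P0 J a) (proj a (NDom t))) k) =
      Comp (functor_cat C (P0 F a)) (FA (swap C (P0 J a) (proj a (NCod t))) k)
        (mk_nt C (swap_at C (proj a (NDom t)) (Dom (P0 J a) k))
          (swap_at C (proj a (NCod t)) (Dom (P0 J a) k)) (\<lambda>c. NAt (MAt (NAt t c) a) (Dom (P0 J a) k)))"
      using k by (auto simp: proj_simps NDom_NCod_functor intro!: mk_nt_cong)
  qed
  then show "is_nt (P0 J a) (P0 (HomF C) a) (MAt (curry_arr t) a)" by simp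
next
  fix a b f j assume a: "a \<in> Ob D" "b \<in> Ob D" and f: "f \<in> Obj (Hom D a b)" and j: "j \<in> Obj (P0 J a)"
  have j': "FO (FO (P1 J a b) f) j \<in> Obj (P0 J b)" using functor_simps(1)[OF J.map1[OF a f] j] .
  show "Comp (P0 (HomF C) b) (NAt (MAt (curry_arr t) b) (FO (FO (P1 J a b) f) j))
          (NAt (T1 (MDom (curry_arr t)) a b f) j) =
      Comp (P0 (HomF C) b) (NAt (T1 (MCod (curry_arr t)) a b f) j)
          (FA (FO (P1 (HomF C) a b) f) (NAt (MAt (curry_arr t) a) j))"
    using a f j j' is_nt_curry_arr_cell[OF a(1) j] G.cat[OF a(2)] G.map1[OF a f]
      modificationD(7)[OF NAt_modification(1) a f j] NAt_modification(2,3)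
    by (auto simp: curry_arr_simps curry_obj_simps curry_cell_simps NDom_NCod_functor intro!: mk_nt_cong)
qed

end

definition curry where
  "curry = mk_functor (functor_cat C L) curry_obj curry_arr"

lemma is_functor_curry: "is_functor (functor_cat C L) (pseudo_hom D J (HomF C)) curry"
  unfolding curry_def
proof (rule is_functor_mk_functor)
  show "category (functor_cat C L)" using C category_pseudo_hom by simp
next
  fix H assume "H \<in> Obj (functor_cat C L)"
  then have H: "is_functor C L H" by simp
  then show "curry_obj H \<in> Obj (pseudo_hom D J (HomF C))"
    using curry_obj_pseudo_nt by (simp add: H.pseudo_hom_simps)
  have I: "is_nt C L (Ident (functor_cat C L) H)"
    using is_nt_Ident[OF C category_pseudo_hom H] by simp
  show "curry_arr (Ident (functor_cat C L) H) = Ident (pseudo_hom D J (HomF C)) (curry_obj H)"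
  proof (rule H.modification_eqI)
    fix a assume a: "a \<in> Ob D"
    show "MAt (curry_arr (Ident (functor_cat C L) H)) a = MAt (Ident (pseudo_hom D J (HomF C)) (curry_obj H)) a"
      using a H I
      by (auto simp: curry_arr_simps H.pseudo_hom_simps pseudo_hom_simps curry_obj_simps proj_simps
        intro!: mk_nt_cong)
  qed (use curry_arr_modification[OF I] H.is_modification_Ident[OF curry_obj_pseudo_nt[OF H]] I
      in \<open>simp_all add: curry_arr_simps H.pseudo_hom_simps\<close>)
next
  fix t assume "t \<in> Arr (functor_cat C L)"
  then show "curry_arr t \<in> Arr (pseudo_hom D J (HomF C)) \<and>
      Dom (pseudo_hom D J (HomF C)) (curry_arr t) = curry_obj (Dom (functor_cat C L) t) \<and>
      Cod (pseudo_hom D J (HomF C)) (curry_arr t) = curry_obj (Cod (functor_cat C L) t)"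
    using curry_arr_modification by (simp add: H.pseudo_hom_simps curry_arr_simps)
next
  fix t' t assume "t' \<in> Arr (functor_cat C L)" "t \<in> Arr (functor_cat C L)"
    "Dom (functor_cat C L) t' = Cod (functor_cat C L) t"
  then have t: "is_nt C L t'" "is_nt C L t" "NDom t' = NCod t" by simp_all
  have I: "is_nt C L (Comp (functor_cat C L) t' t)"
    using is_nt_Comp[OF C category_pseudo_hom t] by simp
  show "curry_arr (Comp (functor_cat C L) t' t) =
      Comp (pseudo_hom D J (HomF C)) (curry_arr t') (curry_arr t)"
  proof (rule H.modification_eqI)
    show "is_modification D J (HomF C) (Comp (pseudo_hom D J (HomF C)) (curry_arr t') (curry_arr t))"
      using t by (intro H.is_modification_Comp curry_arr_modification) (simp_all add: curry_arr_simps)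
    fix a assume a: "a \<in> Ob D"
    show "MAt (curry_arr (Comp (functor_cat C L) t' t)) a =
        MAt (Comp (pseudo_hom D J (HomF C)) (curry_arr t') (curry_arr t)) a"
      using a t I
      by (auto simp: curry_arr_simps H.pseudo_hom_simps pseudo_hom_simps curry_obj_simps proj_simps
        intro!: mk_nt_cong)
  qed (use curry_arr_modification[OF I] t I in \<open>simp_all add: curry_arr_simps H.pseudo_hom_simps\<close>)
qed

section \<open>From cones over \<open>Cat(C, F -)\<close> back to functors into
  \<open>L\<close>\<close>

context
  fixes s assumes s: "is_pseudo_nt D J (HomF C) s"
begin

lemma T0_functor: "a \<in> Ob D \<Longrightarrow> is_functor (P0 J a) (functor_cat C (P0 F a)) (T0 s a)"
  using H.pseudo_ntD(3)[OF s] by simp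

lemma T1_at:
  assumes a: "a \<in> Ob D" "b \<in> Ob D" and f: "f \<in> Obj (Hom D a b)" and j: "j \<in> Obj (P0 J a)"
  shows "is_nt C (P0 F b) (NAt (T1 s a b f) j)"
    and "NDom (NAt (T1 s a b f) j) = fcomp C (FO (P1 F a b) f) (FO (T0 s a) j)"
    and "NCod (NAt (T1 s a b f) j) = FO (T0 s b) (FO (FO (P1 J a b) f) j)"
  using nt_simps(3-5)[OF H.pseudo_ntD(4)[OF s a f] j] H.pseudo_ntD(5,6)[OF s a f] a f j
    functor_to_functor_cat(1)[OF J.cat G.cat C T0_functor, OF a(1) a(1) a(1) j] by simp_all

lemma uncurry_at_simps:
  "a \<in> Ob D \<Longrightarrow> T0 (uncurry_at s c) a = swap_at (P0 J a) (T0 s a) c"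
  "a \<in> Ob D \<Longrightarrow> b \<in> Ob D \<Longrightarrow> f \<in> Obj (Hom D a b) \<Longrightarrow> T1 (uncurry_at s c) a b f =
    mk_nt (P0 J a)
        (fcomp (P0 J a) (FO (P1 F a b) f) (swap_at (P0 J a) (T0 s a) c))
        (fcomp (P0 J a) (swap_at (P0 J b) (T0 s b) c) (FO (P1 J a b) f))
        (\<lambda>j. NAt (NAt (T1 s a b f) j) c)"
  by (simp_all add: uncurry_at_def)

lemma is_functor_T0_at:
  "a \<in> Ob D \<Longrightarrow> c \<in> Obj C \<Longrightarrow> is_functor (P0 J a) (P0 F a) (swap_at (P0 J a) (T0 s a) c)"
  using is_functor_swap_at[OF J.cat G.cat C T0_functor] .

text \<open>Each law of \<open>s\<close> at \<open>j\<close> equates transformations between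
  functors on \<open>C\<close>; taking the component at \<open>c\<close> of both sides gives the law
  for the evaluated cone.\<close>

lemma uncurry_at_pseudo_nt:
  assumes c: "c \<in> Obj C"
  shows "is_pseudo_nt D J F (uncurry_at s c)"
  unfolding is_pseudo_nt_iff
proof (intro conjI ballI)
  show "T0 (uncurry_at s c) \<in> extensional (Ob D)" by (simp add: uncurry_at_def)
  show "\<forall>a b f. \<not> (a \<in> Ob D \<and> b \<in> Ob D \<and> f \<in> Obj (Hom D a b)) \<longrightarrow> T1 (uncurry_at s c) a b f = undefined"
    by (simp add: uncurry_at_def)
  show "is_functor (P0 J a) (P0 F a) (T0 (uncurry_at s c) a)" if "a \<in> Ob D" for a
    using is_functor_T0_at[OF that c] that by (simp add: uncurry_at_simps)
next
  fix a b f assume a: "a \<in> Ob D" "b \<in> Ob D" and f: "f \<in> Obj (Hom D a b)"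
  note F = is_functor_T0_at[OF a(1) c] is_functor_T0_at[OF a(2) c]
  note Ff = G.map1[OF a f] and Jf = J.map1[OF a f]
  note T = functor_to_functor_cat[OF J.cat G.cat C T0_functor, OF a(1) a(1) a(1)]
  show "is_nt (P0 J a) (P0 F b) (T1 (uncurry_at s c) a b f)"
    unfolding uncurry_at_simps(2)[OF a f]
  proof (rule is_nt_mk_nt[OF J.cat[OF a(1)]])
    show "is_functor (P0 J a) (P0 F b) (fcomp (P0 J a) (FO (P1 F a b) f) (swap_at (P0 J a) (T0 s a) c))"
      using is_functor_fcomp[OF J.cat[OF a(1)] F(1) Ff] .
    show "is_functor (P0 J a) (P0 F b) (fcomp (P0 J a) (swap_at (P0 J b) (T0 s b) c) (FO (P1 J a b) f))"
      using is_functor_fcomp[OF J.cat[OF a(1)] Jf F(2)] .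
    fix j assume j: "j \<in> Obj (P0 J a)"
    show "NAt (NAt (T1 s a b f) j) c \<in> Arr (P0 F b) \<and>
         Dom (P0 F b) (NAt (NAt (T1 s a b f) j) c) =
         FO (fcomp (P0 J a) (FO (P1 F a b) f) (swap_at (P0 J a) (T0 s a) c)) j \<and>
         Cod (P0 F b) (NAt (NAt (T1 s a b f) j) c) =
         FO (fcomp (P0 J a) (swap_at (P0 J b) (T0 s b) c) (FO (P1 J a b) f)) j"
      using T1_at[OF a f j] c j Jf by simp
  next
    fix k assume k: "k \<in> Arr (P0 J a)"
    have Jk: "FA (FO (P1 J a b) f) k \<in> Arr (P0 J b)" using Jf k by simp
    show "Comp (P0 F b) (NAt (NAt (T1 s a b f) (Cod (P0 J a) k)) c)
          (FA (fcomp (P0 J a) (FO (P1 F a b) f) (swap_at (P0 J a) (T0 s a) c)) k) =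
         Comp (P0 F b) (FA (fcomp (P0 J a) (swap_at (P0 J b) (T0 s b) c) (FO (P1 J a b) f)) k)
          (NAt (NAt (T1 s a b f) (Dom (P0 J a) k)) c)"
      using arg_cong[OF nt_natural[OF H.pseudo_ntD(4)[OF s a f] k], of "\<lambda>n. NAt n c"]
        H.pseudo_ntD(5,6)[OF s a f] c k f Jk Ff T(2)[OF k] G.cat[OF a(2)] by simp
  qed
  show "NDom (T1 (uncurry_at s c) a b f) = fcomp (P0 J a) (FO (P1 F a b) f) (T0 (uncurry_at s c) a)"
    "NCod (T1 (uncurry_at s c) a b f) = fcomp (P0 J a) (T0 (uncurry_at s c) b) (FO (P1 J a b) f)"
    using a f by (simp_all add: uncurry_at_simps)
  fix j assume j: "j \<in> Obj (P0 J a)"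
  have j': "FO (FO (P1 J a b) f) j \<in> Obj (P0 J b)" using functor_simps(1)[OF Jf j] .
  have "iso_arrow (functor_cat C (P0 F b)) (fcomp C (FO (P1 F a b) f) (FO (T0 s a) j))
      (FO (T0 s b) (FO (FO (P1 J a b) f) j)) (NAt (T1 s a b f) j)"
    using H.pseudo_ntD(7)[OF s a f j] f T(1)[OF j] by simp
  then show "iso_arrow (P0 F b) (FO (FO (P1 F a b) f) (FO (T0 (uncurry_at s c) a) j))
        (FO (T0 (uncurry_at s c) b) (FO (FO (P1 J a b) f) j)) (NAt (T1 (uncurry_at s c) a b f) j)"
    using a f j j' c iso_arrow_functor_cat_iff[OF C G.cat[OF a(2)]] by (auto simp: uncurry_at_simps)
next
  fix a b t j assume a: "a \<in> Ob D" "b \<in> Ob D" and t: "t \<in> Arr (Hom D a b)" and j: "j \<in> Obj (P0 J a)"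
  have fg: "Dom (Hom D a b) t \<in> Obj (Hom D a b)" "Cod (Hom D a b) t \<in> Obj (Hom D a b)"
    using J.hom_category[OF a] t by simp_all
  note Jt = J.map2[OF a t] and Ft = G.map2[OF a t]
  note k = nt_simps(3-5)[OF conjunct1[OF Jt] j]
  note T = functor_to_functor_cat[OF J.cat G.cat C T0_functor, OF a(1) a(1) a(1)]
  show "Comp (P0 F b) (FA (T0 (uncurry_at s c) b) (NAt (FA (P1 J a b) t) j))
          (NAt (T1 (uncurry_at s c) a b (Dom (Hom D a b) t)) j) =
        Comp (P0 F b) (NAt (T1 (uncurry_at s c) a b (Cod (Hom D a b) t)) j)
          (NAt (FA (P1 F a b) t) (FO (T0 (uncurry_at s c) a) j))"
    using arg_cong[OF H.pseudo_ntD(8)[OF s a t j], of "\<lambda>n. NAt n c"]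
      a t j fg Jt Ft k c T(1)[OF j] G.cat[OF a(2)] by (simp add: uncurry_at_simps)
next
  fix a j assume a: "a \<in> Ob D" and j: "j \<in> Obj (P0 J a)"
  note Ja = J.unit[OF a] and Fa = G.unit[OF a]
  note k = nt_simps(3-5)[OF conjunct1[OF Ja] j]
  note T = functor_to_functor_cat[OF J.cat G.cat C T0_functor, OF a a a]
  show "Comp (P0 F a) (NAt (T1 (uncurry_at s c) a a (One D a)) j)
          (NAt (PUnit F a) (FO (T0 (uncurry_at s c) a) j)) =
         FA (T0 (uncurry_at s c) a) (NAt (PUnit J a) j)"
    using arg_cong[OF H.pseudo_ntD(9)[OF s a j], of "\<lambda>n. NAt n c"]
      a j J.one[OF a] Ja Fa k c T(1)[OF j] G.cat[OF a] by (simp add: uncurry_at_simps)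
next
  fix a b d f g j assume a: "a \<in> Ob D" "b \<in> Ob D" "d \<in> Ob D"
    and f: "f \<in> Obj (Hom D a b)" and g: "g \<in> Obj (Hom D b d)" and j: "j \<in> Obj (P0 J a)"
  note Jgf = J.mult[OF a f g] and Fgf = G.mult[OF a f g]
  note k = nt_simps(3-5)[OF conjunct1[OF Jgf] j]
  have j': "FO (FO (P1 J a b) f) j \<in> Obj (P0 J b)" using functor_simps(1)[OF J.map1[OF a(1,2) f] j] .
  note T = functor_to_functor_cat[OF J.cat G.cat C T0_functor, OF a(1) a(1) a(1)]
  show "Comp (P0 F d) (NAt (T1 (uncurry_at s c) a d (Comp1 D a b d g f)) j)
          (NAt (PComp F a b d g f) (FO (T0 (uncurry_at s c) a) j)) =
         Comp (P0 F d) (FA (T0 (uncurry_at s c) d) (NAt (PComp J a b d g f) j))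
          (Comp (P0 F d) (NAt (T1 (uncurry_at s c) b d g) (FO (FO (P1 J a b) f) j))
            (FA (FO (P1 F b d) g) (NAt (T1 (uncurry_at s c) a b f) j)))"
    using arg_cong[OF H.pseudo_ntD(10)[OF s a f g j], of "\<lambda>n. NAt n c"]
      a j f g c J.comp1[OF a f g] Jgf Fgf k j' T(1)[OF j] G.cat[OF a(3)] G.map1[OF a(2,3) g]
      T1_at(1)[OF a(1,2) f j] by (simp add: uncurry_at_simps)
qed

lemma uncurry_obj_simps:
  "c \<in> Obj C \<Longrightarrow> FO (uncurry_obj s) c = uncurry_at s c"
  "u \<in> Arr C \<Longrightarrow> FA (uncurry_obj s) u = \<lparr>MDom = uncurry_at s (Dom C u), MCod = uncurry_at s (Cod C u),
      MAt = (\<lambda>a \<in> Ob D. FA (swap (P0 J a) C (T0 s a)) u)\<rparr>"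
  by (simp_all add: uncurry_obj_def)

lemma is_functor_swap_T0: "a \<in> Ob D \<Longrightarrow> is_functor C (functor_cat (P0 J a) (P0 F a)) (swap (P0 J a) C (T0 s a))"
  using is_functor_swap[OF J.cat G.cat C T0_functor] .

text \<open>Functoriality in \<open>c\<close> is that of the transposes of \<open>T0 s a\<close>.
  The modification law for an arrow \<open>u\<close> is the naturality square at \<open>u\<close> of
  the transformation \<open>NAt (T1 s a b f) j\<close>, the reverse of
  \<open>is_nt_curry_cell\<close>.\<close>

lemma is_functor_uncurry_obj: "is_functor C L (uncurry_obj s)"
  unfolding uncurry_obj_def
proof (rule is_functor_mk_functor[OF C])
  fix c assume c: "c \<in> Obj C"
  show "uncurry_at s c \<in> Obj L" using uncurry_at_pseudo_nt[OF c] by (simp add: pseudo_hom_simps)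
  have "FA (swap (P0 J a) C (T0 s a)) (Ident C c) =
      Ident (functor_cat (P0 J a) (P0 F a)) (swap_at (P0 J a) (T0 s a) c)" if "a \<in> Ob D" for a
    using functor_simps(5)[OF is_functor_swap_T0[OF that] c] c by simp
  then show "\<lparr>MDom = uncurry_at s (Dom C (Ident C c)), MCod = uncurry_at s (Cod C (Ident C c)),
        MAt = \<lambda>a\<in>Ob D. FA (swap (P0 J a) C (T0 s a)) (Ident C c)\<rparr> = Ident L (uncurry_at s c)"
    using c C by (auto simp: pseudo_hom_simps uncurry_at_simps simp del: swap_simps intro!: restrict_ext)
next
  fix u assume u: "u \<in> Arr C"
  have "is_modification D J F \<lparr>MDom = uncurry_at s (Dom C u), MCod = uncurry_at s (Cod C u),
        MAt = \<lambda>a\<in>Ob D. FA (swap (P0 J a) C (T0 s a)) u\<rparr>"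
    unfolding is_modification_iff
  proof (simp del: swap_simps, intro conjI ballI)
    show "is_pseudo_nt D J F (uncurry_at s (Dom C u))" "is_pseudo_nt D J F (uncurry_at s (Cod C u))"
      using uncurry_at_pseudo_nt u C by simp_all
  next
    fix a assume a: "a \<in> Ob D"
    show "is_nt (P0 J a) (P0 F a) (FA (swap (P0 J a) C (T0 s a)) u)"
      "NDom (FA (swap (P0 J a) C (T0 s a)) u) = T0 (uncurry_at s (Dom C u)) a"
      "NCod (FA (swap (P0 J a) C (T0 s a)) u) = T0 (uncurry_at s (Cod C u)) a"
      using functor_simps(2-4)[OF is_functor_swap_T0[OF a] u] a u C by (simp_all add: uncurry_at_simps)
  next
    fix a b f j assume a: "a \<in> Ob D" "b \<in> Ob D" and f: "f \<in> Obj (Hom D a b)" and j: "j \<in> Obj (P0 J a)"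
    have j': "FO (FO (P1 J a b) f) j \<in> Obj (P0 J b)" using functor_simps(1)[OF J.map1[OF a f] j] .
    show "Comp (P0 F b) (NAt (FA (swap (P0 J b) C (T0 s b)) u) (FO (FO (P1 J a b) f) j))
           (NAt (T1 (uncurry_at s (Dom C u)) a b f) j) =
          Comp (P0 F b) (NAt (T1 (uncurry_at s (Cod C u)) a b f) j)
           (FA (FO (P1 F a b) f) (NAt (FA (swap (P0 J a) C (T0 s a)) u) j))"
      using nt_natural[OF T1_at(1)[OF a f j] u] T1_at(2,3)[OF a f j] a f j j' u
      by (simp add: uncurry_at_simps)
  qed
  then show "\<lparr>MDom = uncurry_at s (Dom C u), MCod = uncurry_at s (Cod C u),
        MAt = \<lambda>a\<in>Ob D. FA (swap (P0 J a) C (T0 s a)) u\<rparr> \<in> Arr L \<and>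
      Dom L \<lparr>MDom = uncurry_at s (Dom C u), MCod = uncurry_at s (Cod C u),
        MAt = \<lambda>a\<in>Ob D. FA (swap (P0 J a) C (T0 s a)) u\<rparr> = uncurry_at s (Dom C u) \<and>
      Cod L \<lparr>MDom = uncurry_at s (Dom C u), MCod = uncurry_at s (Cod C u),
        MAt = \<lambda>a\<in>Ob D. FA (swap (P0 J a) C (T0 s a)) u\<rparr> = uncurry_at s (Cod C u)"
    by (simp add: pseudo_hom_simps)
next
  fix v u assume vu: "v \<in> Arr C" "u \<in> Arr C" "Dom C v = Cod C u"
  have "FA (swap (P0 J a) C (T0 s a)) (Comp C v u) =
      Comp (functor_cat (P0 J a) (P0 F a)) (FA (swap (P0 J a) C (T0 s a)) v) (FA (swap (P0 J a) C (T0 s a)) u)"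
    if "a \<in> Ob D" for a
    using functor_simps(6)[OF is_functor_swap_T0[OF that] vu] .
  then show "\<lparr>MDom = uncurry_at s (Dom C (Comp C v u)), MCod = uncurry_at s (Cod C (Comp C v u)),
        MAt = \<lambda>a\<in>Ob D. FA (swap (P0 J a) C (T0 s a)) (Comp C v u)\<rparr> =
      Comp L \<lparr>MDom = uncurry_at s (Dom C v), MCod = uncurry_at s (Cod C v),
        MAt = \<lambda>a\<in>Ob D. FA (swap (P0 J a) C (T0 s a)) v\<rparr>
      \<lparr>MDom = uncurry_at s (Dom C u), MCod = uncurry_at s (Cod C u),
        MAt = \<lambda>a\<in>Ob D. FA (swap (P0 J a) C (T0 s a)) u\<rparr>"
    using vu C by (auto simp: pseudo_hom_simps simp del: swap_simps intro!: restrict_ext)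
qed

text \<open>Reduces the round trip at \<open>a\<close> to \<open>swap_swap\<close>.\<close>

lemma proj_uncurry_obj:
  assumes "a \<in> Ob D"
  shows "proj a (uncurry_obj s) = swap (P0 J a) C (T0 s a)"
  unfolding proj_def swap_def[of "P0 J a"] using assms
  by (auto simp: uncurry_obj_simps uncurry_at_simps intro!: mk_functor_cong)

lemma curry_uncurry_obj: "curry_obj (uncurry_obj s) = s"
proof (rule H.pseudo_nt_eqI[OF curry_obj_pseudo_nt[OF is_functor_uncurry_obj] s])
  note S = swap_swap[OF J.cat G.cat C T0_functor] and S' = swap_at_swap[OF J.cat G.cat C T0_functor]
  note U = is_functor_uncurry_obj
  show "T0 (curry_obj (uncurry_obj s)) a = T0 s a" if "a \<in> Ob D" for a
    using that by (simp add: curry_obj_simps[OF U] proj_uncurry_obj S)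
  fix a b f assume a: "a \<in> Ob D" "b \<in> Ob D" and f: "f \<in> Obj (Hom D a b)"
  have "curry_cell (uncurry_obj s) a b f j = NAt (T1 s a b f) j" if j: "j \<in> Obj (P0 J a)" for j
  proof -
    have j': "FO (FO (P1 J a b) f) j \<in> Obj (P0 J b)" using functor_simps(1)[OF J.map1[OF a f] j] .
    show ?thesis unfolding curry_cell_def
      by (rule mk_nt_eqI[OF T1_at(1)[OF a f j]])
        (use T1_at(2,3)[OF a f j] a f j j' in \<open>simp_all add: proj_uncurry_obj S' uncurry_obj_simps uncurry_at_simps\<close>)
  qed
  then show "T1 (curry_obj (uncurry_obj s)) a b f = T1 s a b f"
    unfolding curry_obj_simps(2)[OF U a f]
    by (intro mk_nt_eqI[OF H.pseudo_ntD(4)[OF s a f]])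
      (use H.pseudo_ntD(5,6)[OF s a f] a in \<open>simp_all add: proj_uncurry_obj S\<close>)
qed

end

lemma uncurry_curry_obj:
  assumes H: "is_functor C L H"
  shows "uncurry_obj (curry_obj H) = H"
proof -
  note s = curry_obj_pseudo_nt[OF H]
  note S = swap_swap[OF C G.cat J.cat is_functor_proj[OF H]]
  \<comment> \<open>Agreement on objects comes before arrows, since it also identifies the sources
    and targets of the modifications compared below.\<close>
  have at: "uncurry_at (curry_obj H) c = FO H c" if c: "c \<in> Obj C" for c
  proof (rule pseudo_nt_eqI[OF uncurry_at_pseudo_nt[OF s c] FO_pseudo_nt[OF H c]])
    have T0: "swap_at (P0 J a) (swap C (P0 J a) (proj a H)) c = T0 (FO H c) a" if a: "a \<in> Ob D" for a
      using swap_at_swap[OF C G.cat J.cat is_functor_proj[OF H] c] a c by (simp add: proj_simps[OF H])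
    then show "T0 (uncurry_at (curry_obj H) c) a = T0 (FO H c) a" if a: "a \<in> Ob D" for a
      using a by (simp add: uncurry_at_simps[OF s] curry_obj_simps[OF H])
    fix a b f assume a: "a \<in> Ob D" "b \<in> Ob D" and f: "f \<in> Obj (Hom D a b)"
    show "T1 (uncurry_at (curry_obj H) c) a b f = T1 (FO H c) a b f"
      unfolding uncurry_at_simps(2)[OF s a f]
      by (rule mk_nt_eqI[OF pseudo_ntD(4)[OF FO_pseudo_nt[OF H c] a f]])
        (use pseudo_ntD(5,6)[OF FO_pseudo_nt[OF H c] a f] a f c T0
          in \<open>simp_all add: curry_obj_simps[OF H] curry_cell_simps[OF H]\<close>)
  qed
  show ?thesis
  proof (rule functor_eqI[OF is_functor_uncurry_obj[OF s] H])
    show "FO (uncurry_obj (curry_obj H)) c = FO H c" if "c \<in> Obj C" for c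
      using at[OF that] that by (simp add: uncurry_obj_simps[OF s])
    fix u assume u: "u \<in> Arr C"
    show "FA (uncurry_obj (curry_obj H)) u = FA H u"
    proof (rule modification_eqI)
      show "is_modification D J F (FA (uncurry_obj (curry_obj H)) u)"
        using FA_modification(1)[OF is_functor_uncurry_obj[OF s] u] .
      show "is_modification D J F (FA H u)" using FA_modification(1)[OF H u] .
      show "MDom (FA (uncurry_obj (curry_obj H)) u) = MDom (FA H u)"
        "MCod (FA (uncurry_obj (curry_obj H)) u) = MCod (FA H u)"
        using FA_modification(2,3)[OF H u] u C at by (simp_all add: uncurry_obj_simps[OF s])
      show "MAt (FA (uncurry_obj (curry_obj H)) u) a = MAt (FA H u) a" if a: "a \<in> Ob D" for a
        using S[OF a] u a by (simp add: uncurry_obj_simps[OF s] curry_obj_simps[OF H] proj_simps[OF H] del: swap_simps)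
    qed
  qed
qed

lemma uncurry_arr_simps:
  "NDom (uncurry_arr m) = uncurry_obj (MDom m)"
  "NCod (uncurry_arr m) = uncurry_obj (MCod m)"
  "c \<in> Obj C \<Longrightarrow> NAt (uncurry_arr m) c = \<lparr>MDom = uncurry_at (MDom m) c, MCod = uncurry_at (MCod m) c,
      MAt = (\<lambda>a \<in> Ob D. mk_nt (P0 J a) (swap_at (P0 J a) (T0 (MDom m) a) c)
        (swap_at (P0 J a) (T0 (MCod m) a) c) (\<lambda>j. NAt (NAt (MAt m a) j) c))\<rparr>"
  by (simp_all add: uncurry_arr_def)

section \<open>From modifications back to transformations of functors into \<open>L\<close>\<close>

context
  fixes m assumes m: "is_modification D J (HomF C) m"
begin

lemma MDom_MCod_pseudo_nt: "is_pseudo_nt D J (HomF C) (MDom m)" "is_pseudo_nt D J (HomF C) (MCod m)"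
  using H.modificationD(1,2)[OF m] .

lemma MAt_at:
  assumes "a \<in> Ob D" "j \<in> Obj (P0 J a)"
  shows "is_nt C (P0 F a) (NAt (MAt m a) j)"
    and "NDom (NAt (MAt m a) j) = FO (T0 (MDom m) a) j"
    and "NCod (NAt (MAt m a) j) = FO (T0 (MCod m) a) j"
  using nt_simps(3-5)[OF H.modificationD(4)[OF m assms(1)] assms(2)]
    H.modificationD(5,6)[OF m assms(1)] by simp_all

lemma is_nt_uncurry_arr_at:
  assumes a: "a \<in> Ob D" and c: "c \<in> Obj C"
  shows "is_nt (P0 J a) (P0 F a) (mk_nt (P0 J a) (swap_at (P0 J a) (T0 (MDom m) a) c)
      (swap_at (P0 J a) (T0 (MCod m) a) c) (\<lambda>j. NAt (NAt (MAt m a) j) c))"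
proof (rule is_nt_mk_nt[OF J.cat[OF a] is_functor_T0_at[OF MDom_MCod_pseudo_nt(1) a c]
      is_functor_T0_at[OF MDom_MCod_pseudo_nt(2) a c]])
  fix j assume j: "j \<in> Obj (P0 J a)"
  then show "NAt (NAt (MAt m a) j) c \<in> Arr (P0 F a) \<and>
      Dom (P0 F a) (NAt (NAt (MAt m a) j) c) = FO (swap_at (P0 J a) (T0 (MDom m) a) c) j \<and>
      Cod (P0 F a) (NAt (NAt (MAt m a) j) c) = FO (swap_at (P0 J a) (T0 (MCod m) a) c) j"
    using MAt_at[OF a j] c by simp
next
  fix k assume k: "k \<in> Arr (P0 J a)"
  show "Comp (P0 F a) (NAt (NAt (MAt m a) (Cod (P0 J a) k)) c) (FA (swap_at (P0 J a) (T0 (MDom m) a) c) k) =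
      Comp (P0 F a) (FA (swap_at (P0 J a) (T0 (MCod m) a) c) k) (NAt (NAt (MAt m a) (Dom (P0 J a) k)) c)"
    using arg_cong[OF nt_natural[OF H.modificationD(4)[OF m a] k], of "\<lambda>n. NAt n c"] c k
      H.modificationD(5,6)[OF m a] by simp
qed

lemma uncurry_arr_at_modification:
  assumes c: "c \<in> Obj C"
  shows "is_modification D J F (NAt (uncurry_arr m) c)"
  unfolding is_modification_iff uncurry_arr_simps(3)[OF c]
proof (simp add: uncurry_at_pseudo_nt[OF MDom_MCod_pseudo_nt(1) c] uncurry_at_pseudo_nt[OF MDom_MCod_pseudo_nt(2) c],
    intro conjI ballI)
  fix a assume a: "a \<in> Ob D"
  show "is_nt (P0 J a) (P0 F a) (mk_nt (P0 J a) (swap_at (P0 J a) (T0 (MDom m) a) c)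
      (swap_at (P0 J a) (T0 (MCod m) a) c) (\<lambda>j. NAt (NAt (MAt m a) j) c))"
    using is_nt_uncurry_arr_at[OF a c] .
  show "swap_at (P0 J a) (T0 (MDom m) a) c = T0 (uncurry_at (MDom m) c) a"
    "swap_at (P0 J a) (T0 (MCod m) a) c = T0 (uncurry_at (MCod m) c) a"
    using a by (simp_all add: uncurry_at_simps MDom_MCod_pseudo_nt)
next
  fix a b f j assume a: "a \<in> Ob D" "b \<in> Ob D" and f: "f \<in> Obj (Hom D a b)" and j: "j \<in> Obj (P0 J a)"
  have j': "FO (FO (P1 J a b) f) j \<in> Obj (P0 J b)" using functor_simps(1)[OF J.map1[OF a f] j] .
  show "Comp (P0 F b) (NAt (mk_nt (P0 J b) (swap_at (P0 J b) (T0 (MDom m) b) c)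
        (swap_at (P0 J b) (T0 (MCod m) b) c) (\<lambda>j. NAt (NAt (MAt m b) j) c)) (FO (FO (P1 J a b) f) j))
        (NAt (T1 (uncurry_at (MDom m) c) a b f) j) =
      Comp (P0 F b) (NAt (T1 (uncurry_at (MCod m) c) a b f) j)
        (FA (FO (P1 F a b) f) (NAt (NAt (MAt m a) j) c))"
    using arg_cong[OF H.modificationD(7)[OF m a f j], of "\<lambda>n. NAt n c"] a f j j' c
      MAt_at(1)[OF a(1) j] G.cat[OF a(2)] G.map1[OF a f]
    by (simp add: uncurry_at_simps MDom_MCod_pseudo_nt)
qed

text \<open>Naturality along \<open>u\<close> is an equation of modifications; at \<open>a\<close>
  and \<open>j\<close> it is the naturality square of \<open>NAt (MAt m a) j\<close> at
  \<open>u\<close>.\<close>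

lemma is_nt_uncurry_arr: "is_nt C L (uncurry_arr m)"
proof -
  note U = uncurry_obj_simps[OF MDom_MCod_pseudo_nt(1)] uncurry_obj_simps[OF MDom_MCod_pseudo_nt(2)]
  note V = uncurry_at_simps[OF MDom_MCod_pseudo_nt(1)] uncurry_at_simps[OF MDom_MCod_pseudo_nt(2)]
  have "is_nt C L (mk_nt C (uncurry_obj (MDom m)) (uncurry_obj (MCod m)) (NAt (uncurry_arr m)))"
  proof (rule is_nt_mk_nt[OF C is_functor_uncurry_obj[OF MDom_MCod_pseudo_nt(1)]
        is_functor_uncurry_obj[OF MDom_MCod_pseudo_nt(2)]])
    fix c assume c: "c \<in> Obj C"
    then show "NAt (uncurry_arr m) c \<in> Arr L \<and>
        Dom L (NAt (uncurry_arr m) c) = FO (uncurry_obj (MDom m)) c \<and>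
        Cod L (NAt (uncurry_arr m) c) = FO (uncurry_obj (MCod m)) c"
      using uncurry_arr_at_modification[OF c] U(1,3) by (simp add: pseudo_hom_simps uncurry_arr_simps)
  next
    fix u assume u: "u \<in> Arr C"
    have "Comp (P0 F a) (NAt (NAt (MAt m a) j) (Cod C u)) (FA (FO (T0 (MDom m) a) j) u) =
        Comp (P0 F a) (FA (FO (T0 (MCod m) a) j) u) (NAt (NAt (MAt m a) j) (Dom C u))"
      if a: "a \<in> Ob D" and j: "j \<in> Obj (P0 J a)" for a j
      using nt_natural[OF MAt_at(1)[OF a j] u] MAt_at(2,3)[OF a j] by simp
    then show "Comp L (NAt (uncurry_arr m) (Cod C u)) (FA (uncurry_obj (MDom m)) u) =
        Comp L (FA (uncurry_obj (MCod m)) u) (NAt (uncurry_arr m) (Dom C u))"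
      using u C by (auto simp: U V pseudo_hom_simps uncurry_arr_simps intro!: restrict_ext mk_nt_cong)
  qed
  then show ?thesis by (simp add: uncurry_arr_def mk_nt_def cong: restrict_cong)
qed

lemma curry_uncurry_arr: "curry_arr (uncurry_arr m) = m"
proof (rule H.modification_eqI[OF curry_arr_modification[OF is_nt_uncurry_arr] m])
  show "MDom (curry_arr (uncurry_arr m)) = MDom m" "MCod (curry_arr (uncurry_arr m)) = MCod m"
    using curry_uncurry_obj MDom_MCod_pseudo_nt by (simp_all add: curry_arr_simps uncurry_arr_simps)
  fix a assume a: "a \<in> Ob D"
  note m' = MDom_MCod_pseudo_nt
  note S = swap_swap[OF J.cat G.cat C T0_functor[OF m'(1)], OF a a a]
    swap_swap[OF J.cat G.cat C T0_functor[OF m'(2)], OF a a a]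
  have "mk_nt C (swap_at C (proj a (uncurry_obj (MDom m))) j) (swap_at C (proj a (uncurry_obj (MCod m))) j)
        (\<lambda>c. NAt (MAt (NAt (uncurry_arr m) c) a) j) = NAt (MAt m a) j" if j: "j \<in> Obj (P0 J a)" for j
    by (rule mk_nt_eqI[OF MAt_at(1)[OF a j]])
      (use MAt_at(2,3)[OF a j] a j in \<open>simp_all add: proj_uncurry_obj m' uncurry_arr_simps
        swap_at_swap[OF J.cat G.cat C T0_functor[OF m'(1)], OF a a a j]
        swap_at_swap[OF J.cat G.cat C T0_functor[OF m'(2)], OF a a a j]\<close>)
  then show "MAt (curry_arr (uncurry_arr m)) a = MAt m a"
    unfolding curry_arr_simps(3)[OF a] uncurry_arr_simps(1,2)
    by (intro mk_nt_eqI[OF H.modificationD(4)[OF m a]])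
      (use H.modificationD(5,6)[OF m a] a in \<open>simp_all add: proj_uncurry_obj m' S\<close>)
qed

end

lemma uncurry_curry_arr:
  assumes t: "is_nt C L t"
  shows "uncurry_arr (curry_arr t) = t"
proof -
  note H = NDom_NCod_functor[OF t] and m = curry_arr_modification[OF t]
  note s = curry_obj_pseudo_nt[OF H(1)] curry_obj_pseudo_nt[OF H(2)]
  have dc: "NDom (uncurry_arr (curry_arr t)) = NDom t" "NCod (uncurry_arr (curry_arr t)) = NCod t"
    using uncurry_curry_obj H by (simp_all add: uncurry_arr_simps curry_arr_simps)
  show ?thesis
  proof (rule nt_eqI[OF is_nt_uncurry_arr[OF m] t dc])
    fix c assume c: "c \<in> Obj C"
    note M = NAt_modification[OF is_nt_uncurry_arr[OF m] c] and M' = NAt_modification[OF t c]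
    show "NAt (uncurry_arr (curry_arr t)) c = NAt t c"
    proof (rule modification_eqI[OF M(1) M'(1)])
      show "MDom (NAt (uncurry_arr (curry_arr t)) c) = MDom (NAt t c)"
        "MCod (NAt (uncurry_arr (curry_arr t)) c) = MCod (NAt t c)"
        using M(2,3) M'(2,3) dc by simp_all
      fix a assume a: "a \<in> Ob D"
      show "MAt (NAt (uncurry_arr (curry_arr t)) c) a = MAt (NAt t c) a"
        using a c NAt_MAt[OF t a c]
          swap_at_swap[OF C G.cat J.cat is_functor_proj[OF H(1)], OF a a a c]
          swap_at_swap[OF C G.cat J.cat is_functor_proj[OF H(2)], OF a a a c]
        by (auto simp: uncurry_arr_simps curry_arr_simps curry_obj_simps[OF H(1)] curry_obj_simps[OF H(2)]
            proj_simps[OF H(1)] proj_simps[OF H(2)] intro!: mk_nt_eqI)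
    qed
  qed
qed

lemma cat_iso_curry: "cat_iso (functor_cat C L) (pseudo_hom D J (HomF C)) curry"
proof (rule cat_isoI[OF is_functor_curry])
  show "uncurry_obj s \<in> Obj (functor_cat C L) \<and> FO curry (uncurry_obj s) = s"
    if "s \<in> Obj (pseudo_hom D J (HomF C))" for s
    using that is_functor_uncurry_obj curry_uncurry_obj by (simp add: curry_def H.pseudo_hom_simps)
  show "uncurry_obj (FO curry H) = H" if "H \<in> Obj (functor_cat C L)" for H
    using that uncurry_curry_obj by (simp add: curry_def)
  show "uncurry_arr m \<in> Arr (functor_cat C L) \<and> FA curry (uncurry_arr m) = m"
    if "m \<in> Arr (pseudo_hom D J (HomF C))" for m
    using that is_nt_uncurry_arr curry_uncurry_arr by (simp add: curry_def H.pseudo_hom_simps)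
  show "uncurry_arr (FA curry t) = t" if "t \<in> Arr (functor_cat C L)" for t
    using that uncurry_curry_arr by (simp add: curry_def)
qed

end

section \<open>Naturality of the comparison in the vertex\<close>

lemma swap_precomp:
  assumes A: "category A" and B: "category B" and C: "category C" and Z: "category Z"
    and T: "is_functor C (functor_cat A Z) T" and u: "is_functor B C u"
  shows "j \<in> Obj A \<Longrightarrow> fcomp B (swap_at C T j) u = swap_at B (fcomp B T u) j"
    and "fcomp A (pre_comp (Cat_of P) B C Z u) (swap C A T) = swap B A (fcomp B T u)"
proof -
  note S = functor_to_functor_cat(1)[OF A Z C is_functor_swap[OF C Z A T]]
    functor_to_functor_cat(2-4)[OF A Z C is_functor_swap[OF C Z A T]]
  show *: "fcomp B (swap_at C T j) u = swap_at B (fcomp B T u) j" if "j \<in> Obj A" for j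
    unfolding fcomp_def[of B "swap_at C T j"] swap_at_def[of B] using u by (auto intro!: mk_functor_cong)
  show "fcomp A (pre_comp (Cat_of P) B C Z u) (swap C A T) = swap B A (fcomp B T u)"
    unfolding fcomp_def[of A] swap_def[of B]
  proof (rule mk_functor_cong)
    fix j assume j: "j \<in> Obj A"
    then show "FO (pre_comp (Cat_of P) B C Z u) (FO (swap C A T) j) = swap_at B (fcomp B T u) j"
      using S(1)[OF j] * by simp
  next
    fix k assume k: "k \<in> Arr A"
    have "FA (pre_comp (Cat_of P) B C Z u) (FA (swap C A T) k) = whisker_right B (FA (swap C A T) k) u"
      using S(2)[OF k] Z u by (simp del: swap_simps)
    also have "\<dots> = mk_nt B (swap_at B (fcomp B T u) (Dom A k)) (swap_at B (fcomp B T u) (Cod A k))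
        (\<lambda>c. FA (FO (fcomp B T u) c) k)"
      unfolding whisker_right_def using k u A by (auto intro!: mk_nt_cong simp: *)
    finally show "FA (pre_comp (Cat_of P) B C Z u) (FA (swap C A T) k) =
      mk_nt B (swap_at B (fcomp B T u) (Dom A k)) (swap_at B (fcomp B T u) (Cod A k))
        (\<lambda>c. FA (FO (fcomp B T u) c) k)" .
  qed
qed

text \<open>On functors both sides are \<open>f\<close> after \<open>h\<close> after
  \<open>u\<close>. This matches the sources of structure cells when a cone is pulled back along
  \<open>u\<close>.\<close>

lemma pre_comp_post_comp:
  assumes B: "category B" and C: "category C" and X: "category X" and Y: "category Y"
    and u: "is_functor B C u" and f: "is_functor X Y f"
  shows "is_functor C X h \<Longrightarrow> FO (pre_comp (Cat_of P) B C Y u) (FO (post_comp (Cat_of P) C X Y f) h) =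
      FO (post_comp (Cat_of P) B X Y f) (FO (pre_comp (Cat_of P) B C X u) h)"
    and "is_nt C X t \<Longrightarrow> FA (pre_comp (Cat_of P) B C Y u) (FA (post_comp (Cat_of P) C X Y f) t) =
      FA (post_comp (Cat_of P) B X Y f) (FA (pre_comp (Cat_of P) B C X u) t)"
proof -
  assume h: "is_functor C X h"
  show "FO (pre_comp (Cat_of P) B C Y u) (FO (post_comp (Cat_of P) C X Y f) h) =
      FO (post_comp (Cat_of P) B X Y f) (FO (pre_comp (Cat_of P) B C X u) h)"
    using is_functor_fcomp[OF C h f] is_functor_fcomp[OF B u h] h u by (simp add: fcomp_assoc)
next
  assume t: "is_nt C X t"
  have "whisker_right B (whisker_left C f t) u = whisker_left B f (whisker_right B t u)"
    unfolding whisker_right_def[of B "whisker_left C f t"] whisker_left_def[of B]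
    using u by (auto intro!: mk_nt_cong simp: fcomp_assoc)
  then show "FA (pre_comp (Cat_of P) B C Y u) (FA (post_comp (Cat_of P) C X Y f) t) =
      FA (post_comp (Cat_of P) B X Y f) (FA (pre_comp (Cat_of P) B C X u) t)"
    using is_nt_whisker_left[OF C X f t] is_nt_whisker_right[OF B u t] X Y u f t by simp
qed

text \<open>The sublocales \<open>B\<close> and \<open>C\<close> have the vertex \<open>B\<close>
  and \<open>C\<close> respectively, so that \<open>B.C\<close> and \<open>C.C\<close> state that
  \<open>B\<close> and \<open>C\<close> are categories.\<close>

locale cat_cones_change = cat_cones +
  fixes B C u assumes P_B: "P B" and P_C: "P C" and u: "is_functor B C u"
begin

sublocale B: cat_cones_at D J F P B by unfold_locales (rule P_B)
sublocale C: cat_cones_at D J F P C by unfold_locales (rule P_C)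

context
  fixes H assumes H: "is_functor C L H"
begin

lemma precomp_functor: "is_functor B L (fcomp B H u)"
  using is_functor_fcomp[OF B.C u H] .

lemma proj_precomp: "B.proj a (fcomp B H u) = fcomp B (C.proj a H) u"
  unfolding B.proj_def fcomp_def[of B "C.proj a H"] using u
  by (auto intro!: mk_functor_cong simp: C.proj_def)

lemma swap_proj_precomp:
  assumes a: "a \<in> Ob D"
  shows "j \<in> Obj (P0 J a) \<Longrightarrow> fcomp B (swap_at C (C.proj a H) j) u = swap_at B (B.proj a (fcomp B H u)) j"
    and "fcomp (P0 J a) (pre_comp (Cat_of P) B C (P0 F a) u) (swap C (P0 J a) (C.proj a H)) =
      swap B (P0 J a) (B.proj a (fcomp B H u))"
  unfolding proj_precomp
  using swap_precomp[OF J.cat[OF a] B.C C.C G.cat[OF a] C.is_functor_proj[OF H a] u] by blast+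

text \<open>Pulling back along \<open>u\<close> affects only the vertex variable and so passes
  through the exchange. For the structure cells, the sources agree because precomposition with
  \<open>u\<close> commutes with postcomposition, the targets by associativity, and the components
  by evaluation at objects of \<open>B\<close>.\<close>

lemma cone_pull_curry_obj:
  "cone_pull (Cat_of P) D J F B C u (C.curry_obj H) = B.curry_obj (fcomp B H u)"
proof -
  have T1: "whisker_left (P0 J a) (pre_comp (Cat_of P) B C (P0 F b) u) (T1 (C.curry_obj H) a b f) =
      T1 (B.curry_obj (fcomp B H u)) a b f"
    if a: "a \<in> Ob D" "b \<in> Ob D" and f: "f \<in> Obj (Hom D a b)" for a b f
  proof -
    note S = C.swap_proj[OF H a(1)] and Ja = J.cat[OF a(1)] and Jf = J.map1[OF a f] and Ff = G.map1[OF a f]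
    note c = G.cat[OF a(1)] G.cat[OF a(2)]
    note Sf = functor_simps(1,2)[OF S(1)]
    have "fcomp (P0 J a) (pre_comp (Cat_of P) B C (P0 F b) u)
        (fcomp (P0 J a) (post_comp (Cat_of P) C (P0 F a) (P0 F b) (FO (P1 F a b) f)) (swap C (P0 J a) (C.proj a H))) =
      fcomp (P0 J a) (post_comp (Cat_of P) B (P0 F a) (P0 F b) (FO (P1 F a b) f))
        (fcomp (P0 J a) (pre_comp (Cat_of P) B C (P0 F a) u) (swap C (P0 J a) (C.proj a H)))"
      unfolding fcomp_def[of "P0 J a"]
      using pre_comp_post_comp[OF B.C C.C c u Ff, where P = P] Sf
      by (intro mk_functor_cong) (simp_all del: swap_simps post_comp_Cat_of pre_comp_Cat_of)
    moreover have "fcomp (P0 J a) (pre_comp (Cat_of P) B C (P0 F b) u)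
        (fcomp (P0 J a) (swap C (P0 J b) (C.proj b H)) (FO (P1 J a b) f)) =
      fcomp (P0 J a) (fcomp (P0 J b) (pre_comp (Cat_of P) B C (P0 F b) u) (swap C (P0 J b) (C.proj b H))) (FO (P1 J a b) f)"
      by (rule fcomp_assoc[OF Jf, symmetric])
    moreover have "FA (pre_comp (Cat_of P) B C (P0 F b) u) (C.curry_cell H a b f j) =
        B.curry_cell (fcomp B H u) a b f j" if j: "j \<in> Obj (P0 J a)" for j
    proof -
      have j': "FO (FO (P1 J a b) f) j \<in> Obj (P0 J b)" using functor_simps(1)[OF Jf j] .
      have "FA (pre_comp (Cat_of P) B C (P0 F b) u) (C.curry_cell H a b f j) = whisker_right B (C.curry_cell H a b f j) u"
        using C.is_nt_curry_cell[OF H a f j] u c by simp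
      also have "\<dots> = B.curry_cell (fcomp B H u) a b f j"
        unfolding whisker_right_def B.curry_cell_def
        using a f j j' u swap_proj_precomp(1)[OF a(1) j] swap_proj_precomp(1)[OF a(2) j']
        by (auto simp: C.curry_cell_simps[OF H] fcomp_assoc[OF u] intro!: mk_nt_cong)
      finally show ?thesis .
    qed
    ultimately show ?thesis
      unfolding whisker_left_def C.curry_obj_simps(2)[OF H a f] B.curry_obj_simps(2)[OF precomp_functor a f]
      using a f by (auto simp: swap_proj_precomp(2) intro!: mk_nt_cong)
  qed
  have "T0 (cone_pull (Cat_of P) D J F B C u (C.curry_obj H)) = T0 (B.curry_obj (fcomp B H u))"
    by (auto simp: cone_pull_def C.curry_obj_def B.curry_obj_def swap_proj_precomp(2) intro!: restrict_ext)
  moreover have "T1 (cone_pull (Cat_of P) D J F B C u (C.curry_obj H)) a b f = T1 (B.curry_obj (fcomp B H u)) a b f" for a b f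
  proof (cases "a \<in> Ob D \<and> b \<in> Ob D \<and> f \<in> Obj (Hom D a b)")
    case True
    then show ?thesis using T1[of a b f] by (simp add: cone_pull_def)
  next
    case False
    then show ?thesis by (auto simp: cone_pull_def B.curry_obj_def)
  qed
  ultimately show ?thesis by (simp add: ext)
qed

end

lemma cone_pull_curry_arr:
  assumes t: "is_nt C L t"
  shows "FA (cone_pull_functor (Cat_of P) D J F B C u) (C.curry_arr t) = B.curry_arr (whisker_right B t u)"
proof -
  note m = C.curry_arr_modification[OF t] and H = C.NDom_NCod_functor[OF t]
  have tu: "is_nt B L (whisker_right B t u)" using is_nt_whisker_right[OF B.C u t] .
  have "whisker_left (P0 J a) (pre_comp (Cat_of P) B C (P0 F a) u) (MAt (C.curry_arr t) a) =
      MAt (B.curry_arr (whisker_right B t u)) a" if a: "a \<in> Ob D" for a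
  proof -
    have "FA (pre_comp (Cat_of P) B C (P0 F a) u)
        (mk_nt C (swap_at C (C.proj a (NDom t)) j) (swap_at C (C.proj a (NCod t)) j) (\<lambda>c. NAt (MAt (NAt t c) a) j)) =
      mk_nt B (swap_at B (B.proj a (fcomp B (NDom t) u)) j) (swap_at B (B.proj a (fcomp B (NCod t) u)) j)
        (\<lambda>c. NAt (MAt (NAt (whisker_right B t u) c) a) j)" (is "FA _ ?n = _") if j: "j \<in> Obj (P0 J a)" for j
    proof -
      have "FA (pre_comp (Cat_of P) B C (P0 F a) u) ?n = whisker_right B ?n u"
        using C.is_nt_curry_arr_cell[OF t a j] u G.cat[OF a] by simp
      then show ?thesis
        unfolding whisker_right_def[of B ?n]
        using a j u swap_proj_precomp(1)[OF H(1) a j] swap_proj_precomp(1)[OF H(2) a j]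
        by (auto intro!: mk_nt_cong)
    qed
    then show ?thesis
      unfolding whisker_left_def C.curry_arr_simps(3)[OF a] B.curry_arr_simps(3)[OF a]
      using a swap_proj_precomp(2)[OF H(1) a] swap_proj_precomp(2)[OF H(2) a] by (auto intro!: mk_nt_cong)
  qed
  then show ?thesis
    using m cone_pull_curry_obj[OF H(1)] cone_pull_curry_obj[OF H(2)]
    by (auto simp: cone_pull_functor_def C.H.pseudo_hom_simps C.curry_arr_simps(1,2) B.curry_arr_def[of "whisker_right B t u"]
        intro!: restrict_ext simp flip: B.curry_arr_simps(3))
qed

end

text \<open>Source and target of \<open>w\<close> are two 1-cells between the same vertices, whence
  the interpretations \<open>u\<close> and \<open>v\<close>. At \<open>a\<close>, \<open>j\<close>
  and \<open>c\<close> both sides give the component at \<open>a\<close> and \<open>j\<close> of the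
  modification \<open>FA H (NAt w c)\<close>.\<close>

lemma (in cat_cones) cone_pull_cell_curry:
  assumes B: "P B" and C: "P C" and w: "is_nt B C w" and H: "is_functor C L H"
  shows "NAt (cone_pull_cell (Cat_of P) D J F B C w) (cat_cones_at.curry_obj D J F P C H) =
    cat_cones_at.curry_arr D J F P B (whisker_left B H w)"
proof -
  interpret u: cat_cones_change D J F P B C "NDom w" using w B C by unfold_locales simp_all
  interpret v: cat_cones_change D J F P B C "NCod w" using w B C by unfold_locales simp_all
  have "whisker_right (P0 J a) (pre_cell (Cat_of P) B C (P0 F a) w) (T0 (u.C.curry_obj H) a) =
      MAt (u.B.curry_arr (whisker_left B H w)) a" if a: "a \<in> Ob D" for a
  proof -
    have "whisker_left B (swap_at C (u.C.proj a H) j) w =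
        mk_nt B (swap_at B (u.B.proj a (fcomp B H (NDom w))) j) (swap_at B (u.B.proj a (fcomp B H (NCod w))) j)
        (\<lambda>c. NAt (MAt (NAt (whisker_left B H w) c) a) j)" if j: "j \<in> Obj (P0 J a)" for j
      unfolding whisker_left_def[of B "swap_at C _ j"]
      using a j w u.swap_proj_precomp(1)[OF H a j] v.swap_proj_precomp(1)[OF H a j]
      by (auto intro!: mk_nt_cong simp: u.C.proj_simps[OF H])
    moreover have "NAt (pre_cell (Cat_of P) B C (P0 F a) w) (swap_at C (u.C.proj a H) j) =
        whisker_left B (swap_at C (u.C.proj a H) j) w" if j: "j \<in> Obj (P0 J a)" for j
      using u.C.swap_proj(2)[OF H a j] w G.cat[OF a] by simp
    ultimately show ?thesis
      unfolding whisker_right_def u.B.curry_arr_simps(3)[OF a] u.C.curry_obj_simps(1)[OF H a]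
      using u.swap_proj_precomp(2)[OF H a] v.swap_proj_precomp(2)[OF H a]
      by (auto intro!: mk_nt_cong)
  qed
  then show ?thesis
    using u.C.curry_obj_pseudo_nt[OF H] u.cone_pull_curry_obj[OF H] v.cone_pull_curry_obj[OF H]
    by (auto simp: cone_pull_cell_def u.C.H.pseudo_hom_simps u.B.curry_arr_def[of "whisker_left B H w"]
        intro!: restrict_ext simp flip: u.B.curry_arr_simps(3))
qed

section \<open>Replacing \<open>L\<close> by an isomorphic category in \<open>P\<close>\<close>

lemma cat_iso_post:
  assumes C: "category C" and X: "category X" and E: "cat_iso X L E"
  shows "cat_iso (functor_cat C X) (functor_cat C L)
    (mk_functor (functor_cat C X) (fcomp C E) (whisker_left C E))"
proof -
  let ?E' = "cat_inv X L E"
  note L = cat_iso_category[OF X E] and EF = cat_iso_is_functor[OF X E] and E'F = is_functor_cat_inv[OF X E]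
  note inv = cat_inv_simps[OF X E]
  show ?thesis
  proof (rule cat_isoI[where q = "fcomp C ?E'" and r = "whisker_left C ?E'"])
    show "is_functor (functor_cat C X) (functor_cat C L)
        (mk_functor (functor_cat C X) (fcomp C E) (whisker_left C E))"
    proof (rule is_functor_mk_functor)
      show "whisker_left C E (Ident (functor_cat C X) h) = Ident (functor_cat C L) (fcomp C E h)"
        if "h \<in> Obj (functor_cat C X)" for h
        using that EF X by (auto simp: whisker_left_def intro!: mk_nt_cong)
      show "whisker_left C E (Comp (functor_cat C X) t s) =
          Comp (functor_cat C L) (whisker_left C E t) (whisker_left C E s)"
        if "t \<in> Arr (functor_cat C X)" "s \<in> Arr (functor_cat C X)" "Dom (functor_cat C X) t = Cod (functor_cat C X) s" for t s
        using that EF X by (auto simp: whisker_left_def intro!: mk_nt_cong)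
    qed (use C X EF is_functor_fcomp[OF C _ EF] is_nt_whisker_left[OF C X EF] in auto)
  next
    fix h assume "h \<in> Obj (functor_cat C L)"
    then have h: "is_functor C L h" by simp
    have "fcomp C E (fcomp C ?E' h) = h"
      using is_functor_fcomp[OF C is_functor_fcomp[OF C h E'F] EF] h inv by (intro functor_eqI[OF _ h]) auto
    then show "fcomp C ?E' h \<in> Obj (functor_cat C X) \<and>
        FO (mk_functor (functor_cat C X) (fcomp C E) (whisker_left C E)) (fcomp C ?E' h) = h"
      using is_functor_fcomp[OF C h E'F] by simp
  next
    fix h assume "h \<in> Obj (functor_cat C X)"
    then have h: "is_functor C X h" by simp
    have "fcomp C ?E' (fcomp C E h) = h"
      using is_functor_fcomp[OF C is_functor_fcomp[OF C h EF] E'F] h inv by (intro functor_eqI[OF _ h]) auto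
    then show "fcomp C ?E' (FO (mk_functor (functor_cat C X) (fcomp C E) (whisker_left C E)) h) = h"
      using h by simp
  next
    fix t assume "t \<in> Arr (functor_cat C L)"
    then have t: "is_nt C L t" by simp
    have "fcomp C E (fcomp C ?E' h) = h" if h: "is_functor C L h" for h
      using is_functor_fcomp[OF C is_functor_fcomp[OF C h E'F] EF] h inv by (intro functor_eqI[OF _ h]) auto
    then have "whisker_left C E (whisker_left C ?E' t) = t"
      unfolding whisker_left_def[of C E] using t inv by (intro mk_nt_eqI[OF t]) auto
    then show "whisker_left C ?E' t \<in> Arr (functor_cat C X) \<and>
        FA (mk_functor (functor_cat C X) (fcomp C E) (whisker_left C E)) (whisker_left C ?E' t) = t"
      using is_nt_whisker_left[OF C L E'F t] by simp
  next
    fix t assume "t \<in> Arr (functor_cat C X)"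
    then have t: "is_nt C X t" by simp
    have "fcomp C ?E' (fcomp C E h) = h" if h: "is_functor C X h" for h
      using is_functor_fcomp[OF C is_functor_fcomp[OF C h EF] E'F] h inv by (intro functor_eqI[OF _ h]) auto
    then have "whisker_left C ?E' (whisker_left C E t) = t"
      unfolding whisker_left_def[of C ?E'] using t inv by (intro mk_nt_eqI[OF t]) auto
    then show "whisker_left C ?E' (FA (mk_functor (functor_cat C X) (fcomp C E) (whisker_left C E)) t) = t"
      using t by simp
  qed
qed

text \<open>The comparison \<open>Q C\<close> is postcomposition with \<open>E\<close> followed by
  \<open>curry\<close>. Naturality splits accordingly: associativity for postcomposition, and the
  pull-back lemmas above for \<open>curry\<close>.\<close>

lemma (in cat_cones) weighted_pseudo_limit_if_cat_iso:
  assumes X: "P X" and E: "cat_iso X L E"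
  shows "weighted_pseudo_limit (Cat_of P) D J F X"
proof -
  interpret K: two_category "Cat_of P" by (rule two_category_Cat_of[OF P_category])
  note Xc = P_category[OF X] and EF = cat_iso_is_functor[OF P_category[OF X] E]
  have at: "cat_cones_at D J F P C" if "P C" for C by unfold_locales (rule that)
  define Q where "Q C = fcomp (functor_cat C X) (cat_cones_at.curry D J F P C)
    (mk_functor (functor_cat C X) (fcomp C E) (whisker_left C E))" for C
  have Q: "FO (Q C) h = cat_cones_at.curry_obj D J F P C (fcomp C E h)"
    if C: "P C" and h: "is_functor C X h" for C h
    using is_functor_fcomp[OF P_category[OF C] h EF] h unfolding Q_def cat_cones_at.curry_def[OF at[OF C]] by simp
  have Q2: "FA (Q C) t = cat_cones_at.curry_arr D J F P C (whisker_left C E t)"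
    if C: "P C" and t: "is_nt C X t" for C t
    using is_nt_whisker_left[OF P_category[OF C] Xc EF t] t unfolding Q_def cat_cones_at.curry_def[OF at[OF C]] by simp
  have "two_naturally_isomorphic (op2 (Cat_of P)) (representable (Cat_of P) X) (weighted_cones (Cat_of P) D J F)"
  proof (rule two_naturally_isomorphic_transport[where P = Q])
    show "two_category (op2 (Cat_of P))" by (rule K.two_category_op2)
    show "two_functor (op2 (Cat_of P)) CAT (representable (Cat_of P) X)"
      using K.two_functor_representable X by simp
    \<comment> \<open>In \<open>op2\<close> a 1-cell from \<open>C\<close> to \<open>B\<close> is a
      functor from \<open>B\<close> to \<open>C\<close>; hence \<open>u\<close> and \<open>w\<close>
      below run from \<open>B\<close> to \<open>C\<close>.\<close>
    fix C assume "C \<in> Ob (op2 (Cat_of P))"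
    then have C: "P C" by simp
    show "cat_iso (P0 (representable (Cat_of P) X) C) (P0 (weighted_cones (Cat_of P) D J F) C) (Q C)"
      using cat_iso_fcomp[OF category_functor_cat[OF P_category[OF C] Xc] cat_iso_post[OF P_category[OF C] Xc E]
          cat_cones_at.cat_iso_curry[OF at[OF C]]]
      by (simp add: Q_def representable_def weighted_cones_def)
    fix B assume "B \<in> Ob (op2 (Cat_of P))"
    then have B: "P B" by simp
    show "\<exists>y1 y2. P1 (weighted_cones (Cat_of P) D J F) C B = mk_functor (Hom (op2 (Cat_of P)) C B) y1 y2"
      by (auto simp: weighted_cones_def)
    show "\<exists>n. FA (P1 (weighted_cones (Cat_of P) D J F) C B) w = mk_nt (P0 (weighted_cones (Cat_of P) D J F) C)
        (FO (P1 (weighted_cones (Cat_of P) D J F) C B) (Dom (Hom (op2 (Cat_of P)) C B) w))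
        (FO (P1 (weighted_cones (Cat_of P) D J F) C B) (Cod (Hom (op2 (Cat_of P)) C B) w)) n"
      if "w \<in> Arr (Hom (op2 (Cat_of P)) C B)" for w
      using that by (auto simp: weighted_cones_def cone_pull_cell_def)
    show "NAt (FA (P1 (weighted_cones (Cat_of P) D J F) C B) w) (FO (Q C) h) =
        FA (Q B) (NAt (FA (P1 (representable (Cat_of P) X) C B) w) h)"
      if "w \<in> Arr (Hom (op2 (Cat_of P)) C B)" "h \<in> Obj (P0 (representable (Cat_of P) X) C)" for w h
    proof -
      have w: "is_nt B C w" and h: "is_functor C X h" using that by (simp_all add: representable_def)
      have "whisker_left B (fcomp C E h) w = whisker_left B E (whisker_left B h w)"
        unfolding whisker_left_def[of B E] whisker_left_def[of B "fcomp C E h"]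
        using w fcomp_assoc[OF nt_simps(1)[OF w]] fcomp_assoc[OF nt_simps(2)[OF w]] by (auto intro!: mk_nt_cong)
      then show ?thesis
        using w h Xc Q[OF C h] Q2[OF B is_nt_whisker_left[OF P_category[OF B] P_category[OF C] h w]]
          cone_pull_cell_curry[OF B C w is_functor_fcomp[OF P_category[OF C] h EF]]
        by (simp add: weighted_cones_def representable_def)
    qed
    fix u assume "u \<in> Obj (Hom (op2 (Cat_of P)) C B)"
    then have u: "is_functor B C u" by simp
    interpret u: cat_cones_change D J F P B C u using B C u by unfold_locales
    show "\<exists>fo fa. FO (P1 (weighted_cones (Cat_of P) D J F) C B) u =
        mk_functor (P0 (weighted_cones (Cat_of P) D J F) C) fo fa"
      using u by (auto simp: weighted_cones_def cone_pull_functor_def)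
    show "FO (FO (P1 (weighted_cones (Cat_of P) D J F) C B) u) (FO (Q C) h) =
        FO (Q B) (FO (FO (P1 (representable (Cat_of P) X) C B) u) h)"
      if "h \<in> Obj (P0 (representable (Cat_of P) X) C)" for h
    proof -
      have h: "is_functor C X h" using that by (simp add: representable_def)
      note Eh = is_functor_fcomp[OF P_category[OF C] h EF]
      show ?thesis
        using u h Q[OF C h] Q[OF B is_functor_fcomp[OF P_category[OF B] u h]] u.cone_pull_curry_obj[OF Eh]
          u.C.curry_obj_pseudo_nt[OF Eh] fcomp_assoc[OF u, of E h]
        by (simp add: weighted_cones_def representable_def cone_pull_functor_def u.C.H.pseudo_hom_simps)
    qed
    show "FA (FO (P1 (weighted_cones (Cat_of P) D J F) C B) u) (FA (Q C) t) =
        FA (Q B) (FA (FO (P1 (representable (Cat_of P) X) C B) u) t)"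
      if "t \<in> Arr (P0 (representable (Cat_of P) X) C)" for t
    proof -
      have t: "is_nt C X t" using that by (simp add: representable_def)
      note Et = is_nt_whisker_left[OF P_category[OF C] Xc EF t]
      have "whisker_right B (whisker_left C E t) u = whisker_left B E (whisker_right B t u)"
        unfolding whisker_right_def[of B "whisker_left C E t"] whisker_left_def[of B]
        using u by (auto intro!: mk_nt_cong simp: fcomp_assoc)
      then show ?thesis
        using u t Xc Q2[OF C t] Q2[OF B is_nt_whisker_right[OF P_category[OF B] u t]] u.cone_pull_curry_arr[OF Et]
        by (simp add: weighted_cones_def representable_def)
    qed
  qed
  then show ?thesis using X unfolding weighted_pseudo_limit_def by simp
qed

section \<open>Existence of weighted pseudo limits\<close>

lemma cat_iso_cat_inv:
  assumes A: "category A" and P: "cat_iso A B P"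
  shows "cat_iso B A (cat_inv A B P)"
  by (rule cat_isoI[OF is_functor_cat_inv[OF A P], where q = "FO P" and r = "FA P"])
    (use cat_inv_simps[OF A P] functor_simps(1,2)[OF cat_iso_is_functor[OF A P]] in simp_all)

text \<open>The structure of \<open>L\<close> is relabelled along the two injections;
  \<open>X\<close> inherits the category laws by \<open>cat_iso_category\<close>, and
  \<open>E\<close> is the inverse relabelling.\<close>

lemma cat_iso_transport:
  fixes L :: "('p, 'b) cat" and e0 :: "'p \<Rightarrow> 'o" and e1 :: "'b \<Rightarrow> 'a"
  assumes L: "category L" and e0: "inj_on e0 (Obj L)" and e1: "inj_on e1 (Arr L)"
  obtains X E where "category X" and "cat_iso X L E" and "Obj X = e0 ` Obj L" and "Arr X = e1 ` Arr L"
proof -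
  let ?d0 = "inv_into (Obj L) e0" and ?d1 = "inv_into (Arr L) e1"
  define X where "X = \<lparr>Obj = e0 ` Obj L, Arr = e1 ` Arr L,
    Dom = (\<lambda>f. e0 (Dom L (?d1 f))), Cod = (\<lambda>f. e0 (Cod L (?d1 f))),
    Ident = (\<lambda>x. e1 (Ident L (?d0 x))), Comp = (\<lambda>g f. e1 (Comp L (?d1 g) (?d1 f)))\<rparr>"
  have E: "is_functor L X (mk_functor L e0 e1)"
    by (rule is_functor_mk_functor[OF L]) (use L e0 e1 in \<open>simp_all add: X_def\<close>)
  have iso: "cat_iso L X (mk_functor L e0 e1)"
    by (rule cat_isoI[OF E, where q = ?d0 and r = ?d1])
      (use e0 e1 in \<open>auto simp: X_def\<close>)
  show thesis
    by (rule that[of X, OF cat_iso_category[OF L iso] cat_iso_cat_inv[OF L iso]]) (simp_all add: X_def)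
qed

theorem theorem5p16:
  fixes elts :: "'u \<Rightarrow> 'u set"
    and D :: "('u, 'u, 'u) two_cat"
    and J F :: "('u, 'u, 'u, 'u, 'u) cat_pseudo_functr"
  assumes "set_universe elts"
    and "small_two_category elts D"
    and "pseudo_functor D (Cat elts) J"
    and "pseudo_functor D (Cat elts) F"
  shows "\<exists>X. weighted_pseudo_limit (Cat elts) D J F X"
proof -
  interpret set_universe elts by fact
  have D: "two_category D" using assms(2) by (simp add: small_two_category_def)
  have P: "small_category elts A \<Longrightarrow> category A" for A by (simp add: small_category_def)
  note J = assms(3)[unfolded Cat_def] and F = assms(4)[unfolded Cat_def]
  have JP: "small_category elts (P0 J a)" and FP: "small_category elts (P0 F a)" if "a \<in> Ob D" for a
    using pseudo_functor.ob[OF J that] pseudo_functor.ob[OF F that] by simp_all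
  \<comment> \<open>The class \<open>P\<close> is now smallness, so that \<open>Cat_of P\<close> is
    \<open>Cat elts\<close>.\<close>
  interpret cat_cones D J F "small_category elts"
    by (intro cat_cones.intro cat_cones_axioms.intro cat_diagrams.intro
        cat_diagram_pseudo_functor[OF D P J] cat_diagram_pseudo_functor[OF D P F] P FP)
  \<comment> \<open>Cones and modifications are named in \<open>'u\<close> independently of each
    other, since the objects and the arrows of a category are separate sets.\<close>
  obtain e0 :: "_ \<Rightarrow> 'u" where e0: "inj_on e0 (Obj L)" "small elts (e0 ` Obj L)"
    using ess_small_inj[OF ess_small_pseudo_hom(1)[OF assms(1,2) JP FP]] by blast
  obtain e1 :: "_ \<Rightarrow> 'u" where e1: "inj_on e1 (Arr L)" "small elts (e1 ` Arr L)"
    using ess_small_inj[OF ess_small_pseudo_hom(2)[OF assms(1,2) JP FP]] by blast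
  obtain X E where X: "category X" "cat_iso X L E" "Obj X = e0 ` Obj L" "Arr X = e1 ` Arr L"
    using cat_iso_transport[OF category_pseudo_hom e0(1) e1(1)] .
  have "small_category elts X" using X e0 e1 by (simp add: small_category_def)
  then show ?thesis
    unfolding Cat_def using weighted_pseudo_limit_if_cat_iso X(2) by blast
qed

end
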